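(* Let $t\ge -2$ be a real number and let $I$ be a quasi homogeneous ideal in $\mathbb{C}[x,y]$. Then the closure $\overline{I}$ of $I$ in $\mathcal{H}_2^{(t)}$, as a submodule of $\mathcal{H}_2^{(t)}$, is $p$-essentially normal for all $p>2$.
   Context: For real $t\ge -2$, $\mathcal{H}_2^{(t)}$ is the reproducing kernel Hilbert space on the unit ball of $\mathbb{C}^2$ with kernel $(1-\langle z,w\rangle)^{-(t+3)}$. Equivalently, it is the completion of $\mathbb{C}[x,y]$ with respect to the inner product making all monomials orthogonal with $\|x^{a}y^{b}\|_t^2=a!\,b!/\prod_{i=1}^{a+b}(2+t+i)$. The operators $S_1,S_2$ of multiplication by the coordinate functions $x,y$ are bounded on it. For a pair $\mathbf{n}=(n_1,n_2)$ of positive integers, a polynomial is $\mathbf{n}$-quasi homogeneous of degree $m$ if every monomial $x^ay^b$ appearing in it satisfies $n_1a+n_2b=m$. An ideal is quasi homogeneous if, for some such $\mathbf{n}$, it is generated by $\mathbf{n}$-quasi homogeneous polynomials. For a closed subspace $N\subseteq\mathcal{H}_2^{(t)}$ invariant under $S_1,S_2$ (a submodule), put $T_i=S_i|_N$. For $p\ge 1$, $N$ is $p$-essentially normal if $[T_i,T_j^*]=T_iT_j^*-T_j^*T_i$ belongs to the Schatten class $\mathcal{L}^p$ for all $i,j$. *)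

theory Defs
  imports
    "HOL-Analysis.Analysis"
    "HOL-Library.Poly_Mapping"
    "HOL-Library.Function_Algebras"
begin

section \<open>Quasi homogeneous ideals of the polynomial ring in two variables\<close>

text \<open>
  The ring of complex polynomials in x, y is the monoid algebra of the additive monoid of
  exponent pairs: the coefficient of x^a y^b in p is \<open>lookup p (a, b)\<close>, and the product of
  \<open>poly_mapping\<close> is the Cauchy product.
\<close>

type_synonym cpoly2 = "(nat \<times> nat) \<Rightarrow>\<^sub>0 complex"

interpretation cpoly2: module "(*) :: cpoly2 \<Rightarrow> cpoly2 \<Rightarrow> cpoly2"
  by standard (simp_all add: algebra_simps)

definition quasi_homogeneous :: "nat \<Rightarrow> nat \<Rightarrow> nat \<Rightarrow> cpoly2 \<Rightarrow> bool" where
  "quasi_homogeneous n1 n2 m p \<longleftrightarrow> (\<forall>(a, b) \<in> Poly_Mapping.keys p. n1 * a + n2 * b = m)"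

text \<open>
  The ring is a module over itself, so \<open>cpoly2.span G\<close> is the ideal generated by G.
  The weights are common to all generators, the degrees are not.
\<close>

definition quasi_homogeneous_ideal :: "cpoly2 set \<Rightarrow> bool" where
  "quasi_homogeneous_ideal I \<longleftrightarrow>
     (\<exists>n1 > 0. \<exists>n2 > 0. \<exists>G. (\<forall>g \<in> G. \<exists>m. quasi_homogeneous n1 n2 m g) \<and> I = cpoly2.span G)"

section \<open>The weighted spaces on the unit ball of \<open>\<complex>\<^sup>2\<close>\<close>

text \<open>
  A function in the space with parameter t is represented by its family of Taylor coefficients
  at the origin, \<open>f (a, b)\<close> being the coefficient of x^a y^b. The space is then the weighted
  square-summable space with weights the squared norms of the monomials, which is the completion
  of the polynomials. The reciprocals of the weights are the Taylor coefficients of the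
  reproducing kernel:
  (1 - <z,w>)^(-(t+3)) is the sum of (z1 * cnj w1)^a * (z2 * cnj w2)^b / weight t (a, b).
  A polynomial p is embedded as \<open>lookup p\<close>.
\<close>

type_synonym coeffs = "nat \<times> nat \<Rightarrow> complex"

definition weight :: "real \<Rightarrow> nat \<times> nat \<Rightarrow> real" where
  "weight t = (\<lambda>(a, b). fact a * fact b / (\<Prod>i = 1..a + b. 2 + t + real i))"

definition hspace :: "real \<Rightarrow> coeffs set" where
  "hspace t = {f. (\<lambda>k. (cmod (f k))\<^sup>2 * weight t k) summable_on UNIV}"

definition hinner :: "real \<Rightarrow> coeffs \<Rightarrow> coeffs \<Rightarrow> complex" where
  "hinner t f g = (\<Sum>\<^sub>\<infinity>k. f k * cnj (g k) * complex_of_real (weight t k))"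

definition hnorm :: "real \<Rightarrow> coeffs \<Rightarrow> real" where
  "hnorm t f = sqrt (Re (hinner t f f))"

definition cscale :: "complex \<Rightarrow> coeffs \<Rightarrow> coeffs" where
  "cscale c f = (\<lambda>k. c * f k)"

interpretation coeffs: vector_space cscale
  by standard (simp_all add: cscale_def fun_eq_iff algebra_simps)

definition hclosure :: "real \<Rightarrow> coeffs set \<Rightarrow> coeffs set" where
  "hclosure t X = {f \<in> hspace t. \<forall>e > 0. \<exists>g \<in> X. hnorm t (f - g) < e}"

definition mult_x :: "coeffs \<Rightarrow> coeffs" where
  "mult_x f = (\<lambda>(a, b). if a = 0 then 0 else f (a - 1, b))"

definition mult_y :: "coeffs \<Rightarrow> coeffs" where
  "mult_y f = (\<lambda>(a, b). if b = 0 then 0 else f (a, b - 1))"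

definition submodule :: "real \<Rightarrow> coeffs set \<Rightarrow> bool" where
  "submodule t N \<longleftrightarrow>
     N \<subseteq> hspace t \<and> coeffs.subspace N \<and> hclosure t N = N \<and>
     (\<forall>f \<in> N. mult_x f \<in> N \<and> mult_y f \<in> N)"

section \<open>Operators on a closed subspace\<close>

text \<open>
  An operator on a closed subspace N of \<open>hspace t\<close> is a function whose values outside N are
  irrelevant. In particular the restriction of \<open>mult_x\<close> to N is \<open>mult_x\<close> regarded as an operator
  on N; its adjoint \<open>adjoint_on t N mult_x\<close> is taken in N and depends on N.
\<close>

definition operator_on :: "coeffs set \<Rightarrow> (coeffs \<Rightarrow> coeffs) \<Rightarrow> bool" where
  "operator_on N A \<longleftrightarrow>
     (\<forall>f \<in> N. A f \<in> N) \<and>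
     (\<forall>f \<in> N. \<forall>g \<in> N. A (f + g) = A f + A g) \<and>
     (\<forall>c. \<forall>f \<in> N. A (cscale c f) = cscale c (A f))"

definition adjoint_on :: "real \<Rightarrow> coeffs set \<Rightarrow> (coeffs \<Rightarrow> coeffs) \<Rightarrow> coeffs \<Rightarrow> coeffs" where
  "adjoint_on t N A g = (THE h. h \<in> N \<and> (\<forall>f \<in> N. hinner t (A f) g = hinner t f h))"

definition commutator :: "(coeffs \<Rightarrow> coeffs) \<Rightarrow> (coeffs \<Rightarrow> coeffs) \<Rightarrow> coeffs \<Rightarrow> coeffs" where
  "commutator A B f = A (B f) - B (A f)"

definition compact_on :: "real \<Rightarrow> coeffs set \<Rightarrow> (coeffs \<Rightarrow> coeffs) \<Rightarrow> bool" where
  "compact_on t N A \<longleftrightarrow>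
     operator_on N A \<and>
     (\<forall>f :: nat \<Rightarrow> coeffs. (\<forall>n. f n \<in> N \<and> hnorm t (f n) \<le> 1) \<longrightarrow>
        (\<exists>r g. strict_mono r \<and> g \<in> N \<and> (\<lambda>n. hnorm t (A (f (r n)) - g)) \<longlonglongrightarrow> 0))"

text \<open>
  The singular values of A are the square roots of the eigenvalues of A* A. The multiplicity of
  s > 0 is the dimension of the eigenspace for s^2, which is 0 if s is not a singular value.
  For compact A these dimensions are finite, so the convention that \<open>dim\<close> is 0 on
  infinite-dimensional spaces does not interfere.
\<close>

definition singular_mult ::
    "real \<Rightarrow> coeffs set \<Rightarrow> (coeffs \<Rightarrow> coeffs) \<Rightarrow> real \<Rightarrow> nat" where
  "singular_mult t N A s =
     coeffs.dim {f \<in> N. adjoint_on t N A (A f) = cscale (complex_of_real (s\<^sup>2)) f}"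

text \<open>
  The Schatten class of exponent p: the compact operators whose sequence of nonzero singular
  values, repeated according to multiplicity, is p-summable.
\<close>

definition schatten_class :: "real \<Rightarrow> coeffs set \<Rightarrow> real \<Rightarrow> (coeffs \<Rightarrow> coeffs) set" where
  "schatten_class t N p =
     {A. compact_on t N A \<and>
         (\<lambda>s. real (singular_mult t N A s) * s powr p) summable_on {s. s > 0}}"

definition essentially_normal :: "real \<Rightarrow> real \<Rightarrow> coeffs set \<Rightarrow> bool" where
  "essentially_normal t p N \<longleftrightarrow>
     (\<forall>T \<in> {mult_x, mult_y}. \<forall>T' \<in> {mult_x, mult_y}.
        commutator T (adjoint_on t N T') \<in> schatten_class t N p)"

section \<open>Consistency of the coefficient model\<close>

lemma lookup_in_hspace: "Poly_Mapping.lookup p \<in> hspace t"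
proof -
  have "(\<lambda>k. (cmod (Poly_Mapping.lookup p k))\<^sup>2 * weight t k) summable_on Poly_Mapping.keys p"
    by (simp add: summable_on_finite)
  then show ?thesis
    unfolding hspace_def mem_Collect_eq
    by (rule summable_on_cong_neutral[THEN iffD1, rotated -1]) (auto simp: in_keys_iff)
qed

lemma hinner_monomials:
  "hinner t (Poly_Mapping.lookup (Poly_Mapping.single k 1))
            (Poly_Mapping.lookup (Poly_Mapping.single l 1)) =
   (if k = l then complex_of_real (weight t k) else 0)"
proof -
  let ?F = "\<lambda>j. Poly_Mapping.lookup (Poly_Mapping.single k 1) j *
      cnj (Poly_Mapping.lookup (Poly_Mapping.single l 1) j) * complex_of_real (weight t j)"
  have "infsum ?F UNIV = infsum ?F {k}"
    by (rule infsum_cong_neutral) (auto simp: lookup_single when_def)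
  then show ?thesis
    by (simp add: hinner_def lookup_single when_def)
qed

lemma lookup_single_times:
  "Poly_Mapping.lookup (Poly_Mapping.single k 1 * (p :: cpoly2)) (k + j) = Poly_Mapping.lookup p j"
proof -
  have "Poly_Mapping.lookup (Poly_Mapping.single k 1 * p) (k + j) =
     (\<Sum>l. (1 when k = l) * (\<Sum>q. Poly_Mapping.lookup p q when k + j = l + q))"
    by (simp add: times_poly_mapping.rep_eq prod_fun_def lookup_single)
  also have "\<dots> = (\<Sum>l. (\<Sum>q. Poly_Mapping.lookup p q when k + j = l + q) when l = k)"
    by (rule Sum_any.cong) (auto simp: when_def)
  finally show ?thesis
    by (simp add: eq_commute[of j])
qed

lemma lookup_single_times_eq_0:
  assumes "\<And>j. i \<noteq> k + j"
  shows "Poly_Mapping.lookup (Poly_Mapping.single k 1 * (p :: cpoly2)) i = 0"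
proof -
  have "Poly_Mapping.lookup (Poly_Mapping.single k 1 * p) i =
     (\<Sum>l. (1 when k = l) * (\<Sum>q. Poly_Mapping.lookup p q when i = l + q))"
    by (simp add: times_poly_mapping.rep_eq prod_fun_def lookup_single)
  also have "\<dots> = (\<Sum>l. (\<Sum>q. Poly_Mapping.lookup p q when i = l + q) when l = k)"
    by (rule Sum_any.cong) (auto simp: when_def)
  finally show ?thesis
    using assms by simp
qed

lemma mult_x_lookup:
  "mult_x (Poly_Mapping.lookup p) = Poly_Mapping.lookup (Poly_Mapping.single (1, 0) 1 * p)"
proof (rule ext, clarify)
  fix a b
  show "mult_x (Poly_Mapping.lookup p) (a, b) =
        Poly_Mapping.lookup (Poly_Mapping.single (1, 0) 1 * p) (a, b)"
    using lookup_single_times[of "(1, 0)" p "(a - 1, b)"]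
      lookup_single_times_eq_0[of "(a, b)" "(1, 0)" p]
    by (cases a) (auto simp: mult_x_def)
qed

lemma mult_y_lookup:
  "mult_y (Poly_Mapping.lookup p) = Poly_Mapping.lookup (Poly_Mapping.single (0, 1) 1 * p)"
proof (rule ext, clarify)
  fix a b
  show "mult_y (Poly_Mapping.lookup p) (a, b) =
        Poly_Mapping.lookup (Poly_Mapping.single (0, 1) 1 * p) (a, b)"
    using lookup_single_times[of "(0, 1)" p "(a, b - 1)"]
      lookup_single_times_eq_0[of "(a, b)" "(0, 1)" p]
    by (cases b) (auto simp: mult_y_def)
qed

end

theory Submission
  imports Defs "HOL-Computational_Algebra.Fundamental_Theorem_Algebra"
    "HOL-Library.Diagonal_Subsequence"
begin

text \<open>
  Let N be the closure of I with orthogonal projection Q, and write S for the coordinate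
  multiplications on the whole space. For f in N one has
  [T, T'*] f = Q [S, S'*] f - Q S (1 - Q) S'* f, and the operators (1 - Q) S* on N enter twice in
  the last term. So it suffices that [S, S'*] gains two steps of the scale of spaces (t is replaced
  by t + 2) and (1 - Q) S* gains one: the number of singular values above s is then O(1 / s^2), by
  imposing that f and [T, T'*] f vanish in low degrees.

  Up to finite codimension a quasi homogeneous ideal consists of the multiples of a product q of
  factors x, y and x^n2 - c y^n1. The adjoint of S is a coefficient operator whose commutator with
  a polynomial gains two steps of the scale, whereas removing one factor from q h loses only one
  step. Expanding S* (q h) - q S* h into iterated commutators with the factors shows that S* (q h)
  has distance O(|q h|_{t+1}) from the ideal.
\<close>

section \<open>The scale of weighted spaces\<close>

text \<open>One step of the scale divides the squared norm of a monomial of degree n by a factor of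
  order n, so it is half an order of differentiation, and an operator of order -1 gains two steps.
  Division by a product of k factors really costs k steps: already for q = x^k the norm of q y^n is
  of order n^(-k/2) times that of y^n. S* (q h) - q S* h can therefore not be estimated through the
  size of h alone; every commutator has to be matched with the factors that it consumes. The finite
  codimension of the ideal in the multiples of q concerns low degrees only, where all norms of the
  scale are comparable.

  For unequal weights the ideal need not be graded by the ordinary degree, so the commutator cannot
  be cut into blocks of fixed degree. Its bound is kept bilinear in f and its image, and low degrees
  are removed from both by linear conditions. Polynomials of degree at most l form a space of
  dimension of order l^2, and what remains is of size O(1 / l); this is where the exponent 2 comes
  from.\<close>

abbreviation lk :: "cpoly2 \<Rightarrow> coeffs" where "lk \<equiv> Poly_Mapping.lookup"

abbreviation tdeg :: "nat \<times> nat \<Rightarrow> nat" where "tdeg k \<equiv> fst k + snd k"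

lemma weight_pos: "weight t k > 0" if "t \<ge> - 2"
  using that by (auto simp: weight_def split: prod.split intro!: divide_pos_pos prod_pos)

lemma weight_nonneg [simp]: "weight t k \<ge> 0" if "t \<ge> - 2"
  using weight_pos[OF that, of k] by simp

lemma weight_Suc_fst:
  assumes "t \<ge> - 2"
  shows "weight t (Suc a, b) = weight t (a, b) * (real (Suc a) / (3 + t + real (a + b)))"
proof -
  have "(\<Prod>i = 1..Suc (a + b). 2 + t + real i) = (\<Prod>i = 1..a + b. 2 + t + real i) * (3 + t + real (a + b))"
    by (simp add: algebra_simps)
  then show ?thesis
    by (simp add: weight_def field_simps)
qed

lemma weight_swap: "weight t (b, a) = weight t (a, b)"
  by (simp add: weight_def add.commute mult.commute)

lemma weight_Suc_snd:
  assumes "t \<ge> - 2"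
  shows "weight t (a, Suc b) = weight t (a, b) * (real (Suc b) / (3 + t + real (a + b)))"
  using weight_Suc_fst[OF assms, of b a] weight_swap[of t a "Suc b"] weight_swap[of t a b]
  by (simp add: add.commute)

text \<open>Shifting t by one drops the first factor of the product in the denominator and appends
  one at its end, so the quotient of the two weights is explicit in the degree. This is what a step
  of the scale means.\<close>

lemma weight_add_1:
  assumes "t \<ge> - 2"
  shows "weight (t + 1) k = weight t k * ((3 + t) / (3 + t + real (tdeg k)))"
proof -
  have prod: "(\<Prod>i = 1..n. 2 + (t + 1) + real i) * (3 + t) = (\<Prod>i = 1..n. 2 + t + real i) * (3 + t + real n)" for n
    by (induction n) (simp_all add: algebra_simps)
  obtain a b where k: "k = (a, b)" by (cases k)
  have "(\<Prod>i = 1..n. 2 + (t + 1) + real i) > 0" "(\<Prod>i = 1..n. 2 + t + real i) > 0" for n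
    using assms by (auto intro!: prod_pos)
  note pos = this[of "a + b"]
  define P where "P = (\<Prod>i = 1..a + b. 2 + (t + 1) + real i)"
  define Q where "Q = (\<Prod>i = 1..a + b. 2 + t + real i)"
  have PQ: "P > 0" "Q > 0" "P * (3 + t) = Q * (3 + t + real (a + b))"
    using pos prod[of "a + b"] by (simp_all only: P_def Q_def)
  have "weight (t + 1) k = fact a * fact b / P" "weight t k = fact a * fact b / Q"
    by (simp_all only: k weight_def prod.case P_def Q_def)
  moreover have "1 / P = 1 / Q * ((3 + t) / (3 + t + real (a + b)))"
  proof -
    have "3 + t + real (a + b) > 0" using assms by simp
    then show ?thesis using PQ by (simp add: divide_simps mult.commute)
  qed
  ultimately show ?thesis by (simp add: k divide_inverse)
qed

definition nsq :: "real \<Rightarrow> coeffs \<Rightarrow> real" where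
  "nsq t f = (\<Sum>\<^sub>\<infinity>k. (cmod (f k))\<^sup>2 * weight t k)"

lemma hinner_self: "hinner t f f = complex_of_real (nsq t f)"
proof -
  have "hinner t f f = (\<Sum>\<^sub>\<infinity>k. complex_of_real ((cmod (f k))\<^sup>2 * weight t k))"
    unfolding hinner_def by (intro infsum_cong) (simp only: of_real_mult complex_norm_square)
  also have "\<dots> = complex_of_real (nsq t f)"
    unfolding nsq_def
  proof (cases "(\<lambda>k. (cmod (f k))\<^sup>2 * weight t k) summable_on UNIV")
    case True
    then show "(\<Sum>\<^sub>\<infinity>k. complex_of_real ((cmod (f k))\<^sup>2 * weight t k)) = complex_of_real (\<Sum>\<^sub>\<infinity>k. (cmod (f k))\<^sup>2 * weight t k)"
      by (intro infsumI has_sum_of_real has_sum_infsum)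
  next
    \<comment> \<open>A family without a sum has \<open>infsum\<close> 0, over the reals as over the
      complex numbers, so the identity persists outside \<open>hspace t\<close>.\<close>
    case False
    then have "\<not> (\<lambda>k. complex_of_real ((cmod (f k))\<^sup>2 * weight t k)) summable_on UNIV"
      using summable_on_Re[of "\<lambda>k. complex_of_real ((cmod (f k))\<^sup>2 * weight t k)" UNIV] by auto
    with False show "(\<Sum>\<^sub>\<infinity>k. complex_of_real ((cmod (f k))\<^sup>2 * weight t k)) = complex_of_real (\<Sum>\<^sub>\<infinity>k. (cmod (f k))\<^sup>2 * weight t k)"
      by (simp add: infsum_not_exists)
  qed
  finally show ?thesis .
qed

lemma nsq_nonneg [simp]: "nsq t f \<ge> 0" if "t \<ge> - 2"
  using that unfolding nsq_def by (intro infsum_nonneg) simp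

lemma hnorm_sqrt: "hnorm t f = sqrt (nsq t f)"
  by (simp add: hnorm_def hinner_self)

lemma hnorm_nonneg [simp]: "hnorm t f \<ge> 0" if "t \<ge> - 2"
  using that by (simp add: hnorm_sqrt)

lemma hnorm_sq: "(hnorm t f)\<^sup>2 = nsq t f" if "t \<ge> - 2"
  using that by (simp add: hnorm_sqrt)

text \<open>Common form of the bounds for operators that move coefficients by an injective \<phi>
  and multiply them by scalars: a comparison coefficient by coefficient yields both membership and
  the norm estimate, possibly between two different members of the scale.\<close>

lemma nsq_reindex_le:
  assumes t: "t \<ge> - 2" and inj: "inj_on \<phi> K" and f: "f \<in> hspace s" and s: "s \<ge> - 2"
    and out: "\<And>k. k \<notin> K \<Longrightarrow> g k = 0"
    and le: "\<And>k. k \<in> K \<Longrightarrow> (cmod (g k))\<^sup>2 * weight t k \<le> C * ((cmod (f (\<phi> k)))\<^sup>2 * weight s (\<phi> k))"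
    and C: "C \<ge> 0"
  shows "g \<in> hspace t \<and> nsq t g \<le> C * nsq s f"
proof -
  let ?F = "\<lambda>k. (cmod (f k))\<^sup>2 * weight s k"
  let ?G = "\<lambda>k. (cmod (g k))\<^sup>2 * weight t k"
  have F: "?F summable_on UNIV" using f by (simp add: hspace_def)
  then have FK: "?F summable_on \<phi> ` K" by (rule summable_on_subset_banach) simp
  then have FK': "(?F \<circ> \<phi>) summable_on K" using summable_on_reindex[OF inj] by blast
  then have CF: "(\<lambda>k. C * ?F (\<phi> k)) summable_on K"
    unfolding o_def by (rule summable_on_cmult_right)
  have GK: "?G summable_on K"
    by (rule summable_on_comparison_test[OF CF]) (use le t in auto)
  have eq: "?G summable_on UNIV \<longleftrightarrow> ?G summable_on K"
    by (rule summable_on_cong_neutral) (auto simp: out)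
  have "nsq t g = infsum ?G K"
    unfolding nsq_def by (rule infsum_cong_neutral) (auto simp: out)
  also have "\<dots> \<le> infsum (\<lambda>k. C * ?F (\<phi> k)) K"
    by (rule infsum_mono[OF GK CF]) (use le in auto)
  also have "\<dots> = C * infsum (?F \<circ> \<phi>) K"
    unfolding o_def using FK' by (intro infsum_cmult_right) (auto simp: o_def)
  also have "infsum (?F \<circ> \<phi>) K = infsum ?F (\<phi> ` K)"
    by (rule infsum_reindex[OF inj, symmetric])
  also have "\<dots> \<le> nsq s f"
    unfolding nsq_def by (rule infsum_mono2[OF FK F]) (use s in auto)
  finally show ?thesis using GK eq C by (auto simp: hspace_def intro: mult_left_mono)
qed

lemma nsq_pointwise_le:
  assumes "t \<ge> - 2" "s \<ge> - 2" "f \<in> hspace s" "C \<ge> 0"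
    and "\<And>k. (cmod (g k))\<^sup>2 * weight t k \<le> C * ((cmod (f k))\<^sup>2 * weight s k)"
  shows "g \<in> hspace t \<and> nsq t g \<le> C * nsq s f"
  using nsq_reindex_le[of t id UNIV f s g C] assms by auto

lemma weight_add_1_le: "weight (t + 1) k \<le> weight t k" if "t \<ge> - 2"
proof -
  have "(3 + t) / (3 + t + real (tdeg k)) \<le> 1" using that by simp
  then show ?thesis
    using weight_add_1[OF that, of k] weight_pos[OF that, of k]
    by (metis mult.right_neutral mult_left_mono less_eq_real_def)
qed

lemma nsq_add_1_le:
  assumes "t \<ge> - 2" "f \<in> hspace t"
  shows "f \<in> hspace (t + 1) \<and> nsq (t + 1) f \<le> nsq t f"
  using nsq_pointwise_le[of "t + 1" t f 1 f] weight_add_1_le[of t] assms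
  by (simp add: mult_left_mono)

lemma weight_antimono: "weight (t + real n) k \<le> weight t k" if "t \<ge> - 2"
proof (induction n)
  case (Suc n)
  have "weight (t + real n + 1) k \<le> weight (t + real n) k"
    using weight_add_1_le that by simp
  then show ?case using Suc by (simp add: algebra_simps)
qed simp

lemma nsq_antimono:
  assumes "t \<ge> - 2" "f \<in> hspace t"
  shows "f \<in> hspace (t + real n) \<and> nsq (t + real n) f \<le> nsq t f"
  using nsq_pointwise_le[of "t + real n" t f 1 f] weight_antimono[of t] assms
  by (simp add: mult_left_mono)

section \<open>The inner product\<close>

lemma hinner_summable:
  assumes t: "t \<ge> - 2" and "f \<in> hspace t" "g \<in> hspace t"
  shows "(\<lambda>k. f k * cnj (g k) * complex_of_real (weight t k)) summable_on UNIV"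
proof (rule abs_summable_summable, rule summable_on_comparison_test)
  show "(\<lambda>k. (cmod (f k))\<^sup>2 * weight t k + (cmod (g k))\<^sup>2 * weight t k) summable_on UNIV"
    using assms by (intro summable_on_add) (auto simp: hspace_def)
  fix k :: "nat \<times> nat"
  have "2 * (cmod (f k) * cmod (g k)) \<le> (cmod (f k))\<^sup>2 + (cmod (g k))\<^sup>2"
    using sum_squares_bound[of "cmod (f k)" "cmod (g k)"] by simp
  moreover have "cmod (f k) * cmod (g k) \<ge> 0" by simp
  ultimately have "cmod (f k) * cmod (g k) \<le> (cmod (f k))\<^sup>2 + (cmod (g k))\<^sup>2" by linarith
  from mult_right_mono[OF this weight_nonneg[OF t]]
  show "cmod (f k * cnj (g k) * complex_of_real (weight t k))
      \<le> (cmod (f k))\<^sup>2 * weight t k + (cmod (g k))\<^sup>2 * weight t k"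
    using t by (simp add: norm_mult distrib_right)
qed auto

lemma hspace_add:
  assumes t: "t \<ge> - 2" and "f \<in> hspace t" "g \<in> hspace t"
  shows "f + g \<in> hspace t"
  unfolding hspace_def mem_Collect_eq
proof (rule summable_on_comparison_test)
  show "(\<lambda>k. 2 * ((cmod (f k))\<^sup>2 * weight t k) + 2 * ((cmod (g k))\<^sup>2 * weight t k)) summable_on UNIV"
    using assms by (intro summable_on_add summable_on_cmult_right) (auto simp: hspace_def)
  fix k :: "nat \<times> nat"
  have "(cmod ((f + g) k))\<^sup>2 \<le> (cmod (f k) + cmod (g k))\<^sup>2"
    by (intro power_mono) (simp_all add: norm_triangle_ineq)
  also have "\<dots> \<le> 2 * (cmod (f k))\<^sup>2 + 2 * (cmod (g k))\<^sup>2"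
    using sum_squares_bound[of "cmod (f k)" "cmod (g k)"] unfolding power2_sum by linarith
  finally have "(cmod ((f + g) k))\<^sup>2 \<le> 2 * (cmod (f k))\<^sup>2 + 2 * (cmod (g k))\<^sup>2" .
  from mult_right_mono[OF this weight_nonneg[OF t, of k]]
  show "(cmod ((f + g) k))\<^sup>2 * weight t k \<le> 2 * ((cmod (f k))\<^sup>2 * weight t k) + 2 * ((cmod (g k))\<^sup>2 * weight t k)"
    by (simp add: distrib_right mult.assoc)
qed (simp add: t)

lemma hspace_scale: "cscale c f \<in> hspace t" if "f \<in> hspace t"
proof -
  have "(\<lambda>k. (cmod c)\<^sup>2 * ((cmod (f k))\<^sup>2 * weight t k)) summable_on UNIV"
    using that by (intro summable_on_cmult_right) (auto simp: hspace_def)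
  then show ?thesis
    by (simp add: hspace_def cscale_def norm_mult power_mult_distrib mult.assoc)
qed

lemma hspace_zero [simp]: "0 \<in> hspace t"
  by (simp add: hspace_def)

lemma subspace_hspace: "coeffs.subspace (hspace t)" if "t \<ge> - 2"
  using that by (auto simp: coeffs.subspace_def hspace_add hspace_scale)

lemma hspace_diff: "f - g \<in> hspace t" if "t \<ge> - 2" "f \<in> hspace t" "g \<in> hspace t"
  using coeffs.subspace_diff[OF subspace_hspace] that by blast

lemma hinner_add_left:
  assumes "t \<ge> - 2" "f \<in> hspace t" "g \<in> hspace t" "h \<in> hspace t"
  shows "hinner t (f + g) h = hinner t f h + hinner t g h"
  unfolding hinner_def using hinner_summable[OF assms(1,2,4)] hinner_summable[OF assms(1,3,4)]
  by (subst infsum_add[symmetric]) (auto simp: algebra_simps)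

lemma hinner_scale_left: "hinner t (cscale c f) h = c * hinner t f h"
  unfolding hinner_def cscale_def by (simp add: infsum_cmult_right' mult.assoc)

lemma hinner_commute: "hinner t g f = cnj (hinner t f g)"
  unfolding hinner_def infsum_cnj[symmetric] by (intro infsum_cong) (simp add: mult_ac)

lemma hinner_add_right:
  assumes "t \<ge> - 2" "f \<in> hspace t" "g \<in> hspace t" "h \<in> hspace t"
  shows "hinner t h (f + g) = hinner t h f + hinner t h g"
  using hinner_add_left[OF assms] by (metis hinner_commute complex_cnj_add)

lemma hinner_scale_right: "hinner t h (cscale c f) = cnj c * hinner t h f"
  by (metis hinner_commute hinner_scale_left complex_cnj_mult)

lemma diff_eq_add_cscale: "f - g = f + cscale (- 1) g"
  by (simp add: cscale_def fun_eq_iff)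

lemma hinner_diff_left:
  assumes "t \<ge> - 2" "f \<in> hspace t" "g \<in> hspace t" "h \<in> hspace t"
  shows "hinner t (f - g) h = hinner t f h - hinner t g h"
  using hinner_add_left[OF assms(1,2) hspace_scale[OF assms(3)] assms(4), of "- 1"]
  unfolding diff_eq_add_cscale hinner_scale_left by simp

lemma hinner_diff_right:
  assumes "t \<ge> - 2" "f \<in> hspace t" "g \<in> hspace t" "h \<in> hspace t"
  shows "hinner t h (f - g) = hinner t h f - hinner t h g"
  using hinner_diff_left[OF assms] by (metis hinner_commute complex_cnj_diff)

lemma hinner_zero_left [simp]: "hinner t 0 h = 0" and hinner_zero_right [simp]: "hinner t h 0 = 0"
  by (simp_all add: hinner_def)

lemma nsq_scale: "nsq t (cscale c f) = (cmod c)\<^sup>2 * nsq t f"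
  unfolding nsq_def cscale_def by (simp add: infsum_cmult_right' norm_mult power_mult_distrib mult.assoc)

lemma hnorm_scale: "hnorm t (cscale c f) = cmod c * hnorm t f"
  by (simp add: hnorm_sqrt nsq_scale real_sqrt_mult)

lemma hnorm_minus_commute: "hnorm t (f - g) = hnorm t (g - f)"
  by (simp add: hnorm_sqrt nsq_def norm_minus_commute)

lemma hnorm_minus: "hnorm t (- f) = hnorm t f"
  by (simp add: hnorm_sqrt nsq_def)

lemma hnorm_zero [simp]: "hnorm t 0 = 0"
  by (simp add: hnorm_def)

lemma nsq_add:
  assumes "t \<ge> - 2" "f \<in> hspace t" "g \<in> hspace t"
  shows "nsq t (f + g) = nsq t f + nsq t g + 2 * Re (hinner t f g)"
proof -
  have "hinner t (f + g) (f + g) = hinner t f f + hinner t g g + (hinner t f g + cnj (hinner t f g))"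
    using assms by (simp add: hinner_add_left hinner_add_right hspace_add hinner_commute[of t g f])
  then have "complex_of_real (nsq t (f + g)) = complex_of_real (nsq t f + nsq t g + 2 * Re (hinner t f g))"
    by (simp add: hinner_self complex_add_cnj)
  then show ?thesis using of_real_eq_iff by blast
qed

lemma coord_le_nsq:
  assumes "t \<ge> - 2" "f \<in> hspace t"
  shows "(cmod (f k))\<^sup>2 * weight t k \<le> nsq t f"
proof -
  have "infsum (\<lambda>k. (cmod (f k))\<^sup>2 * weight t k) {k} \<le> nsq t f"
    unfolding nsq_def using assms by (intro infsum_mono2) (auto simp: hspace_def)
  then show ?thesis by simp
qed

lemma nsq_eq_0:
  assumes "t \<ge> - 2" "f \<in> hspace t" "nsq t f = 0"
  shows "f = 0"
proof
  fix k
  show "f k = 0 k"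
    using coord_le_nsq[OF assms(1,2), of k] assms(3) weight_pos[OF assms(1), of k]
    by (simp add: mult_le_0_iff)
qed

text \<open>The chosen multiple of g minimizes the norm. This yields both the Cauchy-Schwarz
  inequality and, in \<open>proj_ex\<close>, the orthogonality of the error of a nearest
  point.\<close>

lemma nsq_minus_component:
  assumes t: "t \<ge> - 2" and f: "f \<in> hspace t" and g: "g \<in> hspace t" and pos: "nsq t g > 0"
  shows "nsq t (f + cscale (- hinner t f g / nsq t g) g) = nsq t f - (cmod (hinner t f g))\<^sup>2 / nsq t g"
proof -
  define z where "z = - hinner t f g / nsq t g"
  have 1: "nsq t (f + cscale z g) = nsq t f + (cmod z)\<^sup>2 * nsq t g + 2 * Re (cnj z * hinner t f g)"
    using t f g by (simp add: nsq_add hspace_scale nsq_scale hinner_scale_right)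
  have 2: "cnj z * hinner t f g = - complex_of_real ((cmod (hinner t f g))\<^sup>2 / nsq t g)"
    by (simp add: z_def complex_norm_square[symmetric] mult.commute del: of_real_power)
  have 3: "(cmod z)\<^sup>2 * nsq t g = (cmod (hinner t f g))\<^sup>2 / nsq t g"
    using pos by (simp add: z_def norm_divide power_divide power2_eq_square)
  from 1 have "nsq t (f + cscale z g) = nsq t f - (cmod (hinner t f g))\<^sup>2 / nsq t g" unfolding 2 3 by simp
  then show ?thesis unfolding z_def .
qed

lemma hinner_cauchy_schwarz:
  assumes t: "t \<ge> - 2" and f: "f \<in> hspace t" and g: "g \<in> hspace t"
  shows "cmod (hinner t f g) \<le> hnorm t f * hnorm t g"
proof (cases "nsq t g = 0")
  case True
  then show ?thesis using nsq_eq_0[OF t g] t by simp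
next
  case False
  then have pos: "nsq t g > 0" using nsq_nonneg[OF t, of g] by linarith
  have "0 \<le> nsq t (f + cscale (- hinner t f g / nsq t g) g)" using t by simp
  then have "(cmod (hinner t f g))\<^sup>2 / nsq t g \<le> nsq t f"
    unfolding nsq_minus_component[OF t f g pos] by simp
  then have "(cmod (hinner t f g))\<^sup>2 \<le> nsq t f * nsq t g" using pos by (simp add: field_simps)
  then have "(cmod (hinner t f g))\<^sup>2 \<le> (hnorm t f * hnorm t g)\<^sup>2"
    using t by (simp add: power_mult_distrib hnorm_sq)
  then show ?thesis by (rule power2_le_imp_le) (simp add: t)
qed

lemma hnorm_triangle:
  assumes t: "t \<ge> - 2" and f: "f \<in> hspace t" and g: "g \<in> hspace t"
  shows "hnorm t (f + g) \<le> hnorm t f + hnorm t g"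
proof (rule power2_le_imp_le)
  have "Re (hinner t f g) \<le> hnorm t f * hnorm t g"
    using hinner_cauchy_schwarz[OF t f g] complex_Re_le_cmod order_trans by blast
  then show "(hnorm t (f + g))\<^sup>2 \<le> (hnorm t f + hnorm t g)\<^sup>2"
    using t f g by (simp add: hnorm_sq nsq_add power2_sum)
qed (use t in simp)

lemma hnorm_triangle_diff:
  assumes t: "t \<ge> - 2" and f: "f \<in> hspace t" and g: "g \<in> hspace t"
  shows "hnorm t (f - g) \<le> hnorm t f + hnorm t g"
  using hnorm_triangle[OF t f hspace_scale[OF g], of "- 1"]
  unfolding diff_eq_add_cscale hnorm_scale by simp

lemma hnorm_triangle_sub:
  assumes t: "t \<ge> - 2" and "f \<in> hspace t" "g \<in> hspace t" "h \<in> hspace t"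
  shows "hnorm t (f - h) \<le> hnorm t (f - g) + hnorm t (g - h)"
  using hnorm_triangle[OF t, of "f - g" "g - h"] assms by (simp add: hspace_diff)

lemma parallelogram:
  assumes t: "t \<ge> - 2" and f: "f \<in> hspace t" and g: "g \<in> hspace t"
  shows "nsq t (f + g) + nsq t (f - g) = 2 * nsq t f + 2 * nsq t g"
  using nsq_add[OF t f g] nsq_add[OF t f hspace_scale[OF g], of "- 1"]
  unfolding diff_eq_add_cscale[of f g] nsq_scale hinner_scale_right by simp

section \<open>Symmetry between the two variables\<close>

lemma weight_prod_swap: "weight t (prod.swap k) = weight t k"
  by (cases k) (simp, rule weight_swap)

lemma hspace_swap: "f \<circ> prod.swap \<in> hspace t \<longleftrightarrow> f \<in> hspace t"
  using summable_on_reindex_bij_betw[OF bij_swap, of "\<lambda>k. (cmod (f k))\<^sup>2 * weight t k"]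
  by (simp only: hspace_def mem_Collect_eq o_def weight_prod_swap)

lemma nsq_swap: "nsq t (f \<circ> prod.swap) = nsq t f"
  using infsum_reindex_bij_betw[OF bij_swap, of "\<lambda>k. (cmod (f k))\<^sup>2 * weight t k"]
  by (simp only: nsq_def o_def weight_prod_swap)

lemma hinner_swap: "hinner t (f \<circ> prod.swap) (g \<circ> prod.swap) = hinner t f g"
  using infsum_reindex_bij_betw[OF bij_swap, of "\<lambda>k. f k * cnj (g k) * complex_of_real (weight t k)"]
  by (simp only: hinner_def o_def weight_prod_swap)

lemma swap_swap: "f \<circ> prod.swap \<circ> prod.swap = f"
  by (simp add: fun_eq_iff)

lemma mult_y_swap: "mult_y f = mult_x (f \<circ> prod.swap) \<circ> prod.swap"
  by (auto simp: mult_x_def mult_y_def fun_eq_iff)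

section \<open>Completeness and orthogonal projections\<close>

lemma nsq_le_finite_sums:
  assumes t: "t \<ge> - 2" and B: "\<And>K. finite K \<Longrightarrow> (\<Sum>k\<in>K. (cmod (f k))\<^sup>2 * weight t k) \<le> B"
  shows "f \<in> hspace t \<and> nsq t f \<le> B"
proof -
  have "(\<lambda>k. (cmod (f k))\<^sup>2 * weight t k) summable_on UNIV"
  proof (rule nonneg_bdd_above_summable_on)
    show "bdd_above (sum (\<lambda>k. (cmod (f k))\<^sup>2 * weight t k) ` {F. F \<subseteq> UNIV \<and> finite F})"
      using B by (intro bdd_aboveI[of _ B]) auto
  qed (use t in simp)
  moreover from this have "nsq t f \<le> B"
    unfolding nsq_def by (rule infsum_le_finite_sums) (use B in auto)
  ultimately show ?thesis by (simp add: hspace_def)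
qed

lemma finite_sum_le_nsq:
  assumes t: "t \<ge> - 2" and f: "f \<in> hspace t" and K: "finite K"
  shows "(\<Sum>k\<in>K. (cmod (f k))\<^sup>2 * weight t k) \<le> nsq t f"
  unfolding nsq_def using f K t by (intro finite_sum_le_infsum) (auto simp: hspace_def)

lemma cmod_coord_le:
  assumes t: "t \<ge> - 2" and f: "f \<in> hspace t"
  shows "cmod (f k) \<le> hnorm t f / sqrt (weight t k)"
proof -
  have w: "weight t k > 0" using weight_pos t by blast
  have "(cmod (f k) * sqrt (weight t k))\<^sup>2 \<le> (hnorm t f)\<^sup>2"
    using coord_le_nsq[OF t f, of k] w t by (simp add: power_mult_distrib hnorm_sq)
  then have "cmod (f k) * sqrt (weight t k) \<le> hnorm t f"
    by (rule power2_le_imp_le) (simp add: t)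
  then show ?thesis using w by (simp add: field_simps)
qed

text \<open>Each coefficient is a Cauchy sequence because the norm dominates it. Finite partial sums
  of the squared norm of F n - F m pass to the limit in m, which gives membership of the limit and
  convergence in norm at once.\<close>

lemma hspace_complete:
  fixes F :: "nat \<Rightarrow> coeffs"
  assumes t: "t \<ge> - 2" and F: "\<And>n. F n \<in> hspace t"
    and Cauchy: "\<And>e. e > 0 \<Longrightarrow> \<exists>M. \<forall>m\<ge>M. \<forall>n\<ge>M. hnorm t (F m - F n) < e"
  shows "\<exists>f\<in>hspace t. (\<lambda>n. hnorm t (F n - f)) \<longlonglongrightarrow> 0"
proof -
  have "convergent (\<lambda>n. F n k)" for k
  proof (rule Cauchy_convergent, rule metric_CauchyI)
    fix e :: real assume "e > 0"
    then have "e * sqrt (weight t k) > 0" using weight_pos[OF t] by simp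
    then obtain M where M: "\<And>m n. m \<ge> M \<Longrightarrow> n \<ge> M \<Longrightarrow> hnorm t (F m - F n) < e * sqrt (weight t k)"
      using Cauchy by blast
    have "dist (F m k) (F n k) < e" if "m \<ge> M" "n \<ge> M" for m n
    proof -
      have "dist (F m k) (F n k) = cmod ((F m - F n) k)" by (simp add: dist_norm)
      also have "\<dots> \<le> hnorm t (F m - F n) / sqrt (weight t k)"
        using cmod_coord_le[OF t] F t by (simp add: hspace_diff del: minus_apply)
      also have "\<dots> < e" using M[OF that] weight_pos[OF t, of k] by (simp add: field_simps)
      finally show ?thesis .
    qed
    then show "\<exists>M. \<forall>m\<ge>M. \<forall>n\<ge>M. dist (F m k) (F n k) < e" by blast
  qed
  then obtain f where f: "\<And>k. (\<lambda>n. F n k) \<longlonglongrightarrow> f k"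
    unfolding convergent_def by metis
  have close: "\<exists>M. \<forall>n\<ge>M. F n - f \<in> hspace t \<and> nsq t (F n - f) \<le> e\<^sup>2" if e: "e > 0" for e
  proof -
    obtain M where M: "\<And>m n. m \<ge> M \<Longrightarrow> n \<ge> M \<Longrightarrow> hnorm t (F m - F n) < e"
      using Cauchy[OF e] by blast
    have "F n - f \<in> hspace t \<and> nsq t (F n - f) \<le> e\<^sup>2" if n: "n \<ge> M" for n
    proof (rule nsq_le_finite_sums[OF t])
      fix K :: "(nat \<times> nat) set" assume K: "finite K"
      have "(\<lambda>m. \<Sum>k\<in>K. (cmod ((F n - F m) k))\<^sup>2 * weight t k) \<longlonglongrightarrow> (\<Sum>k\<in>K. (cmod ((F n - f) k))\<^sup>2 * weight t k)"
        unfolding minus_apply by (intro tendsto_intros f)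
      moreover have "(\<Sum>k\<in>K. (cmod ((F n - F m) k))\<^sup>2 * weight t k) \<le> e\<^sup>2" if "m \<ge> M" for m
      proof -
        have "(\<Sum>k\<in>K. (cmod ((F n - F m) k))\<^sup>2 * weight t k) \<le> (hnorm t (F n - F m))\<^sup>2"
          unfolding hnorm_sq[OF t] using finite_sum_le_nsq[OF t _ K] hspace_diff[OF t F F] by blast
        also have "\<dots> \<le> e\<^sup>2" using M[OF n that] t by (intro power_mono) auto
        finally show ?thesis .
      qed
      ultimately show "(\<Sum>k\<in>K. (cmod ((F n - f) k))\<^sup>2 * weight t k) \<le> e\<^sup>2"
        by (intro LIMSEQ_le_const2[of _ _ "e\<^sup>2"]) auto
    qed
    then show ?thesis by blast
  qed
  obtain n0 where "F n0 - f \<in> hspace t" using close[of 1] by auto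
  from hspace_diff[OF t F[of n0] this] have "f \<in> hspace t" by simp
  moreover have "(\<lambda>n. hnorm t (F n - f)) \<longlonglongrightarrow> 0"
  proof (rule LIMSEQ_I)
    fix r :: real assume r: "r > 0"
    then obtain M where M: "\<And>n. n \<ge> M \<Longrightarrow> nsq t (F n - f) \<le> (r / 2)\<^sup>2"
      using close[of "r / 2"] by auto
    have "hnorm t (F n - f) < r" if "n \<ge> M" for n
    proof -
      have "(hnorm t (F n - f))\<^sup>2 \<le> (r / 2)\<^sup>2" using M[OF that] t by (simp add: hnorm_sq)
      then have "hnorm t (F n - f) \<le> r / 2" by (rule power2_le_imp_le) (use r in simp)
      then show ?thesis using r by simp
    qed
    then show "\<exists>M. \<forall>n\<ge>M. norm (hnorm t (F n - f) - 0) < r" using t by auto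
  qed
  ultimately show ?thesis by blast
qed

definition closed_subspace :: "real \<Rightarrow> coeffs set \<Rightarrow> bool" where
  "closed_subspace t N \<longleftrightarrow> N \<subseteq> hspace t \<and> coeffs.subspace N \<and> hclosure t N = N"

lemma closed_subspace_limit:
  assumes t: "t \<ge> - 2" and N: "closed_subspace t N" and F: "\<And>n. F n \<in> N" and f: "f \<in> hspace t"
    and lim: "(\<lambda>n. hnorm t (F n - f)) \<longlonglongrightarrow> 0"
  shows "f \<in> N"
proof -
  have "\<exists>g\<in>N. hnorm t (f - g) < e" if "e > 0" for e
  proof -
    have "\<forall>\<^sub>F n in sequentially. hnorm t (F n - f) < e" using lim that by (rule order_tendstoD)
    then obtain n where "hnorm t (F n - f) < e" using eventually_happens trivial_limit_sequentially by blast
    then show ?thesis using F hnorm_minus_commute by metis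
  qed
  then have "f \<in> hclosure t N" using f by (simp add: hclosure_def)
  then show ?thesis using N by (simp add: closed_subspace_def)
qed

text \<open>The weak form, tested against N only, has the shape of \<open>adjoint_on\<close>.
  Adjoints in N then become projections of adjoints in the whole space.\<close>

definition proj :: "real \<Rightarrow> coeffs set \<Rightarrow> coeffs \<Rightarrow> coeffs" where
  "proj t N g = (THE h. h \<in> N \<and> (\<forall>f\<in>N. hinner t f g = hinner t f h))"

lemma proj_ex:
  assumes t: "t \<ge> - 2" and N: "closed_subspace t N" and g: "g \<in> hspace t"
  shows "\<exists>h. h \<in> N \<and> (\<forall>f\<in>N. hinner t f g = hinner t f h)"
proof -
  have NH: "\<And>f. f \<in> N \<Longrightarrow> f \<in> hspace t" and sub: "coeffs.subspace N"
    using N by (auto simp: closed_subspace_def)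
  let ?D = "(\<lambda>f. nsq t (g - f)) ` N"
  define d where "d = Inf ?D"
  have bdd: "bdd_below ?D" using t by (intro bdd_belowI[of _ 0]) auto
  have ne: "?D \<noteq> {}" using coeffs.subspace_0[OF sub] by auto
  have d_le: "d \<le> nsq t (g - f)" if "f \<in> N" for f
    unfolding d_def using bdd that by (intro cInf_lower) auto
  have "\<exists>f\<in>N. nsq t (g - f) < d + 1 / real (Suc n)" for n
  proof -
    have "Inf ?D < d + 1 / real (Suc n)" by (simp add: d_def)
    then show ?thesis using cInf_lessD[OF ne] by blast
  qed
  then obtain F where F: "\<And>n. F n \<in> N" "\<And>n. nsq t (g - F n) < d + 1 / real (Suc n)" by metis
  have FH: "F n \<in> hspace t" for n using F NH by blast
  \<comment> \<open>The midpoint of two terms lies in N and hence has squared distance at least d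
    from g. By the parallelogram law, terms that are nearly optimal are close to each other.\<close>
  have diff: "nsq t (F m - F n) \<le> 4 / real (Suc M)" if "m \<ge> M" "n \<ge> M" for m n M
  proof -
    let ?u = "g - F n" and ?v = "g - F m"
    have mid: "cscale (1/2) (F m + F n) \<in> N"
      using F sub by (intro coeffs.subspace_scale coeffs.subspace_add) auto
    have "?u + ?v = cscale 2 (g - cscale (1/2) (F m + F n))"
      by (auto simp: cscale_def fun_eq_iff algebra_simps)
    then have "nsq t (?u + ?v) = 4 * nsq t (g - cscale (1/2) (F m + F n))"
      by (simp add: nsq_scale)
    then have "nsq t (?u + ?v) \<ge> 4 * d" using d_le[OF mid] by simp
    moreover have "nsq t (?u + ?v) + nsq t (?u - ?v) = 2 * nsq t ?u + 2 * nsq t ?v"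
      by (rule parallelogram[OF t]) (use g FH t in \<open>auto intro: hspace_diff\<close>)
    moreover have "1 / real (Suc n) \<le> 1 / real (Suc M)" "1 / real (Suc m) \<le> 1 / real (Suc M)"
      using that by (simp_all add: frac_le)
    moreover have "?u - ?v = F m - F n" by simp
    ultimately show ?thesis using F(2)[of n] F(2)[of m] by simp
  qed
  have "\<exists>M. \<forall>m\<ge>M. \<forall>n\<ge>M. hnorm t (F m - F n) < e" if "e > 0" for e
  proof -
    from that have "e\<^sup>2 / 4 > 0" by simp
    then obtain M where "inverse (real (Suc M)) < e\<^sup>2 / 4" using reals_Archimedean by blast
    then have M: "4 / real (Suc M) < e\<^sup>2" by (simp add: field_simps)
    have "hnorm t (F m - F n) < e" if "m \<ge> M" "n \<ge> M" for m n
      using diff[OF that] M \<open>e > 0\<close> unfolding hnorm_sqrt by (intro real_less_lsqrt) (auto simp: t)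
    then show ?thesis by blast
  qed
  from hspace_complete[OF t FH this]
  obtain h where hH: "h \<in> hspace t" and lim: "(\<lambda>n. hnorm t (F n - h)) \<longlonglongrightarrow> 0" by blast
  have hN: "h \<in> N" by (rule closed_subspace_limit[OF t N F(1) hH lim])
  have uH: "g - h \<in> hspace t" using g hH t hspace_diff by blast
  have min: "nsq t (g - h) \<le> d"
  proof -
    have "hnorm t (g - h) \<le> sqrt (d + 1 / real (Suc n)) + hnorm t (F n - h)" for n
    proof -
      have "hnorm t (g - h) \<le> hnorm t (g - F n) + hnorm t (F n - h)"
        using hnorm_triangle_sub[OF t g FH hH] .
      moreover have "hnorm t (g - F n) \<le> sqrt (d + 1 / real (Suc n))"
        unfolding hnorm_sqrt using F(2)[of n] by (intro real_sqrt_le_mono) simp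
      ultimately show ?thesis by linarith
    qed
    moreover have "(\<lambda>n. sqrt (d + 1 / real (Suc n)) + hnorm t (F n - h)) \<longlonglongrightarrow> sqrt (d + 0) + 0"
      using LIMSEQ_inverse_real_of_nat lim unfolding inverse_eq_divide
      by (intro tendsto_add tendsto_real_sqrt tendsto_const)
    ultimately have "hnorm t (g - h) \<le> sqrt d"
      by (intro LIMSEQ_le_const[of _ "sqrt d" "hnorm t (g - h)"]) auto
    then show ?thesis by (simp add: hnorm_sqrt)
  qed
  have orth: "hinner t (g - h) f = 0" if f: "f \<in> N" for f
  proof (cases "nsq t f > 0")
    case False
    then have "f = 0" using nsq_eq_0[OF t NH[OF f]] nsq_nonneg[OF t, of f] by simp
    then show ?thesis by simp
  next
    case True
    define z where "z = - hinner t (g - h) f / nsq t f"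
    have "h - cscale z f \<in> N" using f hN sub by (intro coeffs.subspace_diff coeffs.subspace_scale)
    from d_le[OF this] min have 1: "nsq t (g - h) \<le> nsq t (g - (h - cscale z f))" by simp
    have 2: "g - (h - cscale z f) = (g - h) + cscale z f" by simp
    have "nsq t ((g - h) + cscale z f) = nsq t (g - h) - (cmod (hinner t (g - h) f))\<^sup>2 / nsq t f"
      unfolding z_def by (rule nsq_minus_component[OF t uH NH[OF f] True])
    with 1 have "(cmod (hinner t (g - h) f))\<^sup>2 / nsq t f \<le> 0" unfolding 2 by linarith
    then show ?thesis using True by (simp add: divide_le_0_iff)
  qed
  have "hinner t f g = hinner t f h" if f: "f \<in> N" for f
  proof -
    have "hinner t f (g - h) = 0" using orth[OF f] hinner_commute[of t f "g - h"] by simp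
    then show ?thesis using hinner_diff_right[OF t g hH NH[OF f]] by simp
  qed
  then show ?thesis using hN by blast
qed

text \<open>The functional \<Phi> is left arbitrary so that the same uniqueness serves projections,
  adjoints in N and the eigenvalue equation in \<open>subspace_eig\<close>.\<close>

lemma proj_unique:
  assumes t: "t \<ge> - 2" and N: "closed_subspace t N"
    and h: "h \<in> N" "\<And>f. f \<in> N \<Longrightarrow> \<Phi> f = hinner t f h"
    and h': "h' \<in> N" "\<And>f. f \<in> N \<Longrightarrow> \<Phi> f = hinner t f h'"
  shows "h = h'"
proof -
  have NH: "\<And>f. f \<in> N \<Longrightarrow> f \<in> hspace t" and sub: "coeffs.subspace N"
    using N by (auto simp: closed_subspace_def)
  have d: "h - h' \<in> N" using h h' sub coeffs.subspace_diff by blast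
  have "hinner t (h - h') (h - h') = hinner t (h - h') h - hinner t (h - h') h'"
    using hinner_diff_right[OF t] NH h h' d by simp
  also have "\<dots> = 0" using h(2)[OF d] h'(2)[OF d] by simp
  finally have "nsq t (h - h') = 0" by (simp add: hinner_self)
  then have "h - h' = 0" using nsq_eq_0[OF t] NH d by blast
  then show ?thesis by simp
qed

lemma proj_works:
  assumes "t \<ge> - 2" "closed_subspace t N" "g \<in> hspace t"
  shows "proj t N g \<in> N \<and> (\<forall>f\<in>N. hinner t f g = hinner t f (proj t N g))"
proof -
  have "\<exists>!h. h \<in> N \<and> (\<forall>f\<in>N. hinner t f g = hinner t f h)"
    using proj_ex[OF assms] proj_unique[OF assms(1,2), of _ "\<lambda>f. hinner t f g"] by blast
  from theI'[OF this] show ?thesis unfolding proj_def .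
qed

lemmas proj_in = proj_works[THEN conjunct1]

lemma hinner_proj: "hinner t f (proj t N g) = hinner t f g"
  if "t \<ge> - 2" "closed_subspace t N" "g \<in> hspace t" "f \<in> N"
  using proj_works[OF that(1-3)] that(4) by simp

lemma adjoint_on_eq:
  assumes t: "t \<ge> - 2" and N: "closed_subspace t N"
    and h: "h \<in> N" "\<And>f. f \<in> N \<Longrightarrow> hinner t (A f) g = hinner t f h"
  shows "adjoint_on t N A g = h"
  unfolding adjoint_on_def
proof (rule the_equality)
  fix h' assume "h' \<in> N \<and> (\<forall>f\<in>N. hinner t (A f) g = hinner t f h')"
  then show "h' = h" using proj_unique[OF t N, of h' "\<lambda>f. hinner t (A f) g" h] h by blast
qed (use h in blast)

lemma hinner_diff_proj:
  assumes "t \<ge> - 2" "closed_subspace t N" "g \<in> hspace t" "f \<in> N"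
  shows "hinner t f (g - proj t N g) = 0"
proof -
  have "proj t N g \<in> hspace t" "f \<in> hspace t"
    using assms proj_in by (auto simp: closed_subspace_def)
  then show ?thesis using hinner_proj[OF assms] hinner_diff_right assms by simp
qed

lemma nsq_proj_split:
  assumes t: "t \<ge> - 2" and N: "closed_subspace t N" and g: "g \<in> hspace t" and f: "f \<in> N"
  shows "nsq t (g - f) = nsq t (g - proj t N g) + nsq t (proj t N g - f)"
proof -
  have p: "proj t N g \<in> N" using proj_in[OF t N g] .
  then have d: "proj t N g - f \<in> N" using N f coeffs.subspace_diff by (auto simp: closed_subspace_def)
  have H: "proj t N g \<in> hspace t" "proj t N g - f \<in> hspace t"
    using p d N by (auto simp: closed_subspace_def)
  have "hinner t (g - proj t N g) (proj t N g - f) = 0"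
    using hinner_diff_proj[OF t N g d] hinner_commute[of t "g - proj t N g" "proj t N g - f"] by simp
  then have "nsq t ((g - proj t N g) + (proj t N g - f)) = nsq t (g - proj t N g) + nsq t (proj t N g - f)"
    using nsq_add[OF t hspace_diff[OF t g H(1)] H(2)] by simp
  then show ?thesis by simp
qed

lemma hnorm_diff_proj_le:
  assumes "t \<ge> - 2" "closed_subspace t N" "g \<in> hspace t" "f \<in> N"
  shows "hnorm t (g - proj t N g) \<le> hnorm t (g - f)"
  using nsq_proj_split[OF assms] assms(1) by (simp add: hnorm_sqrt)

lemma proj_add:
  assumes t: "t \<ge> - 2" and N: "closed_subspace t N" and g: "g \<in> hspace t" "g' \<in> hspace t"
  shows "proj t N (g + g') = proj t N g + proj t N g'"
proof (rule proj_unique[OF t N, of _ "\<lambda>f. hinner t f (g + g')"])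
  have p: "proj t N g \<in> N" "proj t N g' \<in> N" using proj_in[OF t N] g by blast+
  have NH: "\<And>f. f \<in> N \<Longrightarrow> f \<in> hspace t" and sub: "coeffs.subspace N"
    using N by (auto simp: closed_subspace_def)
  show "proj t N (g + g') \<in> N" using proj_in[OF t N] g t hspace_add by blast
  show "proj t N g + proj t N g' \<in> N" using p sub coeffs.subspace_add by blast
  fix f assume f: "f \<in> N"
  show "hinner t f (g + g') = hinner t f (proj t N (g + g'))"
    using hinner_proj[OF t N _ f] g t hspace_add by simp
  show "hinner t f (g + g') = hinner t f (proj t N g + proj t N g')"
    using hinner_proj[OF t N _ f] g t p NH f by (simp add: hinner_add_right)
qed

lemma proj_scale:
  assumes t: "t \<ge> - 2" and N: "closed_subspace t N" and g: "g \<in> hspace t"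
  shows "proj t N (cscale c g) = cscale c (proj t N g)"
proof (rule proj_unique[OF t N, of _ "\<lambda>f. hinner t f (cscale c g)"])
  have sub: "coeffs.subspace N"
    using N by (auto simp: closed_subspace_def)
  show "proj t N (cscale c g) \<in> N" using proj_in[OF t N] g hspace_scale by blast
  show "cscale c (proj t N g) \<in> N" using proj_in[OF t N g] sub coeffs.subspace_scale by blast
  fix f assume f: "f \<in> N"
  show "hinner t f (cscale c g) = hinner t f (proj t N (cscale c g))"
    using hinner_proj[OF t N _ f] g hspace_scale by simp
  show "hinner t f (cscale c g) = hinner t f (cscale c (proj t N g))"
    using hinner_proj[OF t N g f] by (simp add: hinner_scale_right)
qed

lemma hclosure_superset: "X \<subseteq> hclosure t X" if "X \<subseteq> hspace t"
proof
  fix f assume "f \<in> X"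
  moreover have "hnorm t (f - f) < e" if "e > 0" for e using that by simp
  ultimately show "f \<in> hclosure t X" using that unfolding hclosure_def by blast
qed

lemma hclosure_idem:
  assumes t: "t \<ge> - 2" and X: "X \<subseteq> hspace t"
  shows "hclosure t (hclosure t X) = hclosure t X"
proof
  show "hclosure t (hclosure t X) \<subseteq> hclosure t X"
  proof
    fix f assume f: "f \<in> hclosure t (hclosure t X)"
    then have fH: "f \<in> hspace t" by (simp add: hclosure_def)
    have "\<exists>g\<in>X. hnorm t (f - g) < e" if "e > 0" for e
    proof -
      have e: "e / 2 > 0" using that by simp
      obtain h where h: "h \<in> hclosure t X" "hnorm t (f - h) < e / 2"
        using f e unfolding hclosure_def[of t "hclosure t X"] by blast
      obtain g where g: "g \<in> X" "hnorm t (h - g) < e / 2"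
        using h(1) e unfolding hclosure_def by blast
      have "hnorm t (f - g) \<le> hnorm t (f - h) + hnorm t (h - g)"
        using hnorm_triangle_sub[OF t fH, of h g] h(1) g(1) X by (auto simp: hclosure_def)
      with h g have "hnorm t (f - g) < e" by simp
      then show ?thesis using g by blast
    qed
    then show "f \<in> hclosure t X" using fH by (simp add: hclosure_def)
  qed
  show "hclosure t X \<subseteq> hclosure t (hclosure t X)"
    by (rule hclosure_superset) (auto simp: hclosure_def)
qed

lemma closed_subspace_hclosure:
  assumes t: "t \<ge> - 2" and X: "X \<subseteq> hspace t" and sub: "coeffs.subspace X"
  shows "closed_subspace t (hclosure t X)"
  unfolding closed_subspace_def
proof (intro conjI)
  show "hclosure t (hclosure t X) = hclosure t X" by (rule hclosure_idem[OF t X])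
  show "hclosure t X \<subseteq> hspace t" by (auto simp: hclosure_def)
  show "coeffs.subspace (hclosure t X)"
    unfolding coeffs.subspace_def
  proof (intro conjI ballI allI)
    show "0 \<in> hclosure t X" using hclosure_superset[OF X] coeffs.subspace_0[OF sub] by blast
  next
    fix f g assume f: "f \<in> hclosure t X" and g: "g \<in> hclosure t X"
    then have H: "f \<in> hspace t" "g \<in> hspace t" by (auto simp: hclosure_def)
    have "\<exists>h\<in>X. hnorm t (f + g - h) < e" if "e > 0" for e
    proof -
      have e: "e / 2 > 0" using that by simp
      obtain f' where f': "f' \<in> X" "hnorm t (f - f') < e / 2" using f e unfolding hclosure_def by blast
      obtain g' where g': "g' \<in> X" "hnorm t (g - g') < e / 2" using g e unfolding hclosure_def by blast
      have "hnorm t ((f - f') + (g - g')) \<le> hnorm t (f - f') + hnorm t (g - g')"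
        using f' g' X H t by (intro hnorm_triangle hspace_diff) auto
      moreover have "(f - f') + (g - g') = f + g - (f' + g')" by simp
      ultimately have "hnorm t (f + g - (f' + g')) < e" using f' g' by simp
      then show ?thesis using coeffs.subspace_add[OF sub f'(1) g'(1)] by blast
    qed
    then show "f + g \<in> hclosure t X" using H t by (simp add: hclosure_def hspace_add)
  next
    fix c f assume f: "f \<in> hclosure t X"
    then have H: "f \<in> hspace t" by (auto simp: hclosure_def)
    have "\<exists>h\<in>X. hnorm t (cscale c f - h) < e" if "e > 0" for e
    proof -
      have e: "e / (cmod c + 1) > 0" using that by (simp add: add_nonneg_pos)
      obtain f' where f': "f' \<in> X" "hnorm t (f - f') < e / (cmod c + 1)" using f e unfolding hclosure_def by blast
      have "cscale c f - cscale c f' = cscale c (f - f')" by (simp add: cscale_def fun_eq_iff algebra_simps)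
      then have "hnorm t (cscale c f - cscale c f') = cmod c * hnorm t (f - f')" by (simp add: hnorm_scale)
      also have "\<dots> \<le> (cmod c + 1) * hnorm t (f - f')" using t by (intro mult_right_mono) auto
      also have "\<dots> < e" using f'(2) by (simp add: pos_less_divide_eq add_nonneg_pos mult.commute)
      finally show ?thesis using coeffs.subspace_scale[OF sub f'(1)] by blast
    qed
    then show "cscale c f \<in> hclosure t X" using H by (simp add: hclosure_def hspace_scale)
  qed
qed

section \<open>Lower bounds for multiplication by a factor\<close>

lemma lookup_const_times: "lk (Poly_Mapping.single 0 c * p) k = c * lk p k"
  by (simp add: mult_map_scale_conv_mult[symmetric] Poly_Mapping.map.rep_eq when_def)

lemma lookup_single_mult:
  "lk (Poly_Mapping.single (u, v) c * p) (a, b) = (if u \<le> a \<and> v \<le> b then c * lk p (a - u, b - v) else 0)"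
proof -
  have single: "Poly_Mapping.single (u, v) c = Poly_Mapping.single 0 c * Poly_Mapping.single (u, v) 1"
    by (simp add: mult_single)
  have *: "lk (Poly_Mapping.single (u, v) c * p) (a, b) = c * lk (Poly_Mapping.single (u, v) 1 * p) (a, b)"
    unfolding single mult.assoc lookup_const_times ..
  show ?thesis
  proof (cases "u \<le> a \<and> v \<le> b")
    case True
    then show ?thesis using lookup_single_times[of "(u, v)" p "(a - u, b - v)"] unfolding * by simp
  next
    case False
    then have "(a, b) \<noteq> (u, v) + j" for j by (cases j) auto
    then have "lk (Poly_Mapping.single (u, v) 1 * p) (a, b) = 0" by (rule lookup_single_times_eq_0)
    then show ?thesis using False unfolding * by auto
  qed
qed

text \<open>The quotient of the squared norms of x^(a+p) y^b and x^a y^b. By the symmetry of the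
  weights the same expression with a and b exchanged describes multiplication by a power of
  y.\<close>

definition xratio :: "real \<Rightarrow> nat \<Rightarrow> nat \<Rightarrow> nat \<Rightarrow> real" where
  "xratio t p a b = (\<Prod>i<p. (real a + 1 + real i) / (3 + t + real a + real b + real i))"

lemma weight_add_fst:
  assumes "t \<ge> - 2"
  shows "weight t (a + p, b) = weight t (a, b) * xratio t p a b"
proof (induction p)
  case (Suc p)
  then show ?case using weight_Suc_fst[OF assms, of "a + p" b] by (simp add: xratio_def algebra_simps)
qed (simp add: xratio_def)

lemma weight_add_snd:
  assumes "t \<ge> - 2"
  shows "weight t (a, b + q) = weight t (a, b) * xratio t q b a"
proof (induction q)
  case (Suc q)
  then show ?case using weight_Suc_snd[OF assms, of a "b + q"] by (simp add: xratio_def algebra_simps)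
qed (simp add: xratio_def)

lemma xratio_pos: "xratio t p a b > 0" if "t \<ge> - 2"
  unfolding xratio_def using that by (intro prod_pos) (auto intro!: divide_pos_pos add_pos_nonneg)

text \<open>Once the exponent of x dominates, every denominator is at most 2 (3 + t) times its
  numerator. Hence at each monomial at least one of the two terms of a binomial shrinks the norm by
  a bounded factor only.\<close>

lemma xratio_lower:
  assumes t: "t \<ge> - 2" and "b \<le> a"
  shows "xratio t p a b \<ge> (1 / (2 * (3 + t))) ^ p"
proof -
  have "1 / (2 * (3 + t)) \<le> (real a + 1 + real i) / (3 + t + real a + real b + real i)" for i
  proof -
    have "real a + real i \<le> (3 + t) * (real a + real i)"
      using t mult_right_mono[of 1 "3 + t" "real a + real i"] by simp
    moreover have "real b \<le> real a" using assms by simp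
    ultimately have "3 + t + real a + real b + real i \<le> (real a + 1 + real i) * (2 * (3 + t))"
      using t by (simp add: algebra_simps)
    then show ?thesis using t by (simp add: divide_simps)
  qed
  then have "(\<Prod>i<p. 1 / (2 * (3 + t))) \<le> xratio t p a b"
    unfolding xratio_def using t by (intro prod_mono) auto
  then show ?thesis by simp
qed

text \<open>
  Along the exponents of a quasi homogeneous polynomial the ratio for x increases and the one
  for y decreases. The quantitative gain in the first lemma is what makes the binomials bounded
  below up to one step of the scale.
\<close>

lemma xratio_gain:
  assumes t: "t \<ge> - 2" and p: "p > 0"
  shows "xratio t p a (b + q) \<le> (1 - real q / (3 + t + real a + real b + real q + real p)) * xratio t p (a + p) b"
proof -
  let ?l = "\<lambda>i. (real a + 1 + real i) / (3 + t + real a + real (b + q) + real i)"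
  let ?r = "\<lambda>i. (real (a + p) + 1 + real i) / (3 + t + real (a + p) + real b + real i)"
  have main: "?l i \<le> (1 - real q / (3 + t + real a + real b + real q + real i + real p)) * ?r i" for i
  proof -
    define x where "x = real a + 1 + real i"
    define y where "y = 3 + t + real a + real b + real q + real i"
    have pos: "x > 0" "y > 0" "y + real p > 0" "y + real p - real q > 0"
      using t by (auto simp: x_def y_def)
    \<comment> \<open>Since x \<le> y, adding p to numerator and denominator increases x / y. The
      ratio on the right of the claim has denominator y + p - q instead of y + p, and this
      difference is the factor 1 - q / (y + p).\<close>
    have "x * real p \<le> y * real p" using t by (intro mult_right_mono) (simp_all add: x_def y_def)
    then have "x * (y + real p) \<le> y * (x + real p)" by (simp add: algebra_simps)
    then have "x / y \<le> (x + real p) / (y + real p)" using pos by (simp add: divide_simps mult.commute)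
    also have "\<dots> = (1 - real q / (y + real p)) * ((x + real p) / (y + real p - real q))"
      using pos by (simp add: divide_simps)
    finally show ?thesis by (simp add: x_def y_def algebra_simps)
  qed
  have r_nonneg: "?r i \<ge> 0" for i using t by (intro divide_nonneg_nonneg) simp_all
  have l_nonneg: "?l i \<ge> 0" for i using t by (intro divide_nonneg_nonneg) simp_all
  have le: "?l i \<le> ?r i" for i
  proof -
    have "(1 - real q / (3 + t + real a + real b + real q + real i + real p)) * ?r i \<le> 1 * ?r i"
      using t by (intro mult_right_mono r_nonneg) auto
    with main[of i] show ?thesis by linarith
  qed
  obtain p' where p': "p = Suc p'" using p by (cases p) auto
  \<comment> \<open>Only the factor with index 0 keeps the quantitative gain; monotonicity is enough
    for the others.\<close>
  have "xratio t p a (b + q) = ?l 0 * (\<Prod>i<p'. ?l (Suc i))"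
    unfolding xratio_def p' by (rule prod.lessThan_Suc_shift)
  also have "\<dots> \<le> ((1 - real q / (3 + t + real a + real b + real q + real p)) * ?r 0) * (\<Prod>i<p'. ?r (Suc i))"
  proof (rule mult_mono)
    show "?l 0 \<le> (1 - real q / (3 + t + real a + real b + real q + real p)) * ?r 0"
      using main[of 0] by simp
    show "(\<Prod>i<p'. ?l (Suc i)) \<le> (\<Prod>i<p'. ?r (Suc i))"
      using le l_nonneg by (intro prod_mono) blast
    show "0 \<le> (1 - real q / (3 + t + real a + real b + real q + real p)) * ?r 0"
      using t r_nonneg[of 0] by (intro mult_nonneg_nonneg) auto
    show "0 \<le> (\<Prod>i<p'. ?l (Suc i))" using l_nonneg by (intro prod_nonneg) blast
  qed
  also have "\<dots> = (1 - real q / (3 + t + real a + real b + real q + real p)) * (?r 0 * (\<Prod>i<p'. ?r (Suc i)))"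
    by (simp only: mult.assoc)
  also have "?r 0 * (\<Prod>i<p'. ?r (Suc i)) = xratio t p (a + p) b"
    unfolding xratio_def p' by (rule prod.lessThan_Suc_shift[symmetric])
  finally show ?thesis .
qed

lemma xratio_mono:
  assumes t: "t \<ge> - 2"
  shows "xratio t q b (a + p) \<le> xratio t q (b + q) a"
proof (cases "q = 0")
  case False
  have "(1 - real p / (3 + t + real b + real a + real p + real q)) * xratio t q (b + q) a \<le> 1 * xratio t q (b + q) a"
    using t xratio_pos[OF t, of q "b + q" a] by (intro mult_right_mono) auto
  then show ?thesis using xratio_gain[OF t, of q b a p] False by simp
qed (simp add: xratio_def)

lemma infsum_eq_sum_image:
  fixes G :: "'b \<Rightarrow> real"
  assumes "finite K" "inj_on \<phi> K" "\<And>i. i \<notin> \<phi> ` K \<Longrightarrow> G i = 0"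
  shows "infsum G UNIV = (\<Sum>k\<in>K. G (\<phi> k))" "G summable_on UNIV"
proof -
  have "infsum G UNIV = infsum G (\<phi> ` K)" by (rule infsum_cong_neutral) (use assms(3) in auto)
  also have "\<dots> = (\<Sum>k\<in>K. G (\<phi> k))" using assms by (simp add: sum.reindex)
  finally show "infsum G UNIV = (\<Sum>k\<in>K. G (\<phi> k))" .
  have "G summable_on UNIV \<longleftrightarrow> G summable_on \<phi> ` K"
    by (rule summable_on_cong_neutral) (use assms(3) in auto)
  then show "G summable_on UNIV" using assms(1) by simp
qed

lemma nsq_lookup: "nsq t (lk h) = (\<Sum>k\<in>Poly_Mapping.keys h. (cmod (lk h k))\<^sup>2 * weight t k)"
  unfolding nsq_def by (rule infsum_eq_sum_image(1)[of _ id, simplified]) (auto simp: in_keys_iff)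

text \<open>Young's inequality 2 u v \<le> u^2 / s + s v^2. For a single pair it says little, as one
  coefficient is negative when s is not 1 and c is not 0; it becomes useful after a summation in
  which s varies with the monomial.\<close>

lemma young_complex:
  assumes "s > 0"
  shows "(1 - 1 / s) * (cmod x)\<^sup>2 + (cmod c)\<^sup>2 * (1 - s) * (cmod y)\<^sup>2 \<le> (cmod (x - c * y))\<^sup>2"
proof -
  let ?u = "cmod x" and ?v = "cmod c * cmod y"
  have "2 * (?u * ?v) \<le> ?u\<^sup>2 / s + s * ?v\<^sup>2"
  proof -
    have "0 \<le> (?u - s * ?v)\<^sup>2 / s" using assms by simp
    also have "\<dots> = ?u\<^sup>2 / s + s * ?v\<^sup>2 - 2 * (?u * ?v)"
      using assms by (simp add: power2_eq_square field_simps)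
    finally show ?thesis by simp
  qed
  moreover have "(?u - ?v)\<^sup>2 \<le> (cmod (x - c * y))\<^sup>2"
    using norm_triangle_ineq3[of x "c * y"] by (simp add: abs_le_square_iff[symmetric] norm_mult)
  moreover have "(?u - ?v)\<^sup>2 = ?u\<^sup>2 + ?v\<^sup>2 - 2 * (?u * ?v)" by (simp add: power2_diff)
  ultimately show ?thesis by (simp add: algebra_simps power_mult_distrib)
qed

text \<open>For s' = s the right side is (u - v)^2, which may vanish. The relative growth \<epsilon>
  from s to s' leaves u^2 + v^2 - (2 - \<epsilon>) u v, and 2 u v \<le> u^2 + v^2 finishes.\<close>

lemma binomial_coefficient_bound:
  fixes u v s s' \<epsilon> :: real
  assumes "u > 0" "v > 0" "s = u / v" "s \<le> (1 - \<epsilon>) * s'" "s' > 0" "\<epsilon> \<le> 1"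
  shows "\<epsilon> / 2 * (u\<^sup>2 + v\<^sup>2) \<le> u\<^sup>2 * (1 - 1 / s') + v\<^sup>2 * (1 - s)"
proof -
  have "u * v * s \<le> u * v * ((1 - \<epsilon>) * s')" using assms by (intro mult_left_mono) auto
  moreover have "u * v * s = u\<^sup>2" using assms by (simp add: power2_eq_square)
  ultimately have "u\<^sup>2 \<le> (1 - \<epsilon>) * (u * v) * s'" by (simp only: mult_ac)
  then have "u\<^sup>2 / s' \<le> (1 - \<epsilon>) * (u * v)" using assms by (simp add: pos_divide_le_eq)
  moreover have "v\<^sup>2 * s = u * v" using assms by (simp add: power2_eq_square)
  moreover have "(2 - \<epsilon>) * (2 * (u * v)) \<le> (2 - \<epsilon>) * (u\<^sup>2 + v\<^sup>2)"
    using assms sum_squares_bound[of u v] by (intro mult_left_mono) auto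
  ultimately show ?thesis by (simp add: algebra_simps)
qed

text \<open>At the exponent i the product couples the coefficients of h at i - (p, 0) and i - (0,
  q). \<open>young_complex\<close> decouples them, its parameter being the value of \<sigma> at i -
  (0, q): the ratio of the norms that the monomial there acquires from x^p and from c y^q. Regrouped
  by monomials of h, each squared coefficient meets \<sigma> at two neighbours on a line of constant
  weighted degree. There \<sigma> grows by a relative amount of order 1 / degree, and a factor 1 /
  degree is exactly one step of the scale.\<close>

lemma binomial_bounded_below:
  assumes t: "t \<ge> - 2" and p: "p > 0" and q: "q > 0" and c: "c \<noteq> 0"
  shows "\<exists>C\<ge>0. \<forall>h. nsq (t + 1) (lk h) \<le>
    C * nsq t (lk ((Poly_Mapping.single (p, 0) 1 - Poly_Mapping.single (0, q) c) * h))"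
proof -
  define d where "d = cmod c"
  have d: "d > 0" using c by (simp add: d_def)
  define \<tau> where "\<tau> = 3 + t"
  have \<tau>: "\<tau> \<ge> 1" using t by (simp add: \<tau>_def)
  define A where "A = (\<lambda>(a, b). xratio t p a b)"
  define B where "B = (\<lambda>(a, b). xratio t q b a)"
  define \<sigma> where "\<sigma> = (\<lambda>k. sqrt (A k) / (d * sqrt (B k)))"
  \<comment> \<open>A lower bound for the sum of the squared norm ratios of x^p and c y^q, from
    \<open>xratio_lower\<close> applied to whichever exponent is larger.\<close>
  define \<kappa> where "\<kappa> = min ((1 / (2 * \<tau>)) ^ p) (d\<^sup>2 * (1 / (2 * \<tau>)) ^ q)"
  have AB: "A k > 0" "B k > 0" for k using xratio_pos[OF t] by (auto simp: A_def B_def split: prod.split)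
  have \<sigma>_pos: "\<sigma> k > 0" for k using AB[of k] d by (simp add: \<sigma>_def)
  have \<kappa>_pos: "\<kappa> > 0" using \<tau> d by (auto simp: \<kappa>_def)
  have \<kappa>_le: "\<kappa> \<le> A k + d\<^sup>2 * B k" for k
  proof -
    obtain a b where k: "k = (a, b)" by (cases k)
    show ?thesis
    proof (cases "b \<le> a")
      case True
      have "\<kappa> \<le> A k" using xratio_lower[OF t True, of p] by (auto simp: \<kappa>_def A_def \<tau>_def k)
      moreover have "d\<^sup>2 * B k \<ge> 0" using AB(2)[of k] by simp
      ultimately show ?thesis by simp
    next
      case False
      then have "(1 / (2 * \<tau>)) ^ q \<le> B k" using xratio_lower[OF t, of a b q] by (simp add: B_def \<tau>_def k)
      then have "d\<^sup>2 * (1 / (2 * \<tau>)) ^ q \<le> d\<^sup>2 * B k" by (rule mult_left_mono) simp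
      then have "\<kappa> \<le> d\<^sup>2 * B k" by (simp add: \<kappa>_def)
      then show ?thesis using AB(1)[of k] by simp
    qed
  qed
  \<comment> \<open>Half of the gain in \<open>xratio_gain\<close>, because \<sigma> involves square
    roots and 1 - 2 \<epsilon> \<le> (1 - \<epsilon>)^2. The factor 1 + p absorbs the summand p in
    the denominator there.\<close>
  define \<epsilon> where "\<epsilon> = (\<lambda>k. 1 / (2 * (1 + real p) * (\<tau> + real (tdeg k))))"
  have \<epsilon>: "0 < \<epsilon> k" "\<epsilon> k \<le> 1" for k
  proof -
    have "1 \<le> 2 * (1 + real p) * (\<tau> + real (tdeg k))"
      using \<tau> mult_mono[of 1 "2 * (1 + real p)" 1 "\<tau> + real (tdeg k)"] by simp
    then show "0 < \<epsilon> k" "\<epsilon> k \<le> 1" by (auto simp: \<epsilon>_def field_simps)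
  qed
  have \<sigma>_gain: "\<sigma> (a, b + q) \<le> (1 - \<epsilon> (a, b + q)) * \<sigma> (a + p, b)" for a b
  proof -
    let ?k = "(a, b + q)" and ?k' = "(a + p, b)"
    define \<eta> where "\<eta> = real q / (\<tau> + real a + real b + real q + real p)"
    have \<eta>: "\<eta> \<ge> 2 * \<epsilon> ?k" "\<eta> \<le> 1"
    proof -
      have "\<tau> + real a + real b + real q + real p \<le> (1 + real p) * (\<tau> + real (tdeg ?k))"
        using \<tau> mult_left_mono[of 1 "\<tau> + real a + real b + real q" "real p"] by (simp add: algebra_simps)
      then have "1 / ((1 + real p) * (\<tau> + real (tdeg ?k))) \<le> 1 / (\<tau> + real a + real b + real q + real p)"
        using \<tau> by (intro divide_left_mono mult_pos_pos) auto
      also have "\<dots> \<le> \<eta>" unfolding \<eta>_def using q \<tau> by (intro divide_right_mono) auto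
      finally have "1 / ((1 + real p) * (\<tau> + real (tdeg ?k))) \<le> \<eta>" .
      moreover have "2 * \<epsilon> ?k = 1 / ((1 + real p) * (\<tau> + real (tdeg ?k)))"
        unfolding \<epsilon>_def mult.assoc by (simp only: times_divide_eq_right divide_divide_eq_left' mult_1_right) simp
      ultimately show "\<eta> \<ge> 2 * \<epsilon> ?k" by simp
      show "\<eta> \<le> 1" using \<tau> by (simp add: \<eta>_def)
    qed
    have "A ?k \<le> (1 - \<eta>) * A ?k'" using xratio_gain[OF t p, of a b q] by (simp add: A_def \<eta>_def \<tau>_def)
    also have "\<dots> \<le> (1 - \<epsilon> ?k)\<^sup>2 * A ?k'"
    proof (rule mult_right_mono)
      have "(1 - \<epsilon> ?k)\<^sup>2 = 1 - 2 * \<epsilon> ?k + (\<epsilon> ?k)\<^sup>2" by (simp add: power2_eq_square algebra_simps)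
      then show "1 - \<eta> \<le> (1 - \<epsilon> ?k)\<^sup>2" using \<eta>(1) by (simp add: add_increasing2)
    qed (use AB(1)[of ?k'] in simp)
    finally have "sqrt (A ?k) \<le> sqrt ((1 - \<epsilon> ?k)\<^sup>2 * A ?k')" by (rule real_sqrt_le_mono)
    then have "sqrt (A ?k) \<le> (1 - \<epsilon> ?k) * sqrt (A ?k')"
      using \<epsilon>(2)[of ?k] by (simp add: real_sqrt_mult)
    moreover have "B ?k' \<le> B ?k" using xratio_mono[OF t, of q b a p] by (simp add: B_def)
    then have "d * sqrt (B ?k') \<le> d * sqrt (B ?k)" using d by simp
    moreover have "0 \<le> (1 - \<epsilon> ?k) * sqrt (A ?k')" using \<epsilon>(2)[of ?k] AB(1)[of ?k'] by simp
    ultimately have "\<sigma> ?k \<le> ((1 - \<epsilon> ?k) * sqrt (A ?k')) / (d * sqrt (B ?k'))"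
      unfolding \<sigma>_def using AB(2)[of ?k'] d by (intro frac_le) auto
    then show ?thesis by (simp add: \<sigma>_def)
  qed
  \<comment> \<open>Chosen so that C \<epsilon> \<kappa> / 2 equals \<tau> / (\<tau> + degree), the
    quotient of the weights for t + 1 and t.\<close>
  define C where "C = 4 * (1 + real p) * \<tau> / \<kappa>"
  have "nsq (t + 1) (lk h) \<le> C * nsq t (lk ((Poly_Mapping.single (p, 0) 1 - Poly_Mapping.single (0, q) c) * h))" for h
  proof -
    let ?f = "Poly_Mapping.single (p, 0) 1 - Poly_Mapping.single (0, q) c :: cpoly2"
    let ?K = "Poly_Mapping.keys h"
    let ?w = "weight t"
    define X where "X = (\<lambda>(a, b). if p \<le> a then lk h (a - p, b) else 0)"
    define Y where "Y = (\<lambda>(a, b). if q \<le> b then lk h (a, b - q) else 0)"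
    have lkf: "lk (?f * h) i = X i - c * Y i" for i
      by (cases i) (simp add: X_def Y_def left_diff_distrib lookup_minus lookup_single_mult)
    \<comment> \<open>For b < q no term with y^q reaches the exponent, so nothing has to be given up
      and the coefficient is 1.\<close>
    define G1 where "G1 = (\<lambda>(a, b). (if q \<le> b then 1 - 1 / \<sigma> (a, b - q) else 1) * (cmod (X (a, b)))\<^sup>2 * ?w (a, b))"
    define G2 where "G2 = (\<lambda>(a, b). d\<^sup>2 * (1 - \<sigma> (a, b - q)) * (cmod (Y (a, b)))\<^sup>2 * ?w (a, b))"
    have pw: "G1 i + G2 i \<le> (cmod (lk (?f * h) i))\<^sup>2 * ?w i" for i
    proof -
      obtain a b where i: "i = (a, b)" by (cases i)
      show ?thesis
      proof (cases "q \<le> b")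
        case True
        from mult_right_mono[OF young_complex[OF \<sigma>_pos, of "(a, b - q)" "X i" c "Y i"] weight_nonneg[OF t, of i]]
        show ?thesis using True unfolding lkf by (simp add: G1_def G2_def i d_def algebra_simps)
      next
        case False
        then show ?thesis by (simp add: G1_def G2_def i lkf Y_def)
      qed
    qed
    let ?\<phi> = "\<lambda>(a, b). (a + p, b)" and ?\<psi> = "\<lambda>(a, b). (a, b + q)"
    have i1: "inj_on ?\<phi> ?K" and i2: "inj_on ?\<psi> ?K" by (auto simp: inj_on_def)
    have z1: "G1 i = 0" if "i \<notin> ?\<phi> ` ?K" for i
    proof (rule ccontr)
      obtain a b where i: "i = (a, b)" by (cases i)
      assume "G1 i \<noteq> 0"
      then have "p \<le> a" "(a - p, b) \<in> ?K" by (auto simp: G1_def X_def i in_keys_iff split: if_splits)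
      then have "?\<phi> (a - p, b) \<in> ?\<phi> ` ?K" by blast
      then show False using that i \<open>p \<le> a\<close> by simp
    qed
    have z2: "G2 i = 0" if "i \<notin> ?\<psi> ` ?K" for i
    proof (rule ccontr)
      obtain a b where i: "i = (a, b)" by (cases i)
      assume "G2 i \<noteq> 0"
      then have "q \<le> b" "(a, b - q) \<in> ?K" by (auto simp: G2_def Y_def i in_keys_iff split: if_splits)
      then have "?\<psi> (a, b - q) \<in> ?\<psi> ` ?K" by blast
      then show False using that i \<open>q \<le> b\<close> by simp
    qed
    note s1 = infsum_eq_sum_image[of ?K ?\<phi> G1, OF finite_keys i1 z1]
    note s2 = infsum_eq_sum_image[of ?K ?\<psi> G2, OF finite_keys i2 z2]
    have "(\<Sum>k\<in>?K. G1 (?\<phi> k)) + (\<Sum>k\<in>?K. G2 (?\<psi> k)) = infsum (\<lambda>i. G1 i + G2 i) UNIV"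
      using s1 s2 by (simp add: infsum_add)
    also have "\<dots> \<le> nsq t (lk (?f * h))"
      unfolding nsq_def using pw s1 s2 lookup_in_hspace[of "?f * h" t]
      by (intro infsum_mono summable_on_add) (auto simp: hspace_def)
    finally have lower: "(\<Sum>k\<in>?K. G1 (?\<phi> k) + G2 (?\<psi> k)) \<le> nsq t (lk (?f * h))"
      by (simp add: sum.distrib)
    have coef: "(cmod (lk h k))\<^sup>2 * weight (t + 1) k \<le> C * (G1 (?\<phi> k) + G2 (?\<psi> k))" for k
    proof -
      obtain a b where k: "k = (a, b)" by (cases k)
      let ?u = "sqrt (A k)" and ?v = "d * sqrt (B k)"
      have uv: "?u > 0" "?v > 0" using AB[of k] d by auto
      have "\<epsilon> k / 2 * (?u\<^sup>2 + ?v\<^sup>2) \<le>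
          ?u\<^sup>2 * (if q \<le> b then 1 - 1 / \<sigma> (a + p, b - q) else 1) + ?v\<^sup>2 * (1 - \<sigma> k)"
      proof (cases "q \<le> b")
        case True
        then show ?thesis
          using binomial_coefficient_bound[OF uv, of "\<sigma> k" "\<epsilon> k" "\<sigma> (a + p, b - q)"]
            \<sigma>_gain[of a "b - q"] \<sigma>_pos \<epsilon>(2)[of k] by (simp add: k \<sigma>_def)
      next
        case False
        have "?v\<^sup>2 * \<sigma> k = ?u * ?v" using uv by (simp add: \<sigma>_def power2_eq_square)
        moreover have "2 * (?u * ?v) \<le> ?u\<^sup>2 + ?v\<^sup>2" using sum_squares_bound[of ?u ?v] by simp
        moreover have "\<epsilon> k / 2 * (?u\<^sup>2 + ?v\<^sup>2) \<le> 1 / 2 * (?u\<^sup>2 + ?v\<^sup>2)"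
          using \<epsilon>(2)[of k] by (intro mult_right_mono) auto
        ultimately show ?thesis using False by (simp add: algebra_simps)
      qed
      also have "?u\<^sup>2 = A k" using AB(1)[of k] by simp
      also have v2: "?v\<^sup>2 = d\<^sup>2 * B k" using AB(2)[of k] by (simp add: power_mult_distrib)
      finally have 1: "\<epsilon> k / 2 * (A k + d\<^sup>2 * B k) \<le>
          A k * (if q \<le> b then 1 - 1 / \<sigma> (a + p, b - q) else 1) + d\<^sup>2 * B k * (1 - \<sigma> k)" (is "_ \<le> ?br") .
      have "\<epsilon> k / 2 * \<kappa> \<le> ?br"
        by (rule order_trans[OF mult_left_mono[OF \<kappa>_le] 1]) (use \<epsilon>(1)[of k] in simp)
      moreover have "C * (\<epsilon> k / 2 * \<kappa>) = \<tau> / (\<tau> + real (tdeg k))"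
      proof -
        have "4 * P * \<tau> / \<kappa> * (1 / (2 * P * D) / 2 * \<kappa>) = \<tau> / D" if "P > 0" "D > 0" for P D :: real
          using that \<kappa>_pos by (simp add: field_simps)
        from this[of "1 + real p" "\<tau> + real (tdeg k)"] show ?thesis
          unfolding C_def \<epsilon>_def using \<tau> by simp
      qed
      moreover have C: "C \<ge> 0" using \<tau> \<kappa>_pos by (simp add: C_def)
      ultimately have 2: "\<tau> / (\<tau> + real (tdeg k)) \<le> C * ?br"
        using mult_left_mono[of "\<epsilon> k / 2 * \<kappa>" ?br C] by presburger
      have 3: "G1 (?\<phi> k) + G2 (?\<psi> k) = (cmod (lk h k))\<^sup>2 * ?w k * ?br"
        using weight_add_fst[OF t, of a p b] weight_add_snd[OF t, of a b q]
        by (simp add: k G1_def G2_def X_def Y_def A_def B_def algebra_simps)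
      have "(cmod (lk h k))\<^sup>2 * weight (t + 1) k = (cmod (lk h k))\<^sup>2 * ?w k * (\<tau> / (\<tau> + real (tdeg k)))"
        by (simp add: weight_add_1[OF t] \<tau>_def)
      also have "\<dots> \<le> (cmod (lk h k))\<^sup>2 * ?w k * (C * ?br)"
        using 2 t by (intro mult_left_mono mult_nonneg_nonneg) auto
      also have "\<dots> = C * (G1 (?\<phi> k) + G2 (?\<psi> k))" unfolding 3 by (simp only: mult_ac)
      finally show ?thesis .
    qed
    have "nsq (t + 1) (lk h) \<le> (\<Sum>k\<in>?K. C * (G1 (?\<phi> k) + G2 (?\<psi> k)))"
      unfolding nsq_lookup by (intro sum_mono coef)
    also have "\<dots> \<le> C * nsq t (lk (?f * h))"
      unfolding sum_distrib_left[symmetric] using lower \<tau> \<kappa>_pos by (intro mult_left_mono) (simp_all add: C_def)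
    finally show ?thesis .
  qed
  moreover have "C \<ge> 0" using \<tau> \<kappa>_pos by (simp add: C_def)
  ultimately show ?thesis by blast
qed

section \<open>Bounds for the coordinate multiplications\<close>

definition polyX :: cpoly2 where "polyX = Poly_Mapping.single (1, 0) 1"

definition polyY :: cpoly2 where "polyY = Poly_Mapping.single (0, 1) 1"

lemma lookup_X: "lk (polyX * u) (a, b) = (if a = 0 then 0 else lk u (a - 1, b))"
  by (simp add: polyX_def lookup_single_mult)

lemma lookup_Y: "lk (polyY * u) (a, b) = (if b = 0 then 0 else lk u (a, b - 1))"
  by (simp add: polyY_def lookup_single_mult)

lemma weight_Suc_fst_le: "weight t (Suc a, b) \<le> weight t (a, b)" if "t \<ge> - 2"
proof -
  have "weight t (a, b) * (real (Suc a) / (3 + t + real (a + b))) \<le> weight t (a, b) * 1"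
    using that by (intro mult_left_mono) simp_all
  then show ?thesis by (simp only: weight_Suc_fst[OF that] mult_1_right)
qed

lemma mult_x_bounded:
  assumes t: "t \<ge> - 2" and f: "f \<in> hspace t"
  shows "mult_x f \<in> hspace t \<and> nsq t (mult_x f) \<le> nsq t f"
proof -
  have "mult_x f \<in> hspace t \<and> nsq t (mult_x f) \<le> 1 * nsq t f"
  proof (rule nsq_reindex_le[where K = "{k. fst k \<noteq> 0}" and \<phi> = "\<lambda>k. (fst k - 1, snd k)"])
    fix k :: "nat \<times> nat" assume "k \<in> {k. fst k \<noteq> 0}"
    then obtain a b where k: "k = (Suc a, b)" by (cases k; cases "fst k") auto
    show "(cmod (mult_x f k))\<^sup>2 * weight t k \<le> 1 * ((cmod (f (fst k - 1, snd k)))\<^sup>2 * weight t (fst k - 1, snd k))"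
      using weight_Suc_fst_le[OF t, of a b] by (simp add: k mult_x_def mult_left_mono)
  qed (use t f in \<open>auto simp: inj_on_def mult_x_def\<close>)
  then show ?thesis by simp
qed

lemma mult_y_bounded:
  assumes "t \<ge> - 2" "f \<in> hspace t"
  shows "mult_y f \<in> hspace t \<and> nsq t (mult_y f) \<le> nsq t f"
  unfolding mult_y_swap hspace_swap nsq_swap
  using mult_x_bounded[of t "f \<circ> prod.swap"] assms by (simp only: hspace_swap nsq_swap)

text \<open>Among monomials of a given degree x shrinks pure powers of y most, by 1 / (3 + t + b) in
  squared norm, and that is one step of the scale.\<close>

lemma mult_x_bounded_below:
  assumes t: "t \<ge> - 2" and f: "f \<in> hspace t"
  shows "nsq (t + 1) f \<le> (3 + t) * nsq t (mult_x f)"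
proof (rule nsq_reindex_le[THEN conjunct2])
  fix k :: "nat \<times> nat"
  obtain a b where k: "k = (a, b)" by (cases k)
  have "weight (t + 1) k \<le> (3 + t) * weight t (Suc a, b)"
  proof -
    have "weight t k * ((3 + t) / (3 + t + real (a + b))) \<le> weight t k * ((3 + t) * (real (Suc a) / (3 + t + real (a + b))))"
      using t by (intro mult_left_mono) (simp_all add: divide_simps)
    then show ?thesis using t by (simp add: weight_add_1 weight_Suc_fst k mult_ac)
  qed
  then have "(cmod (f k))\<^sup>2 * weight (t + 1) k \<le> (cmod (f k))\<^sup>2 * ((3 + t) * weight t (Suc a, b))"
    by (intro mult_left_mono) auto
  then show "(cmod (f k))\<^sup>2 * weight (t + 1) k \<le>
      (3 + t) * ((cmod (mult_x f (Suc (fst k), snd k)))\<^sup>2 * weight t (Suc (fst k), snd k))"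
    by (simp add: k mult_x_def mult.left_commute)
qed (use t mult_x_bounded[OF t f] in \<open>auto simp: inj_on_def prod_eq_iff\<close>)

lemma mult_y_bounded_below:
  assumes "t \<ge> - 2" "f \<in> hspace t"
  shows "nsq (t + 1) f \<le> (3 + t) * nsq t (mult_y f)"
  unfolding mult_y_swap nsq_swap
  using mult_x_bounded_below[of t "f \<circ> prod.swap"] assms by (simp only: hspace_swap nsq_swap)

section \<open>Operators of negative order\<close>

abbreviation const :: "complex \<Rightarrow> cpoly2" where "const \<equiv> Poly_Mapping.single 0"

lemma poly_eq_sum_single: "p = (\<Sum>k\<in>Poly_Mapping.keys p. Poly_Mapping.single k (lk p k))" for p :: cpoly2
proof (rule poly_mapping_eqI)
  fix k
  have "(\<Sum>j\<in>Poly_Mapping.keys p. lk (Poly_Mapping.single j (lk p j)) k) = (\<Sum>j\<in>Poly_Mapping.keys p. if j = k then lk p k else 0)"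
    by (intro sum.cong) (auto simp: lookup_single when_def)
  then show "lk p k = lk (\<Sum>k\<in>Poly_Mapping.keys p. Poly_Mapping.single k (lk p k)) k"
    by (simp add: lookup_sum in_keys_iff)
qed

text \<open>Constants and the two variables generate the algebra. Statements about multiplication by
  an arbitrary polynomial, or about commutators with it, are thereby reduced to the
  variables.\<close>

lemma cpoly2_induct [case_names const X Y mult add]:
  fixes g :: cpoly2
  assumes const: "\<And>c. P (const c)" and X: "P polyX" and Y: "P polyY"
    and mult: "\<And>g h. P g \<Longrightarrow> P h \<Longrightarrow> P (g * h)" and add: "\<And>g h. P g \<Longrightarrow> P h \<Longrightarrow> P (g + h)"
  shows "P g"
proof -
  have mon: "P (Poly_Mapping.single (a, b) c)" for a b c
  proof (induction a)
    case 0
    show ?case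
    proof (induction b)
      case 0
      then show ?case using const[of c] by (simp add: zero_prod_def)
    next
      case (Suc b)
      have "Poly_Mapping.single (0, Suc b) c = polyY * Poly_Mapping.single (0, b) c" by (simp add: polyY_def mult_single)
      then show ?case using mult[OF Y Suc] by metis
    qed
  next
    case (Suc a)
    have "Poly_Mapping.single (Suc a, b) c = polyX * Poly_Mapping.single (a, b) c" by (simp add: polyX_def mult_single)
    then show ?case using mult[OF X Suc] by metis
  qed
  have "P (\<Sum>k\<in>K. Poly_Mapping.single k (lk g k))" if "finite K" for K
    using that
  proof (induction K rule: finite_induct)
    case empty
    then show ?case using const[of 0] by simp
  next
    case (insert k K)
    then show ?case using add mon[of "fst k" "snd k"] by simp
  qed
  from this[of "Poly_Mapping.keys g"] show ?thesis using poly_eq_sum_single[of g] by simp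
qed

text \<open>The reciprocal of a rising factorial with s + 1 factors, of size n^(-s-1). A plain power
  of n would serve for size, but the difference in n of a reciprocal rising factorial is a multiple
  of the next one, and this keeps the class of operators below closed under commutators.\<close>

definition rinv :: "real \<Rightarrow> nat \<Rightarrow> nat \<Rightarrow> real" where
  "rinv \<tau> s n = 1 / (\<Prod>i\<le>s. \<tau> + real n + real i)"

definition Rop :: "real \<Rightarrow> nat \<Rightarrow> cpoly2 \<Rightarrow> cpoly2" where
  "Rop \<tau> s u = Poly_Mapping.mapp (\<lambda>k c. complex_of_real (rinv \<tau> s (tdeg k)) * c) u"

definition dx :: "cpoly2 \<Rightarrow> cpoly2" where
  "dx u = Abs_poly_mapping (\<lambda>(a, b). of_nat (Suc a) * lk u (Suc a, b))"

definition dy :: "cpoly2 \<Rightarrow> cpoly2" where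
  "dy u = Abs_poly_mapping (\<lambda>(a, b). of_nat (Suc b) * lk u (a, Suc b))"

lemma lookup_Rop: "lk (Rop \<tau> s u) k = complex_of_real (rinv \<tau> s (tdeg k)) * lk u k"
  by (simp add: Rop_def lookup_mapp when_def in_keys_iff)

lemma lookup_dx: "lk (dx u) (a, b) = of_nat (Suc a) * lk u (Suc a, b)"
proof -
  have "finite ((\<lambda>(a, b). (Suc a, b)) -` Poly_Mapping.keys u)"
    by (rule finite_vimageI) (auto simp: inj_on_def)
  then have "finite {k. (\<lambda>(a, b). of_nat (Suc a) * lk u (Suc a, b)) k \<noteq> 0}"
    by (rule rev_finite_subset) (auto simp: in_keys_iff)
  then show ?thesis by (simp add: dx_def)
qed

lemma lookup_dy: "lk (dy u) (a, b) = of_nat (Suc b) * lk u (a, Suc b)"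
proof -
  have "finite ((\<lambda>(a, b). (a, Suc b)) -` Poly_Mapping.keys u)"
    by (rule finite_vimageI) (auto simp: inj_on_def)
  then have "finite {k. (\<lambda>(a, b). of_nat (Suc b) * lk u (a, Suc b)) k \<noteq> 0}"
    by (rule rev_finite_subset) (auto simp: in_keys_iff)
  then show ?thesis by (simp add: dy_def)
qed

lemma cpoly2_eqI: "(\<And>a b. lk p (a, b) = lk q (a, b)) \<Longrightarrow> p = q"
  by (rule poly_mapping_eqI) auto

lemma rinv_Suc:
  assumes "\<tau> > 0"
  shows "rinv \<tau> s (Suc n) = rinv \<tau> s n - real (Suc s) * rinv \<tau> (Suc s) n"
proof -
  define y where "y = \<tau> + real n"
  define P where "P = (\<Prod>i\<le>s. y + real i)"
  define Q where "Q = (\<Prod>i\<le>s. y + 1 + real i)"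
  have y: "y > 0" using assms by (simp add: y_def)
  have "(\<Prod>i\<le>Suc s. y + real i) = y * Q"
    unfolding Q_def by (subst prod.atMost_Suc_shift) (simp add: algebra_simps)
  then have eq: "P * (y + real (Suc s)) = y * Q" by (simp add: P_def)
  have pos: "P > 0" "Q > 0" using y by (auto simp: P_def Q_def intro!: prod_pos add_pos_nonneg)
  have r: "rinv \<tau> s (Suc n) = 1 / Q" "rinv \<tau> s n = 1 / P" "rinv \<tau> (Suc s) n = 1 / (P * (y + real (Suc s)))"
    by (simp_all add: rinv_def P_def Q_def y_def algebra_simps)
  have "1 / P - real (Suc s) * (1 / (P * (y + real (Suc s)))) = y / (P * (y + real (Suc s)))"
    using pos y by (simp add: divide_simps)
  also have "\<dots> = 1 / Q" unfolding eq using y by simp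
  finally show ?thesis by (simp add: r)
qed

lemma rinv_nonneg: "\<tau> > 0 \<Longrightarrow> rinv \<tau> s n \<ge> 0"
  by (auto simp: rinv_def intro!: divide_nonneg_nonneg prod_nonneg)

lemma rinv_le:
  assumes "\<tau> \<ge> 1" "r \<le> Suc s"
  shows "rinv \<tau> s n \<le> 1 / (1 + real n) ^ r"
proof -
  have "(1 + real n) ^ r \<le> (1 + real n) ^ Suc s" using assms by (intro power_increasing) auto
  also have "\<dots> = (\<Prod>i\<le>s. 1 + real n)" by simp
  also have "\<dots> \<le> (\<Prod>i\<le>s. \<tau> + real n + real i)" using assms by (intro prod_mono) auto
  finally show ?thesis unfolding rinv_def by (intro divide_left_mono mult_pos_pos) (auto intro!: prod_pos simp: add_pos_nonneg order.strict_trans2[OF _ assms(1)] less_le_trans)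
qed

lemma dx_X: "dx (polyX * u) = u + polyX * dx u"
  by (rule cpoly2_eqI) (simp add: lookup_dx lookup_X lookup_add algebra_simps)

lemma dx_Y: "dx (polyY * u) = polyY * dx u"
  by (rule cpoly2_eqI) (simp add: lookup_dx lookup_Y)

lemma dy_Y: "dy (polyY * u) = u + polyY * dy u"
  by (rule cpoly2_eqI) (simp add: lookup_dy lookup_Y lookup_add algebra_simps)

lemma dy_X: "dy (polyX * u) = polyX * dy u"
  by (rule cpoly2_eqI) (simp add: lookup_dy lookup_X)

lemma Rop_X: "\<tau> > 0 \<Longrightarrow> Rop \<tau> s (polyX * u) = polyX * Rop \<tau> s u + (const (- of_nat (Suc s)) * polyX) * Rop \<tau> (Suc s) u"
proof (rule cpoly2_eqI)
  fix a b assume \<tau>: "\<tau> > 0"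
  show "lk (Rop \<tau> s (polyX * u)) (a, b) = lk (polyX * Rop \<tau> s u + (const (- of_nat (Suc s)) * polyX) * Rop \<tau> (Suc s) u) (a, b)"
  proof (cases a)
    case 0
    then show ?thesis unfolding mult.assoc lookup_Rop lookup_add lookup_const_times lookup_X by simp
  next
    case (Suc a')
    then show ?thesis unfolding mult.assoc lookup_Rop lookup_add lookup_const_times lookup_X
      by (simp add: rinv_Suc[OF \<tau>] algebra_simps)
  qed
qed

lemma Rop_Y: "\<tau> > 0 \<Longrightarrow> Rop \<tau> s (polyY * u) = polyY * Rop \<tau> s u + (const (- of_nat (Suc s)) * polyY) * Rop \<tau> (Suc s) u"
proof (rule cpoly2_eqI)
  fix a b assume \<tau>: "\<tau> > 0"
  show "lk (Rop \<tau> s (polyY * u)) (a, b) = lk (polyY * Rop \<tau> s u + (const (- of_nat (Suc s)) * polyY) * Rop \<tau> (Suc s) u) (a, b)"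
  proof (cases b)
    case 0
    then show ?thesis unfolding mult.assoc lookup_Rop lookup_add lookup_const_times lookup_Y by simp
  next
    case (Suc b')
    then show ?thesis unfolding mult.assoc lookup_Rop lookup_add lookup_const_times lookup_Y
      by (simp add: rinv_Suc[OF \<tau>] algebra_simps)
  qed
qed

lemma Rop_add: "Rop \<tau> s (u + v) = Rop \<tau> s u + Rop \<tau> s v"
  by (rule cpoly2_eqI) (simp add: lookup_Rop lookup_add algebra_simps)

lemma Rop_const: "Rop \<tau> s (const c * u) = const c * Rop \<tau> s u"
  by (rule cpoly2_eqI) (simp add: lookup_Rop lookup_const_times)

lemma dx_add: "dx (u + v) = dx u + dx v"
  by (rule cpoly2_eqI) (simp add: lookup_dx lookup_add algebra_simps)

lemma dx_const: "dx (const c * u) = const c * dx u"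
  by (rule cpoly2_eqI) (simp add: lookup_dx lookup_const_times)

lemma dy_add: "dy (u + v) = dy u + dy v"
  by (rule cpoly2_eqI) (simp add: lookup_dy lookup_add algebra_simps)

lemma dy_const: "dy (const c * u) = const c * dy u"
  by (rule cpoly2_eqI) (simp add: lookup_dy lookup_const_times)

text \<open>
  \<open>psi \<tau> r T\<close> says that T is of order at most -r. The adjoints of the coordinate multiplications
  are \<open>Rop (3 + t) 0 \<circ> dx\<close> and \<open>Rop (3 + t) 0 \<circ> dy\<close>, of order 0; every commutator with a
  polynomial gains one order.
\<close>

inductive psi :: "real \<Rightarrow> nat \<Rightarrow> (cpoly2 \<Rightarrow> cpoly2) \<Rightarrow> bool" for \<tau> where
  Rdx: "r \<le> s \<Longrightarrow> psi \<tau> r (\<lambda>u. Rop \<tau> s (dx u))"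
| Rdy: "r \<le> s \<Longrightarrow> psi \<tau> r (\<lambda>u. Rop \<tau> s (dy u))"
| R: "r \<le> Suc s \<Longrightarrow> psi \<tau> r (Rop \<tau> s)"
| add: "psi \<tau> r S \<Longrightarrow> psi \<tau> r T \<Longrightarrow> psi \<tau> r (\<lambda>u. S u + T u)"
| mult: "psi \<tau> r T \<Longrightarrow> psi \<tau> r (\<lambda>u. g * T u)"

lemma psi_antimono: "psi \<tau> r T \<Longrightarrow> r' \<le> r \<Longrightarrow> psi \<tau> r' T"
  by (induction rule: psi.induct) (auto intro: psi.intros)

lemma psi_linear: "psi \<tau> r T \<Longrightarrow> T (u + v) = T u + T v \<and> T (const c * u) = const c * T u"
proof (induction rule: psi.induct)
  case (mult r T g)
  then show ?case by (simp add: distrib_left mult.left_commute)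
qed (simp_all add: Rop_add Rop_const dx_add dx_const dy_add dy_const distrib_left)

definition ad :: "cpoly2 \<Rightarrow> (cpoly2 \<Rightarrow> cpoly2) \<Rightarrow> cpoly2 \<Rightarrow> cpoly2" where
  "ad g T u = T (g * u) - g * T u"

lemma psi_cong:
  assumes "psi \<tau> r S" "\<And>u. T u = S u"
  shows "psi \<tau> r T"
proof -
  have "T = S" using assms(2) by (rule ext)
  then show ?thesis using assms(1) by simp
qed

text \<open>A commutator with a variable either consumes the derivative, leaving \<open>Rop\<close>
  alone, or raises the index s by one. With \<open>Rop \<tau> s\<close> counted as order -(s + 1)
  and its compositions with a derivative as order -s, both lower the order by one. The constants
  \<alpha> and \<beta> let one proof serve x and y.\<close>

lemma psi_ad_variable:
  assumes Rop: "\<And>s u. Rop \<tau> s (z * u) = z * Rop \<tau> s u + (const (- of_nat (Suc s)) * z) * Rop \<tau> (Suc s) u"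
    and dx: "\<And>u. dx (z * u) = const \<alpha> * u + z * dx u" and dy: "\<And>u. dy (z * u) = const \<beta> * u + z * dy u"
  shows "psi \<tau> r T \<Longrightarrow> psi \<tau> (Suc r) (ad z T)"
proof (induction rule: psi.induct)
  case (Rdx r s)
  show ?case
  proof (rule psi_cong)
    show "psi \<tau> (Suc r) (\<lambda>u. const \<alpha> * Rop \<tau> s u + (const (- of_nat (Suc s)) * z) * Rop \<tau> (Suc s) (dx u))"
      using Rdx by (intro psi.intros) simp_all
  qed (simp add: ad_def dx Rop_add Rop_const Rop del: of_nat_Suc)
next
  case (Rdy r s)
  show ?case
  proof (rule psi_cong)
    show "psi \<tau> (Suc r) (\<lambda>u. const \<beta> * Rop \<tau> s u + (const (- of_nat (Suc s)) * z) * Rop \<tau> (Suc s) (dy u))"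
      using Rdy by (intro psi.intros) simp_all
  qed (simp add: ad_def dy Rop_add Rop_const Rop del: of_nat_Suc)
next
  case (R r s)
  show ?case
  proof (rule psi_cong)
    show "psi \<tau> (Suc r) (\<lambda>u. (const (- of_nat (Suc s)) * z) * Rop \<tau> (Suc s) u)"
      using R by (intro psi.intros) simp_all
  qed (simp add: ad_def Rop del: of_nat_Suc)
next
  case (add r S T)
  show ?case
    by (rule psi_cong[OF psi.add[OF add.IH]]) (simp add: ad_def algebra_simps)
next
  case (mult r T g)
  show ?case
    by (rule psi_cong[OF psi.mult[OF mult.IH, of g]]) (simp only: ad_def right_diff_distrib mult.left_commute)
qed

text \<open>The Leibniz rule for a product is ad (g h) T = h ad g T + ad h (ad g T) + g ad h T. The
  middle term has gained two orders, more than required, and is absorbed by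
  \<open>psi_antimono\<close>.\<close>

lemma psi_ad:
  assumes "\<tau> > 0"
  shows "psi \<tau> r T \<Longrightarrow> psi \<tau> (Suc r) (ad g T)"
proof (induction g arbitrary: r T rule: cpoly2_induct)
  case (const c)
  show ?case
  proof (rule psi_cong)
    \<comment> \<open>T commutes with constants; the zero operator enters the class as a trivial
      multiple of some \<open>Rop\<close>.\<close>
    show "psi \<tau> (Suc r) (\<lambda>u. 0 * Rop \<tau> r u)" by (intro psi.intros) simp
  qed (simp add: ad_def psi_linear[OF const])
next
  case X
  show ?case
    by (rule psi_ad_variable[where \<alpha> = 1 and \<beta> = 0, OF Rop_X[OF assms] _ _ X]) (simp_all add: dx_X dy_X)
next
  case Y
  show ?case
    by (rule psi_ad_variable[where \<alpha> = 0 and \<beta> = 1, OF Rop_Y[OF assms] _ _ Y]) (simp_all add: dx_Y dy_Y)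
next
  case (mult g h)
  have adg: "psi \<tau> (Suc r) (ad g T)" and adh: "psi \<tau> (Suc r) (ad h T)" using mult by blast+
  have "psi \<tau> (Suc r) (ad h (ad g T))" using mult.IH(2)[OF adg] psi_antimono by fastforce
  with adg adh have "psi \<tau> (Suc r) (\<lambda>u. h * ad g T u + ad h (ad g T) u + g * ad h T u)"
    by (intro psi.intros)
  then show ?case by (rule psi_cong) (simp only: ad_def mult.assoc right_diff_distrib, simp)
next
  case (add g h)
  have "psi \<tau> (Suc r) (\<lambda>u. ad g T u + ad h T u)" using add by (intro psi.intros) blast+
  then show ?case
    by (rule psi_cong) (simp only: ad_def distrib_right psi_linear[OF add.prems] add_diff_add)
qed

section \<open>Operator norms along the scale\<close>

lemma nsq_add_le:
  assumes "t \<ge> - 2" "f \<in> hspace t" "g \<in> hspace t"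
  shows "nsq t (f + g) \<le> 2 * nsq t f + 2 * nsq t g"
  using parallelogram[OF assms] nsq_nonneg[OF assms(1), of "f - g"] by linarith

lemma lk_add: "lk (p + q) = lk p + lk q"
  by (simp add: fun_eq_iff lookup_add)

lemma lk_diff: "lk (p - q) = lk p - lk q"
  by (simp add: fun_eq_iff lookup_minus)

lemma nsq_lk_add: "nsq t (lk (p + q)) \<le> 2 * nsq t (lk p) + 2 * nsq t (lk q)" if "t \<ge> - 2"
  unfolding lk_add using that lookup_in_hspace by (intro nsq_add_le)

lemma nsq_uminus: "nsq t (- f) = nsq t f"
  by (simp add: nsq_def)

lemma nsq_lk_diff: "nsq t (lk (p - q)) \<le> 2 * nsq t (lk p) + 2 * nsq t (lk q)" if "t \<ge> - 2"
proof -
  have "nsq t (lk (p + - q)) \<le> 2 * nsq t (lk p) + 2 * nsq t (lk (- q))" by (rule nsq_lk_add[OF that])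
  moreover have "lk (- q) = - lk q" by (simp add: fun_eq_iff)
  ultimately show ?thesis by (simp add: nsq_uminus)
qed

lemma nsq_mult_le:
  assumes t: "t \<ge> - 2"
  shows "\<exists>C\<ge>0. \<forall>u. nsq t (lk (g * u)) \<le> C * nsq t (lk u)"
proof (induction g rule: cpoly2_induct)
  case (const c)
  have "lk (const c * u) = cscale c (lk u)" for u by (simp add: fun_eq_iff lookup_const_times cscale_def)
  then show ?case by (intro exI[of _ "(cmod c)\<^sup>2"]) (simp add: nsq_scale)
next
  case X
  show ?case using mult_x_bounded[OF t lookup_in_hspace]
    by (intro exI[of _ 1]) (simp add: mult_x_lookup polyX_def)
next
  case Y
  show ?case using mult_y_bounded[OF t lookup_in_hspace]
    by (intro exI[of _ 1]) (simp add: mult_y_lookup polyY_def)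
next
  case (mult g h)
  obtain C where C: "C \<ge> 0" "\<And>u. nsq t (lk (g * u)) \<le> C * nsq t (lk u)" using mult(1) by blast
  obtain D where D: "D \<ge> 0" "\<And>u. nsq t (lk (h * u)) \<le> D * nsq t (lk u)" using mult(2) by blast
  have "nsq t (lk (g * h * u)) \<le> C * D * nsq t (lk u)" for u
    unfolding mult.assoc by (rule order_trans[OF C(2)[of "h * u"] mult_left_mono[OF D(2)[of u] C(1)]])
  moreover have "C * D \<ge> 0" using C(1) D(1) by (rule mult_nonneg_nonneg)
  ultimately show ?case by blast
next
  case (add g h)
  obtain C where C: "C \<ge> 0" "\<And>u. nsq t (lk (g * u)) \<le> C * nsq t (lk u)" using add(1) by blast
  obtain D where D: "D \<ge> 0" "\<And>u. nsq t (lk (h * u)) \<le> D * nsq t (lk u)" using add(2) by blast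
  have "nsq t (lk ((g + h) * u)) \<le> (2 * C + 2 * D) * nsq t (lk u)" for u
    using nsq_lk_add[OF t, of "g * u" "h * u"] C(2)[of u] D(2)[of u] unfolding distrib_right by linarith
  moreover have "2 * C + 2 * D \<ge> 0" using C(1) D(1) by simp
  ultimately show ?case by blast
qed

lemma weight_add_nat_ge:
  assumes t: "t \<ge> - 2"
  shows "weight t k \<le> (1 + real (tdeg k)) ^ n * weight (t + real n) k"
proof (induction n)
  case (Suc n)
  let ?D = "real (tdeg k)"
  have t': "t + real n \<ge> - 2" using t by simp
  have "weight (t + real n) k \<le> (1 + ?D) * weight (t + real n + 1) k"
  proof -
    have "?D \<le> (3 + (t + real n)) * ?D" using t mult_right_mono[of 1 "3 + (t + real n)" ?D] by simp
    then have "1 \<le> (1 + ?D) * ((3 + (t + real n)) / (3 + (t + real n) + ?D))"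
      using t by (simp add: divide_simps) (simp add: algebra_simps)
    then have "weight (t + real n) k * 1 \<le> weight (t + real n) k * ((1 + ?D) * ((3 + (t + real n)) / (3 + (t + real n) + ?D)))"
      using t' by (intro mult_left_mono) auto
    then show ?thesis unfolding weight_add_1[OF t'] by (simp only: mult_1_right mult.left_commute mult.commute)
  qed
  then have "(1 + ?D) ^ n * weight (t + real n) k \<le> (1 + ?D) ^ n * ((1 + ?D) * weight (t + real n + 1) k)"
    by (intro mult_left_mono) auto
  with Suc have "weight t k \<le> (1 + ?D) ^ n * ((1 + ?D) * weight (t + real n + 1) k)" by linarith
  then show ?case by (simp add: mult_ac add_ac)
qed simp

text \<open>Put D = 1 + a + b. One factor \<open>Suc a\<close> is absorbed by passing from the
  weight at (a, b) to the one at (Suc a, b), which costs a factor of order D; the other is at most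
  D. The squared value of \<open>rinv\<close> is at most D^(-2r-2), so D^(-2r) is left, which is 2 r
  steps of the scale. The factor 4^r compares 1 + D with D.\<close>

lemma shift_weight_bound:
  assumes t: "t \<ge> - 2" and r: "r \<le> s"
  shows "(rinv (3 + t) s (a + b) * real (Suc a))\<^sup>2 * weight (t + real n) (a, b)
    \<le> (3 + (t + real n)) * 4 ^ r * weight (t + real n + real (2 * r)) (Suc a, b)"
proof -
  define t' where "t' = t + real n"
  have t': "t' \<ge> - 2" using t by (simp add: t'_def)
  define D where "D = 1 + real (a + b)"
  have D: "D \<ge> 1" "real (Suc a) \<le> D" by (simp_all add: D_def)
  define \<rho> where "\<rho> = rinv (3 + t) s (a + b)"
  have \<rho>: "0 \<le> \<rho>" "\<rho> \<le> 1 / D ^ Suc r"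
    using rinv_nonneg[of "3 + t"] rinv_le[of "3 + t" "Suc r" s "a + b"] t r by (simp_all add: \<rho>_def D_def)
  define w where "w = weight t' (Suc a, b)"
  have w: "w \<ge> 0" using t' by (simp add: w_def)
  have wa: "weight t' (a, b) * real (Suc a) = w * (3 + t' + real (a + b))"
    using t' by (simp add: w_def weight_Suc_fst[OF t'])
  have fac: "3 + t' + real (a + b) \<le> (3 + t') * D"
    using t' mult_right_mono[of 1 "3 + t'" "real (a + b)"] by (simp add: D_def distrib_left)
  have wD: "w \<le> (1 + D) ^ (2 * r) * weight (t' + real (2 * r)) (Suc a, b)"
    using weight_add_nat_ge[OF t', of "(Suc a, b)" "2 * r"] by (simp add: w_def D_def)
  have pow: "(1 + D) ^ (2 * r) \<le> 4 ^ r * D ^ (2 * r)"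
  proof -
    have "(1 + D) ^ (2 * r) \<le> (2 * D) ^ (2 * r)" using D by (intro power_mono) auto
    then show ?thesis by (simp add: power_mult_distrib power_mult)
  qed
  have "(\<rho> * real (Suc a))\<^sup>2 * weight t' (a, b) = (\<rho>\<^sup>2 * real (Suc a)) * (weight t' (a, b) * real (Suc a))"
    by (simp only: power_mult_distrib power2_eq_square mult_ac)
  also have "\<dots> \<le> ((1 / D ^ Suc r)\<^sup>2 * D) * (w * ((3 + t') * D))"
    unfolding wa using \<rho> D fac w t' by (intro mult_mono power_mono mult_nonneg_nonneg) auto
  also have "\<dots> = (3 + t') * (w / D ^ (2 * r))"
  proof -
    have "(D ^ Suc r)\<^sup>2 = D * D * D ^ (2 * r)" by (simp add: power2_eq_square power_mult mult_ac power_mult_distrib)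
    then show ?thesis using D by (simp add: power_divide)
  qed
  also have "\<dots> \<le> (3 + t') * (4 ^ r * weight (t' + real (2 * r)) (Suc a, b))"
  proof (rule mult_left_mono)
    have "w \<le> 4 ^ r * D ^ (2 * r) * weight (t' + real (2 * r)) (Suc a, b)"
      using t' by (intro order_trans[OF wD] mult_right_mono pow weight_nonneg) simp
    then show "w / D ^ (2 * r) \<le> 4 ^ r * weight (t' + real (2 * r)) (Suc a, b)"
      using D by (simp add: divide_simps mult_ac)
  qed (use t' in simp)
  finally show ?thesis unfolding t'_def \<rho>_def by (simp only: mult.assoc)
qed

text \<open>Extends the composition of \<open>Rop (3 + t) s\<close> with \<open>dx\<close> from
  polynomials to all coefficient families. For s = 0 this is the adjoint of \<open>mult_x\<close> in
  the space with parameter t; larger s occur in the commutators.\<close>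

definition Sx :: "real \<Rightarrow> nat \<Rightarrow> coeffs \<Rightarrow> coeffs" where
  "Sx t s f = (\<lambda>(a, b). complex_of_real (rinv (3 + t) s (a + b)) * (of_nat (Suc a) * f (Suc a, b)))"

definition Sy :: "real \<Rightarrow> nat \<Rightarrow> coeffs \<Rightarrow> coeffs" where
  "Sy t s f = (\<lambda>(a, b). complex_of_real (rinv (3 + t) s (a + b)) * (of_nat (Suc b) * f (a, Suc b)))"

lemma Sy_swap: "Sy t s f = Sx t s (f \<circ> prod.swap) \<circ> prod.swap"
  by (auto simp: Sx_def Sy_def fun_eq_iff add.commute)

lemma Sx_lookup: "Sx t s (lk u) = lk (Rop (3 + t) s (dx u))"
  by (auto simp: fun_eq_iff Sx_def lookup_Rop lookup_dx)

lemma Sy_lookup: "Sy t s (lk u) = lk (Rop (3 + t) s (dy u))"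
  by (auto simp: fun_eq_iff Sy_def lookup_Rop lookup_dy)

lemma Sx_bounded:
  assumes t: "t \<ge> - 2" and r: "r \<le> s" and f: "f \<in> hspace (t + real n + real (2 * r))"
  shows "Sx t s f \<in> hspace (t + real n) \<and>
    nsq (t + real n) (Sx t s f) \<le> (3 + (t + real n)) * 4 ^ r * nsq (t + real n + real (2 * r)) f"
proof (rule nsq_reindex_le[where K = UNIV and \<phi> = "\<lambda>k. (Suc (fst k), snd k)"])
  fix k :: "nat \<times> nat"
  obtain a b where k: "k = (a, b)" by (cases k)
  from mult_left_mono[OF shift_weight_bound[OF t r, of a b n] zero_le_power2, of "cmod (f (Suc a, b))"]
  show "(cmod (Sx t s f k))\<^sup>2 * weight (t + real n) k \<le> (3 + (t + real n)) * 4 ^ r *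
      ((cmod (f (Suc (fst k), snd k)))\<^sup>2 * weight (t + real n + real (2 * r)) (Suc (fst k), snd k))"
    using rinv_nonneg[of "3 + t" s "a + b"] t
    unfolding k Sx_def prod.case norm_mult norm_of_real norm_of_nat fst_conv snd_conv
    by (simp only: abs_of_nonneg power_mult_distrib mult_ac)
qed (use t f in \<open>auto simp: inj_on_def prod_eq_iff\<close>)

lemma Sy_bounded:
  assumes "t \<ge> - 2" "r \<le> s" "f \<in> hspace (t + real n + real (2 * r))"
  shows "Sy t s f \<in> hspace (t + real n) \<and>
    nsq (t + real n) (Sy t s f) \<le> (3 + (t + real n)) * 4 ^ r * nsq (t + real n + real (2 * r)) f"
  unfolding Sy_swap hspace_swap nsq_swap
  using Sx_bounded[of t r s "f \<circ> prod.swap" n] assms by (simp only: hspace_swap nsq_swap)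

lemma hinner_mult_x:
  assumes t: "t \<ge> - 2"
  shows "hinner t (mult_x f) g = hinner t f (Sx t 0 g)"
proof -
  let ?F = "\<lambda>k. mult_x f k * cnj (g k) * complex_of_real (weight t k)"
  let ?\<phi> = "\<lambda>(a, b). (Suc a, b :: nat)"
  have "infsum ?F UNIV = infsum ?F (range ?\<phi>)"
  proof (rule infsum_cong_neutral)
    fix k :: "nat \<times> nat" assume k: "k \<in> UNIV - range ?\<phi>"
    obtain a b where kk: "k = (a, b)" by (cases k)
    have "a = 0"
    proof (rule ccontr)
      assume "a \<noteq> 0"
      then have "k = ?\<phi> (a - 1, b)" by (simp add: kk)
      then show False using k by blast
    qed
    then show "?F k = 0" by (simp add: kk mult_x_def)
  qed auto
  also have "\<dots> = infsum (?F \<circ> ?\<phi>) UNIV" by (rule infsum_reindex) (auto simp: inj_on_def)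
  also have "\<dots> = (\<Sum>\<^sub>\<infinity>k. f k * cnj (Sx t 0 g k) * complex_of_real (weight t k))"
  proof (rule infsum_cong)
    fix k :: "nat \<times> nat"
    obtain a b where k: "k = (a, b)" by (cases k)
    have "weight t (Suc a, b) = weight t (a, b) * rinv (3 + t) 0 (a + b) * real (Suc a)"
      using weight_Suc_fst[OF t, of a b] by (simp add: rinv_def)
    then show "(?F \<circ> ?\<phi>) k = f k * cnj (Sx t 0 g k) * complex_of_real (weight t k)"
      by (simp add: k mult_x_def Sx_def)
  qed
  finally show ?thesis by (simp only: hinner_def)
qed

lemma hinner_mult_y:
  assumes "t \<ge> - 2"
  shows "hinner t (mult_y f) g = hinner t f (Sy t 0 g)"
  using hinner_mult_x[OF assms, of "f \<circ> prod.swap" "g \<circ> prod.swap"]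
    hinner_swap[of t "mult_x (f \<circ> prod.swap)" "g \<circ> prod.swap"] hinner_swap[of t f "Sy t 0 g"]
  unfolding mult_y_swap Sy_swap swap_swap by simp

text \<open>An order counts as two steps because squared norms are compared. The shift n is separate
  from the parameter of the operators: T stays fixed while it is measured in the norms for t +
  n.\<close>

lemma psi_bounded:
  assumes t: "t \<ge> - 2"
  shows "psi (3 + t) r T \<Longrightarrow> \<exists>C\<ge>0. \<forall>u. nsq (t + real n) (lk (T u)) \<le> C * nsq (t + real n + real (2 * r)) (lk u)"
proof (induction rule: psi.induct)
  case (Rdx r s)
  have "nsq (t + real n) (lk (Rop (3 + t) s (dx u))) \<le> (3 + (t + real n)) * 4 ^ r * nsq (t + real n + real (2 * r)) (lk u)" for u
    unfolding Sx_lookup[symmetric] by (rule Sx_bounded[OF t Rdx lookup_in_hspace, THEN conjunct2])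
  moreover have "(3 + (t + real n)) * 4 ^ r \<ge> 0" using t by simp
  ultimately show ?case by blast
next
  case (Rdy r s)
  have "nsq (t + real n) (lk (Rop (3 + t) s (dy u))) \<le> (3 + (t + real n)) * 4 ^ r * nsq (t + real n + real (2 * r)) (lk u)" for u
    unfolding Sy_lookup[symmetric] by (rule Sy_bounded[OF t Rdy lookup_in_hspace, THEN conjunct2])
  moreover have "(3 + (t + real n)) * 4 ^ r \<ge> 0" using t by simp
  ultimately show ?case by blast
next
  case (R r s)
  let ?t = "t + real n"
  have t': "?t \<ge> - 2" using t by simp
  have tw: "?t + real (2 * r) \<ge> - 2" using t' by simp
  have "nsq ?t (lk (Rop (3 + t) s u)) \<le> 1 * nsq (?t + real (2 * r)) (lk u)" for u
  proof (rule nsq_pointwise_le[THEN conjunct2])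
    fix k :: "nat \<times> nat"
    let ?D = "1 + real (tdeg k)" and ?\<rho> = "rinv (3 + t) s (tdeg k)"
    have \<rho>: "0 \<le> ?\<rho>" "?\<rho> \<le> 1 / ?D ^ r" using rinv_nonneg[of "3 + t" s "tdeg k"] rinv_le[of "3 + t" r s "tdeg k"] t R by simp_all
    have "?\<rho>\<^sup>2 * weight ?t k \<le> (1 / ?D ^ r)\<^sup>2 * (?D ^ (2 * r) * weight (?t + real (2 * r)) k)"
      using \<rho> t' weight_add_nat_ge[OF t', of k "2 * r"] by (intro mult_mono power_mono) auto
    also have "\<dots> = weight (?t + real (2 * r)) k"
    proof -
      have "?D \<noteq> 0" by (simp add: add_nonneg_eq_0_iff)
      then show ?thesis by (simp only: power_divide power_mult[symmetric] mult.commute[of r 2]) simp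
    qed
    finally have "?\<rho>\<^sup>2 * weight ?t k \<le> weight (?t + real (2 * r)) k" .
    from mult_left_mono[OF this zero_le_power2, of "cmod (lk u k)"]
    show "(cmod (lk (Rop (3 + t) s u) k))\<^sup>2 * weight ?t k \<le> 1 * ((cmod (lk u k))\<^sup>2 * weight (?t + real (2 * r)) k)"
      using \<rho>(1) unfolding lookup_Rop norm_mult norm_of_real by (simp only: abs_of_nonneg power_mult_distrib mult_ac)
  qed (use t' tw lookup_in_hspace in auto)
  then show ?case by (intro exI[of _ 1]) simp
next
  case (add r S T)
  have t': "t + real n \<ge> - 2" using t by simp
  obtain C where C: "C \<ge> 0" "\<And>u. nsq (t + real n) (lk (S u)) \<le> C * nsq (t + real n + real (2 * r)) (lk u)"
    using add.IH(1) by blast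
  obtain D where D: "D \<ge> 0" "\<And>u. nsq (t + real n) (lk (T u)) \<le> D * nsq (t + real n + real (2 * r)) (lk u)"
    using add.IH(2) by blast
  have "nsq (t + real n) (lk (S u + T u)) \<le> (2 * C + 2 * D) * nsq (t + real n + real (2 * r)) (lk u)" for u
    using nsq_lk_add[OF t', of "S u" "T u"] C(2)[of u] D(2)[of u] unfolding distrib_right by linarith
  moreover have "2 * C + 2 * D \<ge> 0" using C(1) D(1) by simp
  ultimately show ?case by blast
next
  case (mult r T g)
  have t': "t + real n \<ge> - 2" using t by simp
  obtain C where C: "C \<ge> 0" "\<And>u. nsq (t + real n) (lk (T u)) \<le> C * nsq (t + real n + real (2 * r)) (lk u)"
    using mult.IH by blast
  obtain D where D: "D \<ge> 0" "\<And>u. nsq (t + real n) (lk (g * u)) \<le> D * nsq (t + real n) (lk u)"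
    using nsq_mult_le[OF t', of g] by blast
  have "nsq (t + real n) (lk (g * T u)) \<le> D * (C * nsq (t + real n + real (2 * r)) (lk u))" for u
    by (rule order_trans[OF D(2)[of "T u"] mult_left_mono[OF C(2)[of u] D(1)]])
  moreover have "D * C \<ge> 0" using C(1) D(1) by simp
  ultimately show ?case unfolding mult.assoc[symmetric] by blast
qed

section \<open>Approximate invariance of ideals under the adjoints\<close>

text \<open>Quantified over all t because the factors of a product are stripped off one after
  another, each at a parameter shifted by those before it.\<close>

definition bounded_below :: "cpoly2 \<Rightarrow> bool" where
  "bounded_below f \<longleftrightarrow> (\<forall>t\<ge>- 2. \<exists>C\<ge>0. \<forall>h. nsq (t + 1) (lk h) \<le> C * nsq t (lk (f * h)))"

lemma bounded_belowE:
  assumes "bounded_below f" "t \<ge> - 2"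
  obtains C where "C \<ge> 0" "\<And>h. nsq (t + 1) (lk h) \<le> C * nsq t (lk (f * h))"
  using assms unfolding bounded_below_def by blast

lemma prod_bounded_below:
  assumes "\<And>f. f \<in> set L \<Longrightarrow> bounded_below f" "t \<ge> - 2"
  shows "\<exists>C\<ge>0. \<forall>h. nsq (t + real (length L)) (lk h) \<le> C * nsq t (lk (prod_list L * h))"
  using assms
proof (induction L arbitrary: t)
  case Nil
  then show ?case by (intro exI[of _ 1]) simp
next
  case (Cons f L)
  obtain C where C: "C \<ge> 0" "\<And>h. nsq (t + 1) (lk h) \<le> C * nsq t (lk (f * h))"
    using bounded_belowE[of f t] Cons.prems by auto
  have "t + 1 \<ge> - 2" using Cons.prems by simp
  then obtain D where D: "D \<ge> 0" "\<And>h. nsq (t + 1 + real (length L)) (lk h) \<le> D * nsq (t + 1) (lk (prod_list L * h))"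
    using Cons.IH[of "t + 1"] Cons.prems by auto
  have "nsq (t + 1 + real (length L)) (lk h) \<le> D * (C * nsq t (lk (f * (prod_list L * h))))" for h
    by (rule order_trans[OF D(2) mult_left_mono[OF C(2) D(1)]])
  moreover have "D * C \<ge> 0" using C(1) D(1) by simp
  moreover have "t + real (length (f # L)) = t + 1 + real (length L)" by simp
  ultimately show ?case unfolding prod_list.Cons mult.assoc[of f] mult.assoc[of D C, symmetric] by metis
qed

lemma nsq_antimono': "nsq (t + 1) (lk p) \<le> nsq t (lk p)" if "t \<ge> - 2"
  using nsq_add_1_le[OF that lookup_in_hspace] by blast

lemma three_term_bound:
  fixes x :: real
  assumes "x \<le> 2 * a + 2 * (2 * b + 2 * c)" "a \<le> A" "b \<le> B" "c \<le> D"
  shows "x \<le> 2 * A + 4 * B + 4 * D"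
  using assms by simp

text \<open>
  Moving T past q costs, for each set A of factors, a commutator with the factors in A. It gains
  2 |A| steps of the scale while deleting the factors in A from q loses only |A| of them.
\<close>

lemma psi_commutes_approximately:
  assumes t: "t \<ge> - 2" and L: "\<And>f. f \<in> set L \<Longrightarrow> bounded_below f" and T: "psi (3 + t) r T"
  shows "\<exists>C\<ge>0. \<forall>h. nsq t (lk (T (prod_list L * h) - prod_list L * T h)) \<le> C * nsq (t + real (2 * r) + 1) (lk (prod_list L * h))"
  using L T
proof (induction L arbitrary: r T)
  case Nil
  then show ?case using t by (intro exI[of _ 0]) (simp add: nsq_def)
next
  case (Cons f L)
  let ?q = "prod_list L"
  have ad: "psi (3 + t) (Suc r) (ad f T)" using psi_ad[OF _ Cons.prems(2)] t by simp
  let ?s = "t + real (2 * r) + 1"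
  have s: "?s \<ge> - 2" using t by simp
  have s2: "t + real (2 * Suc r) = ?s + 1" by simp
  obtain C1 where C1: "C1 \<ge> 0" "\<And>h. nsq t (lk (T (?q * h) - ?q * T h)) \<le> C1 * nsq ?s (lk (?q * h))"
    using Cons.IH[OF _ Cons.prems(2)] Cons.prems(1) by (auto simp del: of_nat_mult)
  obtain C2 where C2: "C2 \<ge> 0" "\<And>h. nsq t (lk (ad f T (?q * h) - ?q * ad f T h)) \<le> C2 * nsq (?s + 1 + 1) (lk (?q * h))"
    using Cons.IH[OF _ ad] Cons.prems(1) unfolding s2 by auto
  obtain C3 where C3: "C3 \<ge> 0" "\<And>u. nsq t (lk (ad f T u)) \<le> C3 * nsq (?s + 1) (lk u)"
    using psi_bounded[OF t ad, of 0] unfolding of_nat_0 add_0_right s2 by blast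
  obtain C4 where C4: "C4 \<ge> 0" "\<And>h. nsq (?s + 1) (lk h) \<le> C4 * nsq ?s (lk (f * h))"
    using bounded_belowE[of f ?s] Cons.prems(1) s by auto
  have "nsq t (lk (T (prod_list (f # L) * h) - prod_list (f # L) * T h)) \<le> (2 * C1 + 4 * C3 * C4 + 4 * C2 * C4) * nsq ?s (lk (prod_list (f # L) * h))" for h
  proof -
    define a where "a = T (?q * (f * h)) - ?q * T (f * h)"
    define b where "b = ad f T (?q * h)"
    define c where "c = ad f T (?q * h) - ?q * ad f T h"
    define N where "N = nsq ?s (lk (f * (?q * h)))"
    \<comment> \<open>The induction hypothesis enters for T at f * h, giving a, and for
      \<open>ad f T\<close> at h, giving c. Both b and c are measured by q h with the two additional
      steps of \<open>ad f T\<close>; replacing q h by f q h costs one of them, so the single step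
      claimed remains.\<close>
    have "T (f * ?q * h) - f * ?q * T h = a + (b - c)"
    proof -
      have "b - c = ?q * ad f T h" by (simp add: b_def c_def)
      also have "\<dots> = ?q * T (f * h) - f * ?q * T h" unfolding ad_def right_diff_distrib by (simp only: mult_ac)
      finally have "b - c = ?q * T (f * h) - f * ?q * T h" .
      moreover have "T (f * ?q * h) = T (?q * (f * h))" by (simp only: mult_ac)
      ultimately show ?thesis by (simp add: a_def)
    qed
    then have "nsq t (lk (T (f * ?q * h) - f * ?q * T h)) \<le> 2 * nsq t (lk a) + 2 * (2 * nsq t (lk b) + 2 * nsq t (lk c))"
      using nsq_lk_add[OF t, of a "b - c"] nsq_lk_diff[OF t, of b c] by simp
    moreover have "nsq t (lk a) \<le> C1 * N"
      using C1(2)[of "f * h"] unfolding a_def N_def mult.left_commute[of f ?q h] .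
    moreover have q: "nsq (?s + 1) (lk (?q * h)) \<le> C4 * N" using C4(2)[of "?q * h"] by (simp add: N_def)
    then have "nsq t (lk b) \<le> C3 * (C4 * N)"
      unfolding b_def by (rule order_trans[OF C3(2) mult_left_mono[OF _ C3(1)]])
    moreover have "nsq (?s + 1 + 1) (lk (?q * h)) \<le> C4 * N"
      using q nsq_antimono'[of "?s + 1" "?q * h"] s by simp
    then have "nsq t (lk c) \<le> C2 * (C4 * N)"
      unfolding c_def by (rule order_trans[OF C2(2) mult_left_mono[OF _ C2(1)]])
    ultimately have "nsq t (lk (T (f * ?q * h) - f * ?q * T h)) \<le> 2 * (C1 * N) + 4 * (C3 * (C4 * N)) + 4 * (C2 * (C4 * N))"
      by (rule three_term_bound)
    also have "\<dots> = (2 * C1 + 4 * C3 * C4 + 4 * C2 * C4) * N" by (simp add: algebra_simps)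
    finally have "nsq t (lk (T (f * ?q * h) - f * ?q * T h)) \<le> (2 * C1 + 4 * C3 * C4 + 4 * C2 * C4) * N" .
    then show ?thesis by (simp only: prod_list.Cons N_def mult.assoc)
  qed
  moreover have "2 * C1 + 4 * C3 * C4 + 4 * C2 * C4 \<ge> 0" using C1 C2 C3 C4 by simp
  ultimately show ?case by blast
qed

definition low_part :: "nat \<Rightarrow> cpoly2 \<Rightarrow> cpoly2" where
  "low_part M v = Poly_Mapping.mapp (\<lambda>k c. if tdeg k < M then c else 0) v"

lemma lookup_low_part: "lk (low_part M v) k = (if tdeg k < M then lk v k else 0)"
  by (simp add: low_part_def lookup_mapp when_def in_keys_iff)

lemma nsq_low_part_le:
  assumes t: "t \<ge> - 2"
  shows "nsq t (lk (low_part M v)) \<le> real M ^ n * nsq (t + real n) (lk v)"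
proof (rule nsq_pointwise_le[THEN conjunct2])
  fix k :: "nat \<times> nat"
  have "weight t k \<le> real M ^ n * weight (t + real n) k" if "tdeg k < M"
  proof -
    have "(1 + real (tdeg k)) ^ n \<le> real M ^ n" using that by (intro power_mono) auto
    then have "(1 + real (tdeg k)) ^ n * weight (t + real n) k \<le> real M ^ n * weight (t + real n) k"
      using t by (intro mult_right_mono) auto
    then show ?thesis using weight_add_nat_ge[OF t, of k n] by linarith
  qed
  from mult_left_mono[OF this, of "(cmod (lk v k))\<^sup>2"]
  show "(cmod (lk (low_part M v) k))\<^sup>2 * weight t k \<le> real M ^ n * ((cmod (lk v k))\<^sup>2 * weight (t + real n) k)"
    using t by (auto simp: lookup_low_part mult.left_commute)
qed (use t lookup_in_hspace in auto)

text \<open>For g = q h the element q (T h) is close to T g, but it need not lie in I; deleting the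
  coefficients of T h of degree below M puts it there. The deleted part is bounded through the size
  of h, which loses one step for every factor of q. In degrees below M all norms of the scale are
  equivalent, so this loss only affects the constant.\<close>

lemma psi_almost_preserves_ideal:
  assumes t: "t \<ge> - 2" and L: "\<And>f. f \<in> set L \<Longrightarrow> bounded_below f" and T: "psi (3 + t) 0 T"
    and I: "\<And>g. g \<in> I \<Longrightarrow> \<exists>h. g = prod_list L * h"
    and M: "\<And>v. (\<And>k. tdeg k < M \<Longrightarrow> lk v k = 0) \<Longrightarrow> prod_list L * v \<in> I"
  shows "\<exists>C\<ge>0. \<forall>g\<in>I. \<exists>E\<in>I. nsq t (lk (T g - E)) \<le> C * nsq (t + 1) (lk g)"
proof -
  let ?q = "prod_list L"
  \<comment> \<open>One step for the gain to be proved and one for each factor removed from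
    g.\<close>
  let ?n = "Suc (length L)"
  obtain C1 where C1: "C1 \<ge> 0" "\<And>h. nsq t (lk (T (?q * h) - ?q * T h)) \<le> C1 * nsq (t + 1) (lk (?q * h))"
    using psi_commutes_approximately[OF t L T] by auto
  obtain C2 where C2: "C2 \<ge> 0" "\<And>u. nsq t (lk (?q * u)) \<le> C2 * nsq t (lk u)"
    using nsq_mult_le[OF t] by blast
  obtain C3 where C3: "C3 \<ge> 0" "\<And>u. nsq (t + real ?n) (lk (T u)) \<le> C3 * nsq (t + real ?n) (lk u)"
    using psi_bounded[OF t T, of ?n] by auto
  have "t + 1 \<ge> - 2" using t by simp
  from prod_bounded_below[OF L this]
  obtain C4 where C4: "C4 \<ge> 0" "\<And>h. nsq (t + real ?n) (lk h) \<le> C4 * nsq (t + 1) (lk (?q * h))"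
    by (auto simp: add_ac)
  define K where "K = C2 * (real M ^ ?n * (C3 * C4))"
  have K: "K \<ge> 0" using C2 C3 C4 by (simp add: K_def)
  have "\<exists>E\<in>I. nsq t (lk (T g - E)) \<le> (2 * C1 + 2 * K) * nsq (t + 1) (lk g)" if "g \<in> I" for g
  proof -
    obtain h where h: "g = ?q * h" using I \<open>g \<in> I\<close> by blast
    let ?v = "T h - low_part M (T h)"
    have "?q * ?v \<in> I" by (rule M) (simp add: lookup_minus lookup_low_part)
    moreover have "nsq t (lk (T g - ?q * ?v)) \<le> (2 * C1 + 2 * K) * nsq (t + 1) (lk g)"
    proof -
      have "T g - ?q * ?v = (T g - ?q * T h) + ?q * low_part M (T h)" by (simp add: algebra_simps)
      then have "nsq t (lk (T g - ?q * ?v)) \<le> 2 * nsq t (lk (T g - ?q * T h)) + 2 * nsq t (lk (?q * low_part M (T h)))"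
        using nsq_lk_add[OF t, of "T g - ?q * T h" "?q * low_part M (T h)"] by (simp only:)
      moreover have "nsq t (lk (?q * low_part M (T h))) \<le> K * nsq (t + 1) (lk g)"
      proof -
        have "nsq (t + real ?n) (lk (T h)) \<le> C3 * (C4 * nsq (t + 1) (lk g))"
          unfolding h by (rule order_trans[OF C3(2) mult_left_mono[OF C4(2) C3(1)]])
        then have "nsq t (lk (low_part M (T h))) \<le> real M ^ ?n * (C3 * (C4 * nsq (t + 1) (lk g)))"
          by (rule order_trans[OF nsq_low_part_le[OF t, of M _ ?n] mult_left_mono]) simp
        then have "nsq t (lk (?q * low_part M (T h))) \<le> C2 * (real M ^ ?n * (C3 * (C4 * nsq (t + 1) (lk g))))"
          by (rule order_trans[OF C2(2) mult_left_mono[OF _ C2(1)]])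
        then show ?thesis unfolding K_def by (simp only: mult.assoc)
      qed
      moreover have "nsq t (lk (T g - ?q * T h)) \<le> C1 * nsq (t + 1) (lk g)" unfolding h by (rule C1(2))
      ultimately show ?thesis unfolding distrib_right by linarith
    qed
    ultimately show ?thesis by blast
  qed
  moreover have "2 * C1 + 2 * K \<ge> 0" using C1 K by simp
  ultimately show ?thesis by blast
qed

section \<open>Quasi homogeneous ideals in two variables\<close>

abbreviation single :: "nat \<times> nat \<Rightarrow> complex \<Rightarrow> cpoly2" where "single \<equiv> Poly_Mapping.single"

definition wdeg :: "nat \<Rightarrow> nat \<Rightarrow> nat \<times> nat \<Rightarrow> nat" where
  "wdeg n1 n2 k = n1 * fst k + n2 * snd k"

lemma wdeg_add: "wdeg n1 n2 (k + l) = wdeg n1 n2 k + wdeg n1 n2 l"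
  by (simp add: wdeg_def algebra_simps)

lemma quasi_homogeneous_iff:
  "quasi_homogeneous n1 n2 m p \<longleftrightarrow> (\<forall>k\<in>Poly_Mapping.keys p. wdeg n1 n2 k = m)"
  by (auto simp: quasi_homogeneous_def wdeg_def)

lemma quasi_homogeneous_mult:
  assumes "quasi_homogeneous n1 n2 m p" "quasi_homogeneous n1 n2 m' q"
  shows "quasi_homogeneous n1 n2 (m + m') (p * q)"
  unfolding quasi_homogeneous_iff
proof
  fix k assume "k \<in> Poly_Mapping.keys (p * q)"
  then obtain i j where "k = i + j" "i \<in> Poly_Mapping.keys p" "j \<in> Poly_Mapping.keys q"
    using keys_mult by blast
  then show "wdeg n1 n2 k = m + m'" using assms by (simp add: quasi_homogeneous_iff wdeg_add)
qed

text \<open>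
  The quotient can be replaced by one of its quasi homogeneous components. The degree of that
  component is described by an equation because it would be negative if the degree of q
  exceeded m.
\<close>

lemma quasi_homogeneous_quotient:
  assumes q: "quasi_homogeneous n1 n2 d q" and g: "quasi_homogeneous n1 n2 m g" "g = q * h"
  shows "\<exists>e. g = q * e \<and> (\<forall>k\<in>Poly_Mapping.keys e. d + wdeg n1 n2 k = m)"
proof -
  define e where "e = Poly_Mapping.mapp (\<lambda>k c. if d + wdeg n1 n2 k = m then c else 0) h"
  have e: "lk e k = (if d + wdeg n1 n2 k = m then lk h k else 0)" for k
    by (simp add: e_def lookup_mapp when_def in_keys_iff)
  have ekeys: "\<forall>k\<in>Poly_Mapping.keys e. d + wdeg n1 n2 k = m"
    by (auto simp: in_keys_iff e split: if_splits)
  have rest: "\<forall>k\<in>Poly_Mapping.keys (h - e). d + wdeg n1 n2 k \<noteq> m"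
    by (auto simp: in_keys_iff lookup_minus e split: if_splits)
  have eq: "g - q * e = q * (h - e)" by (simp add: g(2) right_diff_distrib)
  have "lk (g - q * e) k = 0" for k
  proof (cases "wdeg n1 n2 k = m")
    case True
    have "k \<notin> Poly_Mapping.keys (q * (h - e))"
    proof
      assume "k \<in> Poly_Mapping.keys (q * (h - e))"
      then obtain i j where "k = i + j" "i \<in> Poly_Mapping.keys q" "j \<in> Poly_Mapping.keys (h - e)"
        using keys_mult by blast
      then show False using True q rest by (auto simp: quasi_homogeneous_iff wdeg_add)
    qed
    then show ?thesis unfolding eq by (simp add: in_keys_iff)
  next
    case False
    have "k \<notin> Poly_Mapping.keys g" using False g(1) by (auto simp: quasi_homogeneous_iff)
    moreover have "k \<notin> Poly_Mapping.keys (q * e)"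
    proof
      assume "k \<in> Poly_Mapping.keys (q * e)"
      then obtain i j where "k = i + j" "i \<in> Poly_Mapping.keys q" "j \<in> Poly_Mapping.keys e"
        using keys_mult by blast
      then show False using False q ekeys by (auto simp: quasi_homogeneous_iff wdeg_add)
    qed
    ultimately show ?thesis by (simp add: in_keys_iff lookup_minus)
  qed
  then have "g - q * e = 0" by (intro poly_mapping_eqI) simp
  then have "g = q * e" by simp
  then show ?thesis using ekeys by blast
qed

section \<open>Factorization into variables and binomials\<close>

definition binom :: "nat \<Rightarrow> nat \<Rightarrow> complex \<Rightarrow> cpoly2" where
  "binom n1 n2 c = single (n2, 0) 1 - single (0, n1) c"

text \<open>For coprime weights these are, up to constants, the irreducible quasi homogeneous
  polynomials. The weights sit crosswise as exponents in \<open>binom\<close> because x^n2 and y^n1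
  both have weighted degree n1 n2.\<close>

definition qfactor :: "nat \<Rightarrow> nat \<Rightarrow> cpoly2 \<Rightarrow> bool" where
  "qfactor n1 n2 f \<longleftrightarrow> f = polyX \<or> f = polyY \<or> (\<exists>c. c \<noteq> 0 \<and> f = binom n1 n2 c)"

lemma quasi_homogeneous_binom: "quasi_homogeneous n1 n2 (n1 * n2) (binom n1 n2 c)"
  by (auto simp: quasi_homogeneous_iff wdeg_def binom_def in_keys_iff lookup_minus lookup_single when_def split: if_splits)

lemma qfactor_quasi_homogeneous:
  assumes "qfactor n1 n2 f" "n1 > 0" "n2 > 0"
  shows "\<exists>d>0. quasi_homogeneous n1 n2 d f"
proof -
  have "quasi_homogeneous n1 n2 n1 polyX" "quasi_homogeneous n1 n2 n2 polyY"
    by (auto simp: quasi_homogeneous_iff wdeg_def polyX_def polyY_def)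
  then show ?thesis using assms quasi_homogeneous_binom[of n1 n2] nat_0_less_mult_iff
    unfolding qfactor_def by blast
qed

lemma qfactor_prod_quasi_homogeneous:
  assumes "\<And>f. f \<in> set L \<Longrightarrow> qfactor n1 n2 f" "n1 > 0" "n2 > 0"
  shows "\<exists>d\<ge>length L. quasi_homogeneous n1 n2 d (prod_list L)"
  using assms(1)
proof (induction L)
  case Nil
  show ?case by (auto simp: quasi_homogeneous_iff wdeg_def in_keys_iff lookup_one when_def)
next
  case (Cons f L)
  obtain d where d: "d \<ge> length L" "quasi_homogeneous n1 n2 d (prod_list L)" using Cons by auto
  obtain d' where d': "d' > 0" "quasi_homogeneous n1 n2 d' f"
    using qfactor_quasi_homogeneous[OF _ assms(2,3)] Cons.prems by auto
  have "quasi_homogeneous n1 n2 (d' + d) (prod_list (f # L))"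
    using quasi_homogeneous_mult[OF d'(2) d(2)] by simp
  moreover have "d' + d \<ge> length (f # L)" using d d' by simp
  ultimately show ?case by blast
qed

text \<open>Modulo the binomial, x^n2 may be traded for c y^n1. Doing this as often as possible
  leaves a normal form whose exponent of x is below n2.\<close>

lemma binom_dvd_single_diff:
  assumes "n2 > 0"
  shows "binom n1 n2 c dvd single (a, b) 1 - single (a mod n2, b + n1 * (a div n2)) (c ^ (a div n2))"
proof (induction a arbitrary: b rule: less_induct)
  case (less a)
  show ?case
  proof (cases "a < n2")
    case False
    then have lt: "a - n2 < a" using assms by simp
    have dm: "a div n2 = Suc ((a - n2) div n2)" "a mod n2 = (a - n2) mod n2"
      using False assms by (simp_all add: le_div_geq le_mod_geq)
    let ?r = "single ((a - n2) mod n2, b + n1 + n1 * ((a - n2) div n2)) (c ^ ((a - n2) div n2))"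
    have "binom n1 n2 c dvd single (a - n2, b) 1 * binom n1 n2 c" by simp
    moreover have "binom n1 n2 c dvd const c * (single (a - n2, b + n1) 1 - ?r)"
      using less.IH[OF lt, of "b + n1"] by (rule dvd_mult)
    ultimately have "binom n1 n2 c dvd single (a - n2, b) 1 * binom n1 n2 c + const c * (single (a - n2, b + n1) 1 - ?r)"
      by (rule dvd_add)
    also have "\<dots> = single (a, b) 1 - single (a mod n2, b + n1 * (a div n2)) (c ^ (a div n2))"
      using False by (simp add: binom_def right_diff_distrib mult_single dm zero_prod_def algebra_simps)
    finally show ?thesis .
  qed simp
qed

text \<open>Since n1 is invertible modulo n2, the weighted degree fixes the exponent of x modulo n2.
  Monomials of equal weighted degree thus have the same normal form up to a power of c.\<close>

lemma wdeg_reduced_eq: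
  assumes "coprime n1 n2" "n2 > 0" "wdeg n1 n2 (a, b) = wdeg n1 n2 (a', b')"
  shows "a mod n2 = a' mod n2" "b + n1 * (a div n2) = b' + n1 * (a' div n2)"
proof -
  have eq: "n1 * a + n2 * b = n1 * a' + n2 * b'" using assms(3) by (simp add: wdeg_def)
  have "(n1 * a) mod n2 = (n1 * a + n2 * b) mod n2" by simp
  also have "\<dots> = (n1 * a') mod n2" unfolding eq by simp
  finally have mod_eq: "(n1 * a) mod n2 = (n1 * a') mod n2" .
  have "int a mod int n2 = int a' mod int n2"
  proof (rule mult_mod_cancel_left)
    show "(int n1 * int a) mod int n2 = (int n1 * int a') mod int n2"
      using mod_eq by (metis of_nat_mult zmod_int)
    show "coprime (int n2) (int n1)" using assms(1) by (simp add: coprime_commute)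
  qed
  then show m: "a mod n2 = a' mod n2" by (metis of_nat_eq_iff zmod_int)
  have "n1 * (n2 * (a div n2) + a mod n2) + n2 * b = n1 * (n2 * (a' div n2) + a' mod n2) + n2 * b'"
    by (simp only: mult_div_mod_eq eq)
  note sum_eq = this
  have "n2 * (b + n1 * (a div n2)) = n2 * (b' + n1 * (a' div n2))"
  proof -
    have "n2 * (b + n1 * x) = n2 * (b' + n1 * y)"
      if "n1 * (n2 * x + r) + n2 * b = n1 * (n2 * y + r) + n2 * b'" for x y r
      using that by (simp add: algebra_simps)
    from this[OF sum_eq[unfolded m]] show ?thesis .
  qed
  then show "b + n1 * (a div n2) = b' + n1 * (a' div n2)" using assms(2) by simp
qed

text \<open>
  The restriction of a quasi homogeneous polynomial to the curves on which the binomials vanish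
  is, up to a monomial, a polynomial in the single variable c.
\<close>

definition restr :: "nat \<Rightarrow> cpoly2 \<Rightarrow> complex poly" where
  "restr n2 e = (\<Sum>k\<in>Poly_Mapping.keys e. monom (lk e k) (fst k div n2))"

text \<open>All monomials of e reduce to one and the same x^\<alpha> y^\<beta>, with exponents
  independent of c, and the collected powers of c form \<open>restr\<close>. A root c of
  \<open>restr\<close> therefore yields a binomial divisor of e.\<close>

lemma binom_dvd_restr:
  assumes "coprime n1 n2" "n2 > 0" and e: "quasi_homogeneous n1 n2 m e"
  shows "\<exists>\<alpha> \<beta>. \<alpha> < n2 \<and> (\<forall>c. binom n1 n2 c dvd e - single (\<alpha>, \<beta>) (poly (restr n2 e) c))"
proof (cases "e = 0")
  case True
  then show ?thesis using assms(2) by (intro exI[of _ 0]) (simp add: restr_def)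
next
  case False
  then obtain k0 where k0: "k0 \<in> Poly_Mapping.keys e" by (metis all_not_in_conv keys_eq_empty)
  obtain a0 b0 where k0': "k0 = (a0, b0)" by (cases k0)
  let ?\<alpha> = "a0 mod n2" and ?\<beta> = "b0 + n1 * (a0 div n2)"
  have "binom n1 n2 c dvd e - single (?\<alpha>, ?\<beta>) (poly (restr n2 e) c)" for c
  proof -
    have "binom n1 n2 c dvd const (lk e k) * (single k 1 - single (?\<alpha>, ?\<beta>) (c ^ (fst k div n2)))"
      if k: "k \<in> Poly_Mapping.keys e" for k
    proof (rule dvd_mult)
      obtain a b where kk: "k = (a, b)" by (cases k)
      have "wdeg n1 n2 (a, b) = wdeg n1 n2 (a0, b0)"
        using e k k0 by (simp add: quasi_homogeneous_iff kk k0')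
      from wdeg_reduced_eq[OF assms(1,2) this]
      show "binom n1 n2 c dvd single k 1 - single (?\<alpha>, ?\<beta>) (c ^ (fst k div n2))"
        using binom_dvd_single_diff[OF assms(2), of n1 c a b] by (simp add: kk)
    qed
    then have "binom n1 n2 c dvd (\<Sum>k\<in>Poly_Mapping.keys e. const (lk e k) * (single k 1 - single (?\<alpha>, ?\<beta>) (c ^ (fst k div n2))))"
      by (rule dvd_sum)
    also have "\<dots> = (\<Sum>k\<in>Poly_Mapping.keys e. single k (lk e k)) - (\<Sum>k\<in>Poly_Mapping.keys e. single (?\<alpha>, ?\<beta>) (lk e k * c ^ (fst k div n2)))"
      by (simp add: right_diff_distrib mult_single sum_subtractf)
    also have "(\<Sum>k\<in>Poly_Mapping.keys e. single k (lk e k)) = e" by (rule poly_eq_sum_single[symmetric])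
    also have "(\<Sum>k\<in>Poly_Mapping.keys e. single (?\<alpha>, ?\<beta>) (lk e k * c ^ (fst k div n2))) = single (?\<alpha>, ?\<beta>) (poly (restr n2 e) c)"
      by (rule poly_mapping_eqI) (simp add: restr_def poly_sum poly_monom lookup_sum lookup_single when_def)
    finally show ?thesis .
  qed
  then show ?thesis using assms(2) by (intro exI[of _ ?\<alpha>] exI[of _ ?\<beta>]) simp
qed

text \<open>Within one weighted degree the quotient of the exponent of x by n2 determines the
  monomial, so no two terms of e merge in \<open>restr\<close>.\<close>

lemma coeff_restr:
  assumes "coprime n1 n2" "n2 > 0" and e: "quasi_homogeneous n1 n2 m e" and k: "k \<in> Poly_Mapping.keys e"
  shows "coeff (restr n2 e) (fst k div n2) = lk e k"
proof -
  have inj: "j = k" if "j \<in> Poly_Mapping.keys e" "fst j div n2 = fst k div n2" for j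
  proof -
    have "wdeg n1 n2 (fst j, snd j) = wdeg n1 n2 (fst k, snd k)"
      using e k that by (simp add: quasi_homogeneous_iff)
    from wdeg_reduced_eq[OF assms(1,2) this] that show ?thesis
      by (metis add_right_imp_eq div_mult_mod_eq prod.collapse)
  qed
  have "coeff (restr n2 e) (fst k div n2) = (\<Sum>j\<in>Poly_Mapping.keys e. if fst j div n2 = fst k div n2 then lk e j else 0)"
    by (simp add: restr_def coeff_sum)
  also have "\<dots> = (\<Sum>j\<in>Poly_Mapping.keys e. if j = k then lk e j else 0)"
    using inj by (intro sum.cong) auto
  also have "\<dots> = lk e k" using k by simp
  finally show ?thesis .
qed

text \<open>By the fundamental theorem of algebra a polynomial without nonzero roots is a single
  monomial, which cannot have two nonzero coefficients.\<close>

lemma nonzero_root: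
  fixes E :: "complex poly"
  assumes "coeff E i \<noteq> 0" "coeff E j \<noteq> 0" "i \<noteq> j"
  shows "\<exists>c. c \<noteq> 0 \<and> poly E c = 0"
proof (rule ccontr)
  assume no: "\<not> ?thesis"
  have "E \<noteq> 0" using assms(1) by auto
  then obtain A where A: "size A = degree E" "E = smult (lead_coeff E) (\<Prod>x\<in>#A. [:- x, 1:])"
    using alg_closed_imp_factorization by blast
  have "x = 0" if "x \<in># A" for x
  proof -
    have "poly (\<Prod>x\<in>#A. [:- x, 1:]) x = 0" using that by (auto simp: poly_prod_mset)
    then have "poly E x = 0" by (subst A(2)) simp
    then show ?thesis using no by blast
  qed
  then have "(\<Prod>x\<in>#A. [:- x, 1:]) = monom 1 (size A)"
    by (induction A) (simp_all add: monom_Suc one_pCons monom_0)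
  with A(2) have "E = smult (lead_coeff E) (monom 1 (size A))" by simp
  then have "E = monom (lead_coeff E) (size A)" by (simp add: smult_monom)
  then have "i = size A" "j = size A" using assms by (metis coeff_monom)+
  then show False using assms(3) by simp
qed

lemma single_eq_power: "single (a, b) c = const c * prod_list (replicate a polyX @ replicate b polyY)"
proof -
  have "prod_list (replicate a polyX @ replicate b polyY) = polyX ^ a * polyY ^ b" by simp
  moreover have "polyX ^ a = single (a, 0) 1"
    by (induction a) (simp_all add: polyX_def mult_single zero_prod_def[symmetric])
  moreover have "polyY ^ b = single (0, b) 1"
    by (induction b) (simp_all add: polyY_def mult_single zero_prod_def[symmetric])
  ultimately show ?thesis by (simp add: mult_single)
qed

text \<open>A single monomial is a product of variables. With two monomials \<open>restr\<close> has
  two nonzero coefficients, hence a nonzero root, and the corresponding binomial splits off,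
  lowering the weighted degree.\<close>

lemma quasi_homogeneous_factorization:
  assumes n: "coprime n1 n2" "n1 > 0" "n2 > 0" and e: "quasi_homogeneous n1 n2 m e" "e \<noteq> 0"
  shows "\<exists>c L. c \<noteq> 0 \<and> (\<forall>f\<in>set L. qfactor n1 n2 f) \<and> e = const c * prod_list L"
  using e
proof (induction m arbitrary: e rule: less_induct)
  case (less m)
  obtain k where k: "k \<in> Poly_Mapping.keys e" using less.prems by (metis all_not_in_conv keys_eq_empty)
  show ?case
  proof (cases "Poly_Mapping.keys e = {k}")
    case True
    obtain a b where kk: "k = (a, b)" by (cases k)
    have "e = single (a, b) (lk e k)" using poly_eq_sum_single[of e] True by (simp add: kk)
    then have "e = const (lk e k) * prod_list (replicate a polyX @ replicate b polyY)"
      unfolding single_eq_power .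
    moreover have "lk e k \<noteq> 0" using k by (simp add: in_keys_iff)
    moreover have "\<forall>f\<in>set (replicate a polyX @ replicate b polyY). qfactor n1 n2 f"
      by (auto simp: qfactor_def)
    ultimately show ?thesis by blast
  next
    case False
    then obtain k' where k': "k' \<in> Poly_Mapping.keys e" "k' \<noteq> k" using k by blast
    have coeffs: "coeff (restr n2 e) (fst k div n2) = lk e k" "coeff (restr n2 e) (fst k' div n2) = lk e k'"
      using coeff_restr[OF n(1,3) less.prems(1)] k k' by blast+
    have "fst k div n2 \<noteq> fst k' div n2"
    proof
      assume eq: "fst k div n2 = fst k' div n2"
      have "wdeg n1 n2 (fst k, snd k) = wdeg n1 n2 (fst k', snd k')"
        using less.prems k k' by (simp add: quasi_homogeneous_iff)
      from wdeg_reduced_eq[OF n(1,3) this] eq k'(2) show False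
        by (metis add_right_imp_eq div_mult_mod_eq prod.collapse)
    qed
    then obtain c where c: "c \<noteq> 0" "poly (restr n2 e) c = 0"
      using nonzero_root[of "restr n2 e"] coeffs k k' by (metis in_keys_iff)
    obtain \<alpha> \<beta> where "binom n1 n2 c dvd e - single (\<alpha>, \<beta>) (poly (restr n2 e) c)"
      using binom_dvd_restr[OF n(1,3) less.prems(1)] by blast
    then obtain h where "e = binom n1 n2 c * h" using c(2) by (auto simp: dvd_def)
    from quasi_homogeneous_quotient[OF quasi_homogeneous_binom less.prems(1) this]
    obtain e' where e': "e = binom n1 n2 c * e'" "\<forall>k\<in>Poly_Mapping.keys e'. n1 * n2 + wdeg n1 n2 k = m" by blast
    have ne: "e' \<noteq> 0" using e'(1) less.prems by auto
    then obtain j where "j \<in> Poly_Mapping.keys e'" by (metis all_not_in_conv keys_eq_empty)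
    \<comment> \<open>A monomial of the cofactor witnesses n1 * n2 \<le> m, so the truncated
      difference is the true degree.\<close>
    with e'(2) have lt: "m - n1 * n2 < m" using n by (auto simp: nat_0_less_mult_iff intro!: diff_less)
    have "quasi_homogeneous n1 n2 (m - n1 * n2) e'" using e'(2) by (auto simp: quasi_homogeneous_iff)
    from less.IH[OF lt this ne] obtain d L where dL: "d \<noteq> 0" "\<forall>f\<in>set L. qfactor n1 n2 f" "e' = const d * prod_list L"
      by blast
    have "e = const d * prod_list (binom n1 n2 c # L)" unfolding e'(1) dL(3) by (simp only: prod_list.Cons mult.left_commute)
    moreover have "\<forall>f\<in>set (binom n1 n2 c # L). qfactor n1 n2 f" using dL c by (auto simp: qfactor_def)
    ultimately show ?thesis using dL(1) by blast
  qed
qed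

section \<open>Ideals of finite codimension with two generators\<close>

definition pair_ideal :: "cpoly2 \<Rightarrow> cpoly2 \<Rightarrow> cpoly2 set" where
  "pair_ideal f e = {p. \<exists>u v. p = f * u + e * v}"

lemma pair_ideal_mult: "p \<in> pair_ideal f e \<Longrightarrow> w * p \<in> pair_ideal f e"
proof -
  assume "p \<in> pair_ideal f e"
  then obtain u v where "p = f * u + e * v" by (auto simp: pair_ideal_def)
  then have "w * p = f * (w * u) + e * (w * v)" by (simp only: distrib_left mult.left_commute)
  then show ?thesis unfolding pair_ideal_def by blast
qed

lemma pair_ideal_add: "p \<in> pair_ideal f e \<Longrightarrow> q \<in> pair_ideal f e \<Longrightarrow> p + q \<in> pair_ideal f e"
proof -
  assume "p \<in> pair_ideal f e" "q \<in> pair_ideal f e"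
  then obtain u v u' v' where "p = f * u + e * v" "q = f * u' + e * v'" unfolding pair_ideal_def by blast
  then have "p + q = f * (u + u') + e * (v + v')" by (simp add: distrib_left add_ac)
  then show ?thesis unfolding pair_ideal_def by blast
qed

lemma pair_ideal_left: "f dvd p \<Longrightarrow> p \<in> pair_ideal f e"
  unfolding pair_ideal_def dvd_def mem_Collect_eq by (metis add.right_neutral mult_zero_right)

lemma pair_ideal_right: "e \<in> pair_ideal f e"
proof -
  have "e = f * 0 + e * 1" by simp
  then show ?thesis unfolding pair_ideal_def by blast
qed

lemma pair_ideal_congruent:
  assumes "f dvd p - q" "q \<in> pair_ideal f e"
  shows "p \<in> pair_ideal f e"
  using pair_ideal_add[OF pair_ideal_left[OF assms(1)] assms(2)] by simp

lemma pair_ideal_single: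
  assumes "single (a, b) c \<in> pair_ideal f e" "c \<noteq> 0" "a \<le> a'" "b \<le> b'"
  shows "single (a', b') d \<in> pair_ideal f e"
proof -
  have "single (a', b') d = single (a' - a, b' - b) (d / c) * single (a, b) c"
    using assms(2-4) by (simp add: mult_single)
  then show ?thesis using pair_ideal_mult[OF assms(1)] by metis
qed

lemma polyX_dvd: "polyX dvd p" if "\<And>b. lk p (0, b) = 0"
proof -
  have "polyX dvd single k (lk p k)" if k: "k \<in> Poly_Mapping.keys p" for k
  proof -
    obtain a b where kk: "k = (a, b)" by (cases k)
    obtain a' where a: "a = Suc a'" using \<open>\<And>b. lk p (0, b) = 0\<close> k by (cases a) (auto simp: kk in_keys_iff)
    have "single k (lk p k) = polyX * single (a', b) (lk p k)" by (simp add: kk a polyX_def mult_single)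
    then show ?thesis by (rule dvdI)
  qed
  then have "polyX dvd (\<Sum>k\<in>Poly_Mapping.keys p. single k (lk p k))" by (rule dvd_sum)
  then show ?thesis by (simp only: poly_eq_sum_single[symmetric])
qed

lemma polyY_dvd: "polyY dvd p" if "\<And>a. lk p (a, 0) = 0"
proof -
  have "polyY dvd single k (lk p k)" if k: "k \<in> Poly_Mapping.keys p" for k
  proof -
    obtain a b where kk: "k = (a, b)" by (cases k)
    obtain b' where b: "b = Suc b'" using \<open>\<And>a. lk p (a, 0) = 0\<close> k by (cases b) (auto simp: kk in_keys_iff)
    have "single k (lk p k) = polyY * single (a, b') (lk p k)" by (simp add: kk b polyY_def mult_single)
    then show ?thesis by (rule dvdI)
  qed
  then have "polyY dvd (\<Sum>k\<in>Poly_Mapping.keys p. single k (lk p k))" by (rule dvd_sum)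
  then show ?thesis by (simp only: poly_eq_sum_single[symmetric])
qed

text \<open>The weighted degree admits only one power of y in e, so modulo x the polynomial e is a
  nonzero multiple of some y^b. The ideal then contains every monomial divisible by x or by
  y^b.\<close>

lemma pair_ideal_X_cofinite:
  assumes n: "n1 > 0" "n2 > 0" and e: "quasi_homogeneous n1 n2 m e" and ndvd: "\<not> polyX dvd e"
  shows "\<exists>M. \<forall>k. M \<le> tdeg k \<longrightarrow> single k 1 \<in> pair_ideal polyX e"
proof -
  obtain b where b: "lk e (0, b) \<noteq> 0" using polyX_dvd ndvd by blast
  have uniq: "b' = b" if "lk e (0, b') \<noteq> 0" for b'
  proof -
    have "wdeg n1 n2 (0, b) = m" "wdeg n1 n2 (0, b') = m"
      using e b that by (auto simp: quasi_homogeneous_iff in_keys_iff)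
    then have "n2 * b = n2 * b'" by (simp add: wdeg_def)
    then show ?thesis using n by simp
  qed
  have "polyX dvd single (0, b) (lk e (0, b)) - e"
    by (rule polyX_dvd) (use uniq in \<open>auto simp: lookup_minus lookup_single when_def\<close>)
  then have base: "single (0, b) (lk e (0, b)) \<in> pair_ideal polyX e"
    using pair_ideal_congruent pair_ideal_right by blast
  have "single k 1 \<in> pair_ideal polyX e" if "b \<le> tdeg k" for k
  proof (cases "fst k")
    case 0
    then obtain b' where k: "k = (0, b')" by (cases k) auto
    then have "b \<le> b'" using that by simp
    then show ?thesis unfolding k by (intro pair_ideal_single[OF base b]) auto
  next
    case (Suc a)
    then have "k = (Suc a, snd k)" by (simp add: prod_eq_iff)
    then have "single k 1 = polyX * single (a, snd k) 1" by (metis mult_single polyX_def add_Pair add.left_neutral plus_1_eq_Suc mult_1)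
    then show ?thesis by (intro pair_ideal_left dvdI)
  qed
  then show ?thesis by blast
qed

lemma pair_ideal_Y_cofinite:
  assumes n: "n1 > 0" "n2 > 0" and e: "quasi_homogeneous n1 n2 m e" and ndvd: "\<not> polyY dvd e"
  shows "\<exists>M. \<forall>k. M \<le> tdeg k \<longrightarrow> single k 1 \<in> pair_ideal polyY e"
proof -
  obtain a where a: "lk e (a, 0) \<noteq> 0" using polyY_dvd ndvd by blast
  have uniq: "a' = a" if "lk e (a', 0) \<noteq> 0" for a'
  proof -
    have "wdeg n1 n2 (a, 0) = m" "wdeg n1 n2 (a', 0) = m"
      using e a that by (auto simp: quasi_homogeneous_iff in_keys_iff)
    then have "n1 * a = n1 * a'" by (simp add: wdeg_def)
    then show ?thesis using n by simp
  qed
  have "polyY dvd single (a, 0) (lk e (a, 0)) - e"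
    by (rule polyY_dvd) (use uniq in \<open>auto simp: lookup_minus lookup_single when_def\<close>)
  then have base: "single (a, 0) (lk e (a, 0)) \<in> pair_ideal polyY e"
    using pair_ideal_congruent pair_ideal_right by blast
  have "single k 1 \<in> pair_ideal polyY e" if "a \<le> tdeg k" for k
  proof (cases "snd k")
    case 0
    then obtain a' where k: "k = (a', 0)" by (cases k) auto
    then have "a \<le> a'" using that by simp
    then show ?thesis unfolding k by (intro pair_ideal_single[OF base a]) auto
  next
    case (Suc b)
    then have "k = (fst k, Suc b)" by (simp add: prod_eq_iff)
    then have "single k 1 = polyY * single (fst k, b) 1" by (metis mult_single polyY_def add_Pair add.left_neutral plus_1_eq_Suc mult_1)
    then show ?thesis by (intro pair_ideal_left dvdI)
  qed
  then show ?thesis by blast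
qed

text \<open>Modulo the binomial e is a nonzero multiple of x^\<alpha> y^\<beta> with \<alpha> < n2.
  So x^n2 y^\<beta> lies in the ideal, and trading x^n2 for c y^n1 produces the pure power
  y^(\<beta>+n1). It divides the normal form of every monomial of large degree.\<close>

lemma pair_ideal_binom_cofinite:
  assumes n: "coprime n1 n2" "n1 > 0" "n2 > 0" and c: "c \<noteq> 0"
    and e: "quasi_homogeneous n1 n2 m e" and ndvd: "\<not> binom n1 n2 c dvd e"
  shows "\<exists>M. \<forall>k. M \<le> tdeg k \<longrightarrow> single k 1 \<in> pair_ideal (binom n1 n2 c) e"
proof -
  let ?f = "binom n1 n2 c"
  obtain \<alpha> \<beta> where \<alpha>: "\<alpha> < n2" and red: "?f dvd e - single (\<alpha>, \<beta>) (poly (restr n2 e) c)"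
    using binom_dvd_restr[OF n(1,3) e] by blast
  let ?s = "poly (restr n2 e) c"
  have s: "?s \<noteq> 0" using red ndvd by auto
  have "?f dvd single (\<alpha>, \<beta>) ?s - e" using red by (metis dvd_minus_iff minus_diff_eq)
  then have 1: "single (\<alpha>, \<beta>) ?s \<in> pair_ideal ?f e"
    using pair_ideal_congruent pair_ideal_right by blast
  have 2: "single (n2, \<beta>) 1 \<in> pair_ideal ?f e" by (rule pair_ideal_single[OF 1 s]) (use \<alpha> in auto)
  have "single (0, \<beta>) 1 * ?f = single (n2, \<beta>) 1 - single (0, \<beta> + n1) c"
    by (simp add: binom_def right_diff_distrib mult_single)
  then have "?f dvd single (n2, \<beta>) 1 - single (0, \<beta> + n1) c" by (metis dvd_triv_right)
  then have "?f dvd single (0, \<beta> + n1) c - single (n2, \<beta>) 1" by (metis dvd_minus_iff minus_diff_eq)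
  then have 3: "single (0, \<beta> + n1) c \<in> pair_ideal ?f e" using 2 pair_ideal_congruent by blast
  \<comment> \<open>The normal form of x^a y^b has y exponent b + n1 (a div n2), at least b + a div
    n2, and n2 (b + a div n2) exceeds a + b - n2. The threshold forces this exponent up to \<beta> +
    n1.\<close>
  have "single k 1 \<in> pair_ideal ?f e" if k: "n2 * (\<beta> + n1) + n2 \<le> tdeg k" for k
  proof -
    obtain a b where kk: "k = (a, b)" by (cases k)
    let ?q = "a div n2"
    have "a < n2 * ?q + n2" using n(3) by (metis add_strict_left_mono mod_less_divisor mult_div_mod_eq)
    moreover have "b \<le> n2 * b" using n by simp
    moreover have "n2 * (\<beta> + n1) + n2 \<le> a + b" using k by (simp add: kk)
    ultimately have "n2 * (\<beta> + n1) < n2 * (?q + b)" unfolding distrib_left[of n2 ?q b] by linarith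
    then have "\<beta> + n1 \<le> ?q + b" by simp
    moreover have "?q \<le> n1 * ?q" using n by simp
    ultimately have "\<beta> + n1 \<le> b + n1 * ?q" by linarith
    then have "single (a mod n2, b + n1 * ?q) (c ^ ?q) \<in> pair_ideal ?f e"
      by (intro pair_ideal_single[OF 3 c]) auto
    then show ?thesis
      unfolding kk by (rule pair_ideal_congruent[OF binom_dvd_single_diff[OF n(3)]])
  qed
  then show ?thesis by blast
qed

lemma pair_ideal_cofinite:
  assumes n: "coprime n1 n2" "n1 > 0" "n2 > 0" and f: "qfactor n1 n2 f"
    and e: "quasi_homogeneous n1 n2 m e" "\<not> f dvd e"
  shows "\<exists>M. \<forall>k. M \<le> tdeg k \<longrightarrow> single k 1 \<in> pair_ideal f e"
  using f pair_ideal_X_cofinite[OF n(2,3) e(1)] pair_ideal_Y_cofinite[OF n(2,3) e(1)]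
    pair_ideal_binom_cofinite[OF n _ e(1)] e(2) unfolding qfactor_def by blast

text \<open>
  The list is chosen of maximal length among those whose product divides all generators. The
  cofactors then have no common factor, and the ideal J they generate contains all monomials of
  large degree: it contains a product of factors, and for each of these factors an element not
  divisible by it.
\<close>

theorem quasi_homogeneous_ideal_structure:
  assumes n: "coprime n1 n2" "n1 > 0" "n2 > 0"
    and G: "\<And>g. g \<in> G \<Longrightarrow> \<exists>m. quasi_homogeneous n1 n2 m g" and g0: "g0 \<in> G" "g0 \<noteq> 0"
  shows "\<exists>L M. (\<forall>f\<in>set L. qfactor n1 n2 f) \<and> (\<forall>g\<in>cpoly2.span G. \<exists>h. g = prod_list L * h) \<and>
    (\<forall>k. M \<le> tdeg k \<longrightarrow> prod_list L * single k 1 \<in> cpoly2.span G)"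
proof -
  define P where "P = (\<lambda>l. \<exists>L. length L = l \<and> (\<forall>f\<in>set L. qfactor n1 n2 f) \<and> (\<forall>g\<in>G. prod_list L dvd g))"
  obtain m0 where m0: "quasi_homogeneous n1 n2 m0 g0" using G g0 by blast
  \<comment> \<open>Every factor has positive weighted degree, so the degree of one nonzero
    generator limits the length of such lists.\<close>
  have bound: "l \<le> m0" if Pl: "P l" for l
  proof -
    obtain L where L: "length L = l" "\<forall>f\<in>set L. qfactor n1 n2 f" "prod_list L dvd g0"
      using Pl g0(1) unfolding P_def by blast
    obtain d where d: "d \<ge> length L" "quasi_homogeneous n1 n2 d (prod_list L)"
      using qfactor_prod_quasi_homogeneous[of L n1 n2] L(2) n by blast
    obtain h where "g0 = prod_list L * h" using L(3) by (rule dvdE)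
    from quasi_homogeneous_quotient[OF d(2) m0 this] obtain e where
      e: "g0 = prod_list L * e" "\<forall>k\<in>Poly_Mapping.keys e. d + wdeg n1 n2 k = m0" by blast
    have "e \<noteq> 0" using e(1) g0 by auto
    then obtain j where "j \<in> Poly_Mapping.keys e" by (metis all_not_in_conv keys_eq_empty)
    then show ?thesis using e(2) d(1) L(1) by force
  qed
  have "P 0" unfolding P_def by (intro exI[of _ "[]"]) simp
  note greatest = GreatestI_nat[of P, OF this bound] Greatest_le_nat[of P, OF _ bound]
  obtain L where L: "length L = Greatest P" "\<forall>f\<in>set L. qfactor n1 n2 f" "\<forall>g\<in>G. prod_list L dvd g"
    using greatest(1) unfolding P_def by blast
  let ?q = "prod_list L"
  obtain d where d: "quasi_homogeneous n1 n2 d ?q"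
    using qfactor_prod_quasi_homogeneous[of L n1 n2] L(2) n by blast
  let ?I = "cpoly2.span G"
  define J where "J = {h. ?q * h \<in> ?I}"
  have J_mult: "u * h \<in> J" if "h \<in> J" for u h
  proof -
    have "u * (?q * h) \<in> ?I" using that by (intro cpoly2.span_scale[of "?q * h"]) (simp add: J_def)
    then show ?thesis by (simp only: J_def mem_Collect_eq mult.left_commute)
  qed
  have J_add: "h + h' \<in> J" if "h \<in> J" "h' \<in> J" for h h'
    using that cpoly2.span_add by (auto simp: J_def distrib_left)
  have cofactor: "\<exists>e m. g = ?q * e \<and> quasi_homogeneous n1 n2 m e \<and> e \<in> J" if g: "g \<in> G" for g
  proof -
    obtain m where m: "quasi_homogeneous n1 n2 m g" using G g by blast
    obtain h where "g = ?q * h" using L(3) g by (auto elim: dvdE)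
    from quasi_homogeneous_quotient[OF d m this] obtain e where
      e: "g = ?q * e" "\<forall>k\<in>Poly_Mapping.keys e. d + wdeg n1 n2 k = m" by blast
    have "quasi_homogeneous n1 n2 (m - d) e" using e(2) by (auto simp: quasi_homogeneous_iff)
    moreover have "e \<in> J" using cpoly2.span_base[OF g] e(1) by (simp add: J_def)
    ultimately show ?thesis using e(1) by blast
  qed
  have cof: "\<exists>M. \<forall>k. M \<le> tdeg k \<longrightarrow> (\<exists>u. \<exists>v\<in>J. single k 1 = f * u + v)" if f: "qfactor n1 n2 f" for f
  proof -
    \<comment> \<open>Maximality of the length: otherwise f could be added to the list. The cofactor
      of such a generator is not divisible by f.\<close>
    have "\<exists>g\<in>G. \<not> prod_list (f # L) dvd g"
    proof (rule ccontr)
      assume "\<not> ?thesis"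
      then have "length (f # L) = Suc (Greatest P) \<and> (\<forall>f\<in>set (f # L). qfactor n1 n2 f) \<and> (\<forall>g\<in>G. prod_list (f # L) dvd g)"
        using L f by auto
      then have "P (Suc (Greatest P))" unfolding P_def[THEN fun_cong] by blast
      then have "Suc (Greatest P) \<le> Greatest P" by (rule greatest(2))
      then show False by simp
    qed
    then obtain g where g: "g \<in> G" "\<not> prod_list (f # L) dvd g" by blast
    obtain e m where e: "g = ?q * e" "quasi_homogeneous n1 n2 m e" "e \<in> J" using cofactor[OF g(1)] by blast
    have "\<not> f dvd e" using g(2) unfolding e(1) prod_list.Cons mult.commute[of f ?q]
      by (meson dvd_refl mult_dvd_mono)
    from pair_ideal_cofinite[OF n f e(2) this] obtain M where
      M: "\<And>k. M \<le> tdeg k \<Longrightarrow> single k 1 \<in> pair_ideal f e" by blast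
    have "\<exists>u. \<exists>v\<in>J. single k 1 = f * u + v" if k: "M \<le> tdeg k" for k
    proof -
      obtain u v where "single k 1 = f * u + e * v" using M[OF k] unfolding pair_ideal_def by blast
      moreover have "e * v \<in> J" using J_mult[OF e(3), of v] by (simp only: mult.commute)
      ultimately show ?thesis by blast
    qed
    then show ?thesis by blast
  qed
  have cofs: "\<exists>M. \<forall>k. M \<le> tdeg k \<longrightarrow> (\<exists>u. \<exists>v\<in>J. single k 1 = prod_list K * u + v)"
    if "\<forall>f\<in>set K. qfactor n1 n2 f" for K
    using that
  proof (induction K)
    case Nil
    have "single k 1 = prod_list [] * single k 1 + 0" "0 \<in> J" for k
      using cpoly2.span_zero by (auto simp: J_def)
    then show ?case by blast
  next
    case (Cons f K)
    obtain M1 where M1: "\<And>k. M1 \<le> tdeg k \<Longrightarrow> \<exists>u. \<exists>v\<in>J. single k 1 = f * u + v"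
      using cof[OF Cons.prems[THEN bspec, OF list.set_intros(1)]] by blast
    obtain M2 where M2: "\<And>k. M2 \<le> tdeg k \<Longrightarrow> \<exists>u. \<exists>v\<in>J. single k 1 = prod_list K * u + v"
      using Cons.IH Cons.prems by (metis list.set_intros(2))
    have "\<exists>u. \<exists>v\<in>J. single k 1 = prod_list (f # K) * u + v" if k: "M1 + M2 \<le> tdeg k" for k
    proof -
      obtain a b where kk: "k = (a, b)" by (cases k)
      \<comment> \<open>Splits off a monomial of degree exactly M1, using x as far as it goes and y
        for the rest; degree at least M2 is left over.\<close>
      define a1 where "a1 = min a M1"
      define b1 where "b1 = M1 - a1"
      let ?k1 = "(a1, b1)" and ?k2 = "(a - a1, b - b1)"
      have deg: "M1 \<le> tdeg ?k1" "M2 \<le> tdeg ?k2" "a1 \<le> a" "b1 \<le> b" using k by (auto simp: kk a1_def b1_def)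
      have "single k 1 = single ?k1 1 * single ?k2 1" using deg by (simp add: kk mult_single)
      moreover obtain u1 v1 where 1: "v1 \<in> J" "single ?k1 1 = f * u1 + v1" using M1[OF deg(1)] by blast
      moreover obtain u2 v2 where 2: "v2 \<in> J" "single ?k2 1 = prod_list K * u2 + v2" using M2[OF deg(2)] by blast
      ultimately have "single k 1 = (f * u1 + v1) * (prod_list K * u2 + v2)" by simp
      \<comment> \<open>Of the four products only the one of the two multiples escapes J, and it
        carries the full product f K.\<close>
      also have "\<dots> = prod_list (f # K) * (u1 * u2) + ((f * u1) * v2 + (prod_list K * u2 + v2) * v1)"
        by (simp only: prod_list.Cons distrib_left distrib_right mult_ac add_ac)
      finally show ?thesis using J_add J_mult 1(1) 2(1) by blast
    qed
    then show ?case by blast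
  qed
  obtain e0 m1 where e0: "g0 = ?q * e0" "quasi_homogeneous n1 n2 m1 e0" "e0 \<in> J" using cofactor[OF g0(1)] by blast
  have "e0 \<noteq> 0" using e0(1) g0(2) by auto
  \<comment> \<open>One cofactor is itself a product of factors up to a constant. That product lies
    in J, so in the decomposition of \<open>cofs\<close> for this K both summands do.\<close>
  from quasi_homogeneous_factorization[OF n e0(2) this] obtain c K where
    K: "c \<noteq> 0" "\<forall>f\<in>set K. qfactor n1 n2 f" "e0 = const c * prod_list K" by blast
  have "prod_list K = const (1 / c) * e0" unfolding K(3) using K(1) by (simp add: mult.assoc[symmetric] mult_single)
  then have KJ: "prod_list K \<in> J" using J_mult[OF e0(3)] by simp
  obtain M where M: "\<And>k. M \<le> tdeg k \<Longrightarrow> \<exists>u. \<exists>v\<in>J. single k 1 = prod_list K * u + v"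
    using cofs[OF K(2)] by blast
  have "?q * single k 1 \<in> ?I" if k: "M \<le> tdeg k" for k
  proof -
    obtain u v where uv: "v \<in> J" "single k 1 = prod_list K * u + v" using M[OF k] by blast
    have "prod_list K * u \<in> J" using J_mult[OF KJ, of u] by (simp only: mult.commute)
    then have "single k 1 \<in> J" unfolding uv(2) using uv(1) by (rule J_add)
    then show ?thesis by (simp add: J_def)
  qed
  moreover have "\<exists>h. g = ?q * h" if "g \<in> ?I" for g
  proof -
    have "?q dvd g"
      using that
    proof (induction rule: cpoly2.span_induct_alt)
      case (step u g h)
      then show ?case using L(3) by (intro dvd_add dvd_mult) auto
    qed simp
    then show ?thesis by (simp add: dvd_def)
  qed
  ultimately show ?thesis using L(2) by blast
qed

text \<open>The common divisor of the weights divides the weighted degree of every monomial, and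
  cancelling it does not change which monomials have equal degree. Coprimality is what makes normal
  forms modulo a binomial agree.\<close>

lemma quasi_homogeneous_ideal_coprime:
  assumes "quasi_homogeneous_ideal I"
  shows "\<exists>n1 n2 G. coprime n1 n2 \<and> n1 > 0 \<and> n2 > 0 \<and> (\<forall>g\<in>G. \<exists>m. quasi_homogeneous n1 n2 m g) \<and> I = cpoly2.span G"
proof -
  obtain n1 n2 G where n: "n1 > 0" "n2 > 0" and G: "\<forall>g\<in>G. \<exists>m. quasi_homogeneous n1 n2 m g" and I: "I = cpoly2.span G"
    using assms unfolding quasi_homogeneous_ideal_def by blast
  let ?d = "gcd n1 n2"
  have d: "?d > 0" using n by simp
  have wd: "?d * wdeg (n1 div ?d) (n2 div ?d) k = wdeg n1 n2 k" for k
    by (simp add: wdeg_def distrib_left mult.assoc[symmetric])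
  have "\<exists>m. quasi_homogeneous (n1 div ?d) (n2 div ?d) m g" if g: "g \<in> G" for g
  proof -
    obtain m where "quasi_homogeneous n1 n2 m g" using G g by blast
    then have "\<forall>k\<in>Poly_Mapping.keys g. ?d * wdeg (n1 div ?d) (n2 div ?d) k = m"
      by (simp only: wd quasi_homogeneous_iff)
    then have "quasi_homogeneous (n1 div ?d) (n2 div ?d) (m div ?d) g"
      using d unfolding quasi_homogeneous_iff by (metis nonzero_mult_div_cancel_left less_irrefl)
    then show ?thesis by blast
  qed
  moreover have "coprime (n1 div ?d) (n2 div ?d)" using n by (intro div_gcd_coprime) simp
  moreover have "n1 div ?d > 0" "n2 div ?d > 0" using n by (auto simp: div_greater_zero_iff intro: dvd_imp_le)
  ultimately show ?thesis using I by blast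
qed

section \<open>A criterion for membership in the Schatten classes\<close>

lemma finite_low: "finite {k :: nat \<times> nat. tdeg k \<le> l}"
  by (rule finite_subset[of _ "{..l} \<times> {..l}"]) auto

lemma card_low: "card {k :: nat \<times> nat. tdeg k \<le> l} \<le> (l + 1)\<^sup>2"
proof -
  have "card {k :: nat \<times> nat. tdeg k \<le> l} \<le> card ({..l} \<times> {..l})" by (rule card_mono) auto
  then show ?thesis by (simp add: power2_eq_square)
qed

text \<open>Quantitative form of the compact inclusion into the next space: up to finitely many
  coefficients one step gains a factor of order 1 / l. Degrees above l begin at l + 1, whence 4 + t
  + l.\<close>

lemma nsq_tail_le:
  assumes t: "t \<ge> - 2" and f: "f \<in> hspace t"
  shows "nsq (t + 1) f \<le> (\<Sum>k\<in>{k. tdeg k \<le> l}. (cmod (f k))\<^sup>2 * weight t k) + (3 + t) / (4 + t + real l) * nsq t f"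
proof -
  let ?low = "{k :: nat \<times> nat. tdeg k \<le> l}"
  let ?F = "\<lambda>k. (cmod (f k))\<^sup>2 * weight t k"
  let ?e = "(3 + t) / (4 + t + real l)"
  have F: "?F summable_on UNIV" using f by (simp add: hspace_def)
  have L: "(\<lambda>k. if k \<in> ?low then ?F k else 0) summable_on UNIV"
  proof -
    have "(\<lambda>k. if k \<in> ?low then ?F k else 0) summable_on UNIV \<longleftrightarrow> ?F summable_on ?low"
      by (rule summable_on_cong_neutral) auto
    then show ?thesis using finite_low by simp
  qed
  have E: "(\<lambda>k. ?e * ?F k) summable_on UNIV" using F by (rule summable_on_cmult_right)
  have le: "(cmod (f k))\<^sup>2 * weight (t + 1) k \<le> (if k \<in> ?low then ?F k else 0) + ?e * ?F k" for k
  proof (cases "k \<in> ?low")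
    case True
    have "(cmod (f k))\<^sup>2 * weight (t + 1) k \<le> ?F k"
      using weight_add_1_le[OF t] by (intro mult_left_mono) auto
    moreover have "0 \<le> ?e * ?F k" using t by simp
    ultimately show ?thesis using True by simp
  next
    case False
    then have "real l + 1 \<le> real (tdeg k)" by simp
    then have "(3 + t) / (3 + t + real (tdeg k)) \<le> ?e" using t by (intro divide_left_mono) auto
    then have "?F k * ((3 + t) / (3 + t + real (tdeg k))) \<le> ?F k * ?e" using t by (intro mult_left_mono) auto
    then show ?thesis using False unfolding weight_add_1[OF t] by (simp add: mult_ac)
  qed
  have S: "(\<lambda>k. (cmod (f k))\<^sup>2 * weight (t + 1) k) summable_on UNIV"
    using nsq_add_1_le[OF t f] by (simp add: hspace_def)
  have "nsq (t + 1) f \<le> infsum (\<lambda>k. (if k \<in> ?low then ?F k else 0) + ?e * ?F k) UNIV"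
    unfolding nsq_def using le by (intro infsum_mono S summable_on_add L E) blast
  also have "\<dots> = infsum (\<lambda>k. if k \<in> ?low then ?F k else 0) UNIV + infsum (\<lambda>k. ?e * ?F k) UNIV"
    using L E by (rule infsum_add)
  also have "infsum (\<lambda>k. if k \<in> ?low then ?F k else 0) UNIV = infsum ?F ?low"
    by (rule infsum_cong_neutral) auto
  also have "\<dots> = (\<Sum>k\<in>?low. ?F k)" using finite_low by simp
  also have "infsum (\<lambda>k. ?e * ?F k) UNIV = ?e * nsq t f"
    unfolding nsq_def by (rule infsum_cmult_right) (use F in blast)
  finally show ?thesis .
qed

lemma coordinatewise_convergent_subsequence:
  fixes F :: "nat \<Rightarrow> coeffs"
  assumes t: "t \<ge> - 2" and F: "\<And>n. F n \<in> hspace t" "\<And>n. hnorm t (F n) \<le> R"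
  shows "\<exists>r. strict_mono r \<and> (\<forall>k. convergent (\<lambda>n. F (r n) k))"
proof -
  let ?P = "\<lambda>n s. convergent (\<lambda>i. F (s i) (prod_decode n))"
  interpret subseqs ?P
  proof
    fix n and s :: "nat \<Rightarrow> nat"
    have "cmod (F (s i) (prod_decode n)) \<le> R / sqrt (weight t (prod_decode n))" for i
      using order_trans[OF cmod_coord_le[OF t F(1)] divide_right_mono[OF F(2)]] weight_nonneg[OF t] by simp
    then have "bounded (range (\<lambda>i. F (s i) (prod_decode n)))" by (auto simp: bounded_iff)
    from bounded_imp_convergent_subsequence[OF this]
    obtain l r where "strict_mono (r :: nat \<Rightarrow> nat)" "((\<lambda>i. F (s i) (prod_decode n)) \<circ> r) \<longlonglongrightarrow> l" by blast
    then show "\<exists>r'. strict_mono r' \<and> ?P n (s \<circ> r')" by (auto simp: convergent_def o_def)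
  qed
  have "convergent (\<lambda>n. F (diagseq n) k)" for k
  proof -
    have "?P (prod_encode k) (diagseq \<circ> ((+) (Suc (prod_encode k))))"
    proof (rule diagseq_holds)
      fix r s :: "nat \<Rightarrow> nat" and n assume "strict_mono r" "?P n s"
      then show "?P n (s \<circ> r)" using convergent_subseq_convergent[of "\<lambda>i. F (s i) (prod_decode n)" r] by (simp add: o_def)
    qed
    then have "convergent (\<lambda>n. F (diagseq (n + Suc (prod_encode k))) k)" by (simp add: add.commute)
    then show ?thesis using convergent_ignore_initial_segment[of "\<lambda>n. F (diagseq n) k"] by blast
  qed
  then show ?thesis using subseq_diagseq by blast
qed

text \<open>The differences have norm at most 2 R, so beyond a suitable degree their norms for t + 1
  are uniformly small; below it only finitely many convergent coefficients remain.\<close>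

lemma cauchy_next_space:
  fixes F :: "nat \<Rightarrow> coeffs"
  assumes t: "t \<ge> - 2" and F: "\<And>n. F n \<in> hspace t" "\<And>n. hnorm t (F n) \<le> R"
    and conv: "\<And>k. convergent (\<lambda>n. F n k)" and e: "e > 0"
  shows "\<exists>M. \<forall>m\<ge>M. \<forall>n\<ge>M. hnorm (t + 1) (F m - F n) < e"
proof -
  have R: "R \<ge> 0" using F(2)[of 0] hnorm_nonneg[OF t, of "F 0"] by linarith
  obtain l :: nat where l: "2 * (3 + t) * (2 * R)\<^sup>2 / e\<^sup>2 < real l" using reals_Archimedean2 by blast
  let ?low = "{k :: nat \<times> nat. tdeg k \<le> l}"
  have eps: "(3 + t) / (4 + t + real l) * (2 * R)\<^sup>2 \<le> e\<^sup>2 / 2"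
  proof -
    have "2 * (3 + t) * (2 * R)\<^sup>2 < real l * e\<^sup>2" using l e by (simp add: field_simps)
    also have "\<dots> \<le> (4 + t + real l) * e\<^sup>2" using t by (intro mult_right_mono) auto
    finally show ?thesis using t by (simp add: field_simps)
  qed
  have "\<exists>M. \<forall>m\<ge>M. \<forall>n\<ge>M. (\<Sum>k\<in>?low. (cmod ((F m - F n) k))\<^sup>2 * weight t k) < e\<^sup>2 / 2"
  proof -
    let ?c = "e\<^sup>2 / 2 / (real (card ?low) + 1)"
    have c: "?c > 0" using e by (simp add: add_nonneg_pos)
    have "\<exists>M. \<forall>m\<ge>M. \<forall>n\<ge>M. (cmod ((F m - F n) k))\<^sup>2 * weight t k < ?c" for k
    proof -
      have w: "weight t k > 0" using weight_pos[OF t] .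
      have "Cauchy (\<lambda>n. F n k)" using conv convergent_Cauchy by blast
      moreover have "sqrt (?c / weight t k) > 0" using divide_pos_pos[OF c w] by (simp only: real_sqrt_gt_0_iff)
      ultimately obtain M where M: "\<And>m n. m \<ge> M \<Longrightarrow> n \<ge> M \<Longrightarrow> cmod (F m k - F n k) < sqrt (?c / weight t k)"
        unfolding Cauchy_iff by meson
      have "(cmod ((F m - F n) k))\<^sup>2 * weight t k < ?c" if "m \<ge> M" "n \<ge> M" for m n
      proof -
        have "(cmod (F m k - F n k))\<^sup>2 < (sqrt (?c / weight t k))\<^sup>2"
          using M[OF that] by (rule power_strict_mono) auto
        also have "\<dots> = ?c / weight t k" using c w by (intro real_sqrt_pow2) auto
        finally show ?thesis using w unfolding minus_apply by (simp only: pos_less_divide_eq)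
      qed
      then show ?thesis by blast
    qed
    then obtain M where "\<forall>k. \<forall>m\<ge>M k. \<forall>n\<ge>M k. (cmod ((F m - F n) k))\<^sup>2 * weight t k < ?c"
      using choice[of "\<lambda>k M. \<forall>m\<ge>M. \<forall>n\<ge>M. (cmod ((F m - F n) k))\<^sup>2 * weight t k < ?c"] by blast
    then have M: "\<And>k m n. m \<ge> M k \<Longrightarrow> n \<ge> M k \<Longrightarrow> (cmod ((F m - F n) k))\<^sup>2 * weight t k < ?c" by blast
    have "(\<Sum>k\<in>?low. (cmod ((F m - F n) k))\<^sup>2 * weight t k) < e\<^sup>2 / 2"
      if mn: "m \<ge> Max (M ` ?low)" "n \<ge> Max (M ` ?low)" for m n
    proof -
      have "(cmod ((F m - F n) k))\<^sup>2 * weight t k \<le> ?c" if "k \<in> ?low" for k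
      proof -
        have "M k \<le> Max (M ` ?low)" using that finite_low by (intro Max_ge) auto
        then show ?thesis using M[of k m n] mn by simp
      qed
      then have "(\<Sum>k\<in>?low. (cmod ((F m - F n) k))\<^sup>2 * weight t k) \<le> real (card ?low) * ?c"
        by (rule sum_bounded_above)
      also have "\<dots> < (real (card ?low) + 1) * ?c" using c by (intro mult_strict_right_mono) auto
      also have "\<dots> = e\<^sup>2 / 2"
        by (rule nonzero_mult_div_cancel_left[of "real (card ?low) + 1" "e\<^sup>2 / 2", unfolded times_divide_eq_right[symmetric]]) linarith
      finally show ?thesis .
    qed
    then show ?thesis by blast
  qed
  then obtain M where M: "\<And>m n. m \<ge> M \<Longrightarrow> n \<ge> M \<Longrightarrow> (\<Sum>k\<in>?low. (cmod ((F m - F n) k))\<^sup>2 * weight t k) < e\<^sup>2 / 2"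
    by blast
  have "hnorm (t + 1) (F m - F n) < e" if "m \<ge> M" "n \<ge> M" for m n
  proof -
    have d: "F m - F n \<in> hspace t" using F t hspace_diff by blast
    have "hnorm t (F m - F n) \<le> 2 * R"
      using hnorm_triangle_diff[OF t F(1)[of m] F(1)[of n]] F(2)[of m] F(2)[of n] by linarith
    then have "nsq t (F m - F n) \<le> (2 * R)\<^sup>2"
      unfolding hnorm_sq[OF t, symmetric] using t by (intro power_mono) auto
    then have "(3 + t) / (4 + t + real l) * nsq t (F m - F n) \<le> (3 + t) / (4 + t + real l) * (2 * R)\<^sup>2"
      using t by (intro mult_left_mono) auto
    then have "nsq (t + 1) (F m - F n) < e\<^sup>2"
      using nsq_tail_le[OF t d, of l] M[OF that] eps by linarith
    then show ?thesis unfolding hnorm_sqrt using e by (intro real_less_lsqrt) auto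
  qed
  then show ?thesis by blast
qed

lemma sum_coeffs_apply: "(\<Sum>x\<in>X. f x) k = (\<Sum>x\<in>X. f x k)" for f :: "'i \<Rightarrow> coeffs"
  by (induction X rule: infinite_finite_induct) auto

lemma support_in_span:
  assumes K: "finite K" and f: "\<And>k. k \<notin> K \<Longrightarrow> f k = 0"
  shows "f \<in> coeffs.span ((\<lambda>k j. if j = k then 1 else 0) ` K)"
proof -
  have "f = (\<Sum>k\<in>K. cscale (f k) (\<lambda>j. if j = k then 1 else 0))"
  proof
    fix j
    have "(\<Sum>k\<in>K. cscale (f k) (\<lambda>j. if j = k then 1 else 0)) j = (\<Sum>k\<in>K. if k = j then f j else 0)"
      unfolding sum_coeffs_apply by (intro sum.cong) (auto simp: cscale_def)
    then show "f j = (\<Sum>k\<in>K. cscale (f k) (\<lambda>j. if j = k then 1 else 0)) j" using K f by simp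
  qed
  also have "\<dots> \<in> coeffs.span ((\<lambda>k j. if j = k then 1 else 0) ` K)"
    by (intro coeffs.span_sum coeffs.span_scale coeffs.span_base) auto
  finally show ?thesis .
qed

text \<open>Stated for families because different indices may carry the same vector; two such
  indices already give a relation.\<close>

lemma nontrivial_relation:
  fixes v :: "'i \<Rightarrow> coeffs"
  assumes X: "finite X" and K: "finite K" "card K < card X"
    and supp: "\<And>x k. x \<in> X \<Longrightarrow> k \<notin> K \<Longrightarrow> v x k = 0"
  shows "\<exists>c. (\<exists>x\<in>X. c x \<noteq> 0) \<and> (\<Sum>x\<in>X. cscale (c x) (v x)) = 0"
proof (cases "inj_on v X")
  case True
  let ?U = "(\<lambda>k j. if j = k then 1 else 0 :: complex) ` K"
  have "coeffs.dependent (v ` X)"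
  proof (rule ccontr)
    assume "\<not> ?thesis"
    moreover have "v ` X \<subseteq> coeffs.span ?U" using support_in_span[OF K(1)] supp by blast
    ultimately have "card (v ` X) \<le> card ?U" using coeffs.independent_span_bound[of ?U "v ` X"] K(1) by blast
    also have "\<dots> \<le> card K" using K(1) by (rule card_image_le)
    finally show False using K(2) card_image[OF True] by simp
  qed
  then obtain u where u: "\<exists>y\<in>v ` X. u y \<noteq> 0" "(\<Sum>y\<in>v ` X. cscale (u y) y) = 0"
    using coeffs.dependent_finite[of "v ` X"] X by blast
  have "(\<Sum>x\<in>X. cscale (u (v x)) (v x)) = 0" using u(2) unfolding sum.reindex[OF True] o_def .
  moreover have "\<exists>x\<in>X. u (v x) \<noteq> 0" using u(1) by blast
  ultimately show ?thesis by (intro exI[of _ "u \<circ> v"]) simp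
next
  case False
  then obtain x y where xy: "x \<in> X" "y \<in> X" "x \<noteq> y" "v x = v y" by (auto simp: inj_on_def)
  let ?c = "\<lambda>z. if z = x then 1 else if z = y then - 1 else 0 :: complex"
  have "(\<Sum>z\<in>X. cscale (?c z) (v z)) = (\<Sum>z\<in>{x, y}. cscale (?c z) (v z))"
    using X xy by (intro sum.mono_neutral_right) auto
  also have "\<dots> = 0" using xy by (simp add: cscale_def fun_eq_iff)
  finally show ?thesis using xy(1) by (intro exI[of _ ?c]) auto
qed

lemma nsq_orthogonal_sum:
  assumes t: "t \<ge> - 2" and "finite S" and F: "\<And>s. s \<in> S \<Longrightarrow> F s \<in> hspace t"
    and orth: "\<And>s s'. s \<in> S \<Longrightarrow> s' \<in> S \<Longrightarrow> s \<noteq> s' \<Longrightarrow> hinner t (F s) (F s') = 0"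
  shows "nsq t (\<Sum>s\<in>S. F s) = (\<Sum>s\<in>S. nsq t (F s))"
  using assms(2-)
proof (induction S rule: finite_induct)
  case empty
  then show ?case by (simp add: nsq_def)
next
  case (insert s S)
  have "hinner t (F s) (\<Sum>s\<in>S'. F s) = 0 \<and> (\<Sum>s\<in>S'. F s) \<in> hspace t" if "finite S'" "S' \<subseteq> S" for S'
    using that
  proof (induction S' rule: finite_induct)
    case (insert x S')
    have x: "F x \<in> hspace t" "hinner t (F s) (F x) = 0" using insert.prems insert.hyps \<open>s \<notin> S\<close> \<open>\<And>r. r \<in> insert s S \<Longrightarrow> F r \<in> hspace t\<close>
      \<open>\<And>r r'. r \<in> insert s S \<Longrightarrow> r' \<in> insert s S \<Longrightarrow> r \<noteq> r' \<Longrightarrow> hinner t (F r) (F r') = 0\<close> by auto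
    moreover have "F s \<in> hspace t" using \<open>\<And>r. r \<in> insert s S \<Longrightarrow> F r \<in> hspace t\<close> by blast
    moreover have S': "hinner t (F s) (sum F S') = 0" "sum F S' \<in> hspace t" using insert.IH insert.prems by auto
    moreover have "hinner t (F s) (F x + sum F S') = hinner t (F s) (F x) + hinner t (F s) (sum F S')"
      by (rule hinner_add_right[OF t]) fact+
    moreover have "F x + sum F S' \<in> hspace t" by (rule hspace_add[OF t]) fact+
    ultimately have "hinner t (F s) (F x + sum F S') = 0" "F x + sum F S' \<in> hspace t" by simp_all
    then show ?case unfolding sum.insert[OF insert.hyps] by (rule conjI)
  qed simp
  from this[of S] have S: "hinner t (F s) (sum F S) = 0" "sum F S \<in> hspace t" using insert.hyps by auto
  have "nsq t (sum F S) = (\<Sum>s\<in>S. nsq t (F s))" by (rule insert.IH) (use insert.prems in auto)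
  moreover have "F s \<in> hspace t" using insert.prems(1) by blast
  moreover from this have "nsq t (F s + sum F S) = nsq t (F s) + nsq t (sum F S) + 2 * Re (hinner t (F s) (sum F S))"
    by (intro nsq_add[OF t] S(2))
  ultimately have "nsq t (F s + sum F S) = nsq t (F s) + (\<Sum>s\<in>S. nsq t (F s))" unfolding S(1) by simp
  then show ?case unfolding sum.insert[OF insert.hyps] .
qed

lemma operator_on_sum:
  assumes A: "operator_on N A" and N: "coeffs.subspace N" and "finite X" "\<And>x. x \<in> X \<Longrightarrow> v x \<in> N"
  shows "A (\<Sum>x\<in>X. cscale (c x) (v x)) = (\<Sum>x\<in>X. cscale (c x) (A (v x)))"
  using assms(3,4)
proof (induction X rule: finite_induct)
  case empty
  have "A (cscale 0 0) = cscale 0 (A 0)" using A coeffs.subspace_0[OF N] unfolding operator_on_def by blast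
  then show ?case by (simp add: cscale_def fun_eq_iff zero_fun_def)
next
  case (insert x X)
  have 1: "cscale (c x) (v x) \<in> N" using insert.prems N by (intro coeffs.subspace_scale) auto
  have 2: "(\<Sum>x\<in>X. cscale (c x) (v x)) \<in> N"
    using insert.prems N by (intro coeffs.subspace_sum coeffs.subspace_scale) auto
  have "A (cscale (c x) (v x) + (\<Sum>x\<in>X. cscale (c x) (v x))) = A (cscale (c x) (v x)) + A (\<Sum>x\<in>X. cscale (c x) (v x))"
    using A 1 2 unfolding operator_on_def by blast
  moreover have "A (cscale (c x) (v x)) = cscale (c x) (A (v x))"
    using A insert.prems unfolding operator_on_def by blast
  moreover have "A (\<Sum>x\<in>X. cscale (c x) (v x)) = (\<Sum>x\<in>X. cscale (c x) (A (v x)))"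
    by (rule insert.IH) (use insert.prems in blast)
  ultimately show ?case unfolding sum.insert[OF insert.hyps] by (simp only:)
qed

lemma hnorm_add_1_le: "hnorm (t + 1) f \<le> hnorm t f" if "t \<ge> - 2" "f \<in> hspace t"
  using nsq_add_1_le[OF that] by (simp add: hnorm_sqrt)

lemma hnorm_next_of_vanishing:
  assumes t: "t \<ge> - 2" and f: "f \<in> hspace t" and z: "\<And>k. tdeg k \<le> l \<Longrightarrow> f k = 0"
  shows "nsq (t + 1) f \<le> (3 + t) / (4 + t + real l) * nsq t f"
  using nsq_tail_le[OF t f, of l] z by simp

text \<open>The form of \<open>bound\<close> comes from pairing A f with itself, which is why A f
  occurs on both sides. Each summand has gained two steps of the scale, shared between f and A f in
  one and spent on f alone in the other. B is the adjoint of A within N, so that the eigenspaces of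
  B A describe the singular values.\<close>

locale small_operator =
  fixes t :: real and N :: "coeffs set" and A B :: "coeffs \<Rightarrow> coeffs" and C :: real
  assumes t: "t \<ge> - 2" and N: "closed_subspace t N" and A: "operator_on N A"
    and B: "\<And>g. g \<in> N \<Longrightarrow> B g \<in> N"
    and adj: "\<And>f g. f \<in> N \<Longrightarrow> g \<in> N \<Longrightarrow> hinner t (A f) g = hinner t f (B g)"
    and C: "C > 0"
    and bound: "\<And>f. f \<in> N \<Longrightarrow> nsq t (A f) \<le>
      C * (hnorm (t + 1) f * hnorm (t + 1) (A f) + hnorm (t + 2) f * hnorm t (A f))"
begin

lemma sub: "coeffs.subspace N" and NH: "f \<in> N \<Longrightarrow> f \<in> hspace t"
  using N by (auto simp: closed_subspace_def)

lemma A_in: "f \<in> N \<Longrightarrow> A f \<in> N"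
  using A by (simp add: operator_on_def)

lemma A_sum: "finite X \<Longrightarrow> (\<And>x. x \<in> X \<Longrightarrow> v x \<in> N) \<Longrightarrow>
    A (\<Sum>x\<in>X. cscale (c x) (v x)) = (\<Sum>x\<in>X. cscale (c x) (A (v x)))"
  by (rule operator_on_sum[OF A sub])

lemma A_diff:
  assumes "f \<in> N" "g \<in> N"
  shows "A (f - g) = A f - A g"
proof -
  have "A (f + cscale (- 1) g) = A f + A (cscale (- 1) g)"
    using A assms coeffs.subspace_scale[OF sub] unfolding operator_on_def by blast
  also have "A (cscale (- 1) g) = cscale (- 1) (A g)" using A assms unfolding operator_on_def by blast
  finally show ?thesis unfolding diff_eq_add_cscale .
qed

text \<open>Giving up all gains except one step on f and cancelling the norm of A f. This weaker
  bound is enough for compactness and for the size of the largest singular value.\<close>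

lemma A_bound:
  assumes f: "f \<in> N"
  shows "hnorm t (A f) \<le> 2 * C * hnorm (t + 1) f"
proof (cases "hnorm t (A f) = 0")
  case True
  then show ?thesis using C t by simp
next
  case False
  then have pos: "hnorm t (A f) > 0" using hnorm_nonneg[OF t, of "A f"] by linarith
  have t1: "t + 1 \<ge> - 2" using t by simp
  have f1: "f \<in> hspace (t + 1)" using nsq_add_1_le[OF t NH[OF f]] by blast
  have "hnorm (t + 1) f * hnorm (t + 1) (A f) \<le> hnorm (t + 1) f * hnorm t (A f)"
    using hnorm_add_1_le[OF t NH[OF A_in[OF f]]] t1 by (intro mult_left_mono) auto
  moreover have "hnorm (t + 2) f * hnorm t (A f) \<le> hnorm (t + 1) f * hnorm t (A f)"
    using hnorm_add_1_le[OF t1 f1] t by (intro mult_right_mono) (auto simp: add.assoc)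
  ultimately have "hnorm (t + 1) f * hnorm (t + 1) (A f) + hnorm (t + 2) f * hnorm t (A f) \<le> 2 * (hnorm (t + 1) f * hnorm t (A f))"
    by linarith
  then have "nsq t (A f) \<le> C * (2 * (hnorm (t + 1) f * hnorm t (A f)))"
    using order_trans[OF bound[OF f] mult_left_mono] C by simp
  then have "hnorm t (A f) * hnorm t (A f) \<le> (2 * C * hnorm (t + 1) f) * hnorm t (A f)"
    unfolding hnorm_sq[OF t, symmetric] power2_eq_square by (simp add: mult_ac)
  then show ?thesis using pos by simp
qed

lemma compact: "compact_on t N A"
  unfolding compact_on_def
proof (intro conjI A allI impI)
  fix f :: "nat \<Rightarrow> coeffs" assume f: "\<forall>n. f n \<in> N \<and> hnorm t (f n) \<le> 1"
  then have fH: "\<And>n. f n \<in> hspace t" and f1: "\<And>n. hnorm t (f n) \<le> 1" using NH by blast+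
  obtain r where r: "strict_mono r" "\<forall>k. convergent (\<lambda>n. f (r n) k)"
    using coordinatewise_convergent_subsequence[of t f 1, OF t fH f1] by blast
  have "\<exists>M. \<forall>m\<ge>M. \<forall>n\<ge>M. hnorm t (A (f (r m)) - A (f (r n))) < e" if e: "e > 0" for e
  proof -
    have "e / (2 * C) > 0" using e C by simp
    from cauchy_next_space[of t "\<lambda>n. f (r n)" 1, OF t fH f1 _ this] r(2) obtain M where
      M: "\<And>m n. m \<ge> M \<Longrightarrow> n \<ge> M \<Longrightarrow> hnorm (t + 1) (f (r m) - f (r n)) < e / (2 * C)" by blast
    have "hnorm t (A (f (r m)) - A (f (r n))) < e" if "m \<ge> M" "n \<ge> M" for m n
    proof -
      have "f (r m) - f (r n) \<in> N" using f sub coeffs.subspace_diff by blast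
      from A_bound[OF this] have "hnorm t (A (f (r m)) - A (f (r n))) \<le> 2 * C * hnorm (t + 1) (f (r m) - f (r n))"
        using A_diff f by simp
      also have "\<dots> < e" using M[OF that] C by (simp add: field_simps)
      finally show ?thesis .
    qed
    then show ?thesis by blast
  qed
  from hspace_complete[OF t _ this] obtain g where
    g: "g \<in> hspace t" "(\<lambda>n. hnorm t (A (f (r n)) - g)) \<longlonglongrightarrow> 0" using NH A_in f by blast
  have "g \<in> N" by (rule closed_subspace_limit[OF t N _ g]) (use A_in f in blast)
  then show "\<exists>r g. strict_mono r \<and> g \<in> N \<and> (\<lambda>n. hnorm t (A (f (r n)) - g)) \<longlonglongrightarrow> 0"
    using r g by blast
qed

section \<open>Counting singular values\<close>

definition eig :: "real \<Rightarrow> coeffs set" where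
  "eig s = {f \<in> N. B (A f) = cscale (complex_of_real (s\<^sup>2)) f}"

lemma singular_mult_eq: "singular_mult t N A s = coeffs.dim (eig s)"
proof -
  have "adjoint_on t N A (A f) = B (A f)" if "f \<in> N" for f
    using adjoint_on_eq[OF t N B[OF A_in[OF that]]] adj A_in[OF that] by blast
  then show ?thesis unfolding singular_mult_def eig_def by (metis (no_types, lifting))
qed

lemma hinner_A_A:
  assumes "f \<in> N" "g \<in> eig s"
  shows "hinner t (A f) (A g) = of_real (s\<^sup>2) * hinner t f g"
proof -
  have g: "g \<in> N" "B (A g) = cscale (complex_of_real (s\<^sup>2)) g" using assms(2) by (auto simp: eig_def)
  have "hinner t (A f) (A g) = hinner t f (B (A g))" using adj[OF assms(1) A_in[OF g(1)]] .
  then show ?thesis unfolding g(2) hinner_scale_right by simp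
qed

lemma eig_orthogonal:
  assumes f: "f \<in> eig s" and g: "g \<in> eig s'" and s: "s > 0" "s' > 0" "s \<noteq> s'"
  shows "hinner t f g = 0" "hinner t (A f) (A g) = 0"
proof -
  have N': "f \<in> N" "g \<in> N" using f g by (auto simp: eig_def)
  have 1: "hinner t (A f) (A g) = of_real (s'\<^sup>2) * hinner t f g" by (rule hinner_A_A[OF N'(1) g])
  have "hinner t (A g) (A f) = of_real (s\<^sup>2) * hinner t g f" by (rule hinner_A_A[OF N'(2) f])
  then have "cnj (hinner t (A g) (A f)) = of_real (s\<^sup>2) * cnj (hinner t g f)" by simp
  then have 2: "hinner t (A f) (A g) = of_real (s\<^sup>2) * hinner t f g"
    by (simp only: hinner_commute[symmetric])
  have "s\<^sup>2 \<noteq> s'\<^sup>2" using s by (simp add: power2_eq_iff)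
  then have "complex_of_real (s\<^sup>2) \<noteq> of_real (s'\<^sup>2)" using of_real_eq_iff by blast
  then show "hinner t f g = 0" using 1 2 by (simp del: of_real_power)
  then show "hinner t (A f) (A g) = 0" using 1 by simp
qed

lemma nsq_A_eig: "nsq t (A f) = s\<^sup>2 * nsq t f" if "f \<in> eig s"
proof -
  have "f \<in> N" using that by (simp add: eig_def)
  from hinner_A_A[OF this that] have "complex_of_real (nsq t (A f)) = complex_of_real (s\<^sup>2 * nsq t f)"
    by (simp add: hinner_self)
  then show ?thesis using of_real_eq_iff by blast
qed

lemma subspace_eig: "coeffs.subspace (eig s)"
  unfolding coeffs.subspace_def
proof (intro conjI ballI allI)
  \<comment> \<open>Linearity of B is obtained from that of A: the eigenvalue equation is tested
    weakly against N, where the adjoint relation moves everything to A.\<close>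
  have ext: "B (A f) = cscale (complex_of_real (s\<^sup>2)) f"
    if "f \<in> N" "\<And>g. g \<in> N \<Longrightarrow> hinner t (A g) (A f) = of_real (s\<^sup>2) * hinner t g f" for f
  proof (rule proj_unique[OF t N, of _ "\<lambda>g. hinner t (A g) (A f)"])
    show "B (A f) \<in> N" "cscale (complex_of_real (s\<^sup>2)) f \<in> N"
      using that B A_in coeffs.subspace_scale[OF sub] by auto
  qed (use that adj A_in hinner_scale_right in auto)
  have zero: "A 0 = 0" using A_diff[of 0 0] coeffs.subspace_0[OF sub] by simp
  have "B (A 0) = cscale (complex_of_real (s\<^sup>2)) 0"
    by (rule ext) (simp_all add: zero coeffs.subspace_0[OF sub])
  then show "0 \<in> eig s" unfolding eig_def using coeffs.subspace_0[OF sub] by blast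
  fix f assume f: "f \<in> eig s"
  then have fN: "f \<in> N" by (simp add: eig_def)
  show "cscale c f \<in> eig s" for c
  proof -
    have 1: "A (cscale c f) = cscale c (A f)" using A fN unfolding operator_on_def by blast
    have 2: "cscale c f \<in> N" using fN coeffs.subspace_scale[OF sub] by blast
    have "B (A (cscale c f)) = cscale (complex_of_real (s\<^sup>2)) (cscale c f)"
      by (rule ext[OF 2]) (simp only: 1 hinner_scale_right hinner_A_A[OF _ f] mult.left_commute)
    then show ?thesis using 2 by (simp add: eig_def)
  qed
  fix g assume g: "g \<in> eig s"
  then have gN: "g \<in> N" by (simp add: eig_def)
  have 1: "A (f + g) = A f + A g" using A fN gN unfolding operator_on_def by blast
  have 2: "f + g \<in> N" using fN gN coeffs.subspace_add[OF sub] by blast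
  have "B (A (f + g)) = cscale (complex_of_real (s\<^sup>2)) (f + g)"
  proof (rule ext[OF 2])
    fix h assume h: "h \<in> N"
    have "hinner t (A h) (A f + A g) = hinner t (A h) (A f) + hinner t (A h) (A g)"
      by (rule hinner_add_right[OF t]) (use NH A_in fN gN h in blast)+
    also have "\<dots> = of_real (s\<^sup>2) * (hinner t h f + hinner t h g)"
      unfolding hinner_A_A[OF h f] hinner_A_A[OF h g] by (simp only: distrib_left)
    also have "hinner t h f + hinner t h g = hinner t h (f + g)"
      by (rule hinner_add_right[OF t, symmetric]) (use NH fN gN h in blast)+
    finally show "hinner t (A h) (A (f + g)) = of_real (s\<^sup>2) * hinner t h (f + g)" unfolding 1 .
  qed
  then show "f + g \<in> eig s" using 2 by (simp add: eig_def)
qed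

text \<open>With e the gain of one step in squared norm, f and A f contribute sqrt e each to the
  first product. Two steps on f contribute at most 2 e to the second, because the gain of the second
  step is at most 2 e when t \<ge> -2. Together this is 3 e.\<close>

lemma A_bound_of_vanishing:
  assumes f: "f \<in> N" and z: "\<And>k. tdeg k \<le> l \<Longrightarrow> f k = 0" "\<And>k. tdeg k \<le> l \<Longrightarrow> A f k = 0"
  shows "hnorm t (A f) \<le> 3 * C * ((3 + t) / (4 + t + real l)) * hnorm t f"
proof (cases "hnorm t (A f) = 0")
  case True
  then show ?thesis using C t by simp
next
  case False
  then have pos: "hnorm t (A f) > 0" using hnorm_nonneg[OF t, of "A f"] by linarith
  define e where "e = (3 + t) / (4 + t + real l)"
  have e: "e \<ge> 0" using t by (simp add: e_def)
  have t1: "t + 1 \<ge> - 2" using t by simp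
  have fH: "f \<in> hspace t" "f \<in> hspace (t + 1)" using nsq_add_1_le[OF t NH[OF f]] NH[OF f] by blast+
  have n1: "nsq (t + 1) f \<le> e * nsq t f" "nsq (t + 1) (A f) \<le> e * nsq t (A f)"
    using hnorm_next_of_vanishing[OF t] NH A_in f z unfolding e_def by blast+
  have "nsq (t + 1 + 1) f \<le> (3 + (t + 1)) / (4 + (t + 1) + real l) * nsq (t + 1) f"
    by (rule hnorm_next_of_vanishing[OF t1 fH(2) z(1)])
  also have "\<dots> \<le> (2 * e) * nsq (t + 1) f"
  proof (rule mult_right_mono)
    have "(4 + t) * (4 + t + real l) \<le> 2 * (3 + t) * (5 + t + real l)"
    proof -
      have "(4 + t) * (4 + t + real l) \<le> (2 * (3 + t)) * (5 + t + real l)" using t by (intro mult_mono) auto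
      then show ?thesis by simp
    qed
    then show "(3 + (t + 1)) / (4 + (t + 1) + real l) \<le> 2 * e" using t by (simp add: e_def divide_simps mult_ac)
  qed (use t1 in simp)
  also have "\<dots> \<le> (2 * e) * (e * nsq t f)" using n1(1) e by (intro mult_left_mono) auto
  also have "\<dots> \<le> (2 * e)\<^sup>2 * nsq t f"
    using e t by (simp add: power2_eq_square mult.assoc[symmetric] mult_right_mono)
  finally have "hnorm (t + 1 + 1) f \<le> sqrt ((2 * e)\<^sup>2 * nsq t f)" unfolding hnorm_sqrt by (rule real_sqrt_le_mono)
  then have h2: "hnorm (t + 2) f \<le> 2 * e * hnorm t f"
    using e by (simp add: real_sqrt_mult hnorm_sqrt add.assoc)
  have "hnorm (t + 1) f * hnorm (t + 1) (A f) \<le> (sqrt e * hnorm t f) * (sqrt e * hnorm t (A f))"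
  proof (rule mult_mono)
    show "hnorm (t + 1) f \<le> sqrt e * hnorm t f" "hnorm (t + 1) (A f) \<le> sqrt e * hnorm t (A f)"
      unfolding hnorm_sqrt real_sqrt_mult[symmetric] using n1 by (auto intro: real_sqrt_le_mono)
  qed (use t t1 e in auto)
  also have "\<dots> = e * (hnorm t f * hnorm t (A f))" using e by (simp add: mult_ac flip: real_sqrt_mult)
  finally have h1: "hnorm (t + 1) f * hnorm (t + 1) (A f) \<le> e * (hnorm t f * hnorm t (A f))" .
  have "hnorm (t + 2) f * hnorm t (A f) \<le> (2 * e * hnorm t f) * hnorm t (A f)"
    using h2 t by (intro mult_right_mono) auto
  then have "hnorm (t + 1) f * hnorm (t + 1) (A f) + hnorm (t + 2) f * hnorm t (A f) \<le> 3 * e * (hnorm t f * hnorm t (A f))"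
    using h1 by (simp add: mult.assoc)
  then have "nsq t (A f) \<le> C * (3 * e * (hnorm t f * hnorm t (A f)))"
    using order_trans[OF bound[OF f] mult_left_mono] C by simp
  then have "hnorm t (A f) * hnorm t (A f) \<le> (3 * C * e * hnorm t f) * hnorm t (A f)"
    unfolding hnorm_sq[OF t, symmetric] power2_eq_square by (simp add: mult_ac)
  from mult_right_le_imp_le[OF this pos] show ?thesis unfolding e_def .
qed

text \<open>
  If the eigenspaces to eigenvalues at least \<open>\<sigma>\<^sup>2\<close> had too large a total dimension, some nonzero
  f in their sum would satisfy that f and A f vanish in low degrees.
\<close>

lemma sum_dim_eig_le:
  assumes S: "finite S" "\<And>s. s \<in> S \<Longrightarrow> \<sigma> \<le> s" and \<sigma>: "\<sigma> > 0"
    and l: "3 * C * ((3 + t) / (4 + t + real l)) < \<sigma>"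
  shows "(\<Sum>s\<in>S. coeffs.dim (eig s)) \<le> 2 * (l + 1)\<^sup>2"
proof (rule ccontr)
  assume large: "\<not> ?thesis"
  have pos: "s > 0" if "s \<in> S" for s using S(2)[OF that] \<sigma> by simp
  \<comment> \<open>An infinite basis would make \<open>dim\<close> 0 by convention; the empty
    family then replaces it.\<close>
  have "\<exists>E. finite E \<and> E \<subseteq> eig s \<and> coeffs.independent E \<and> card E = coeffs.dim (eig s)" for s
  proof -
    obtain E where E: "E \<subseteq> eig s" "coeffs.independent E" "card E = coeffs.dim (eig s)"
      by (rule coeffs.basis_exists)
    show ?thesis
    proof (cases "finite E")
      case False
      then have "coeffs.dim (eig s) = 0" using E(3) by simp
      then have "finite {} \<and> {} \<subseteq> eig s \<and> coeffs.independent {} \<and> card ({} :: coeffs set) = coeffs.dim (eig s)"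
        using coeffs.independent_empty by simp
      then show ?thesis by (rule exI)
    next
      case True
      with E show ?thesis by (intro exI[of _ E] conjI)
    qed
  qed
  then obtain E where E: "\<And>s. finite (E s)" "\<And>s. E s \<subseteq> eig s" "\<And>s. coeffs.independent (E s)"
    "\<And>s. card (E s) = coeffs.dim (eig s)"
    using choice[of "\<lambda>s E. finite E \<and> E \<subseteq> eig s \<and> coeffs.independent E \<and> card E = coeffs.dim (eig s)"] by blast
  have EN: "b \<in> N" if "b \<in> E s" for b s using that E(2) by (auto simp: eig_def)
  define X where "X = Sigma S E"
  have X: "finite X" using S E by (auto simp: X_def)
  have cardX: "card X = (\<Sum>s\<in>S. coeffs.dim (eig s))" using S E by (simp add: X_def)
  have XN: "snd x \<in> N" if "x \<in> X" for x using that EN by (auto simp: X_def)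
  let ?low = "{k :: nat \<times> nat. tdeg k \<le> l}"
  (* The values of f and of A f in low degrees are stored at even and odd first exponents. *)
  define K where "K = (\<lambda>((a, b), i). (2 * a + i, b)) ` (?low \<times> {0, 1 :: nat})"
  have K: "finite K" unfolding K_def using finite_low by blast
  have "card K \<le> card (?low \<times> {0, 1 :: nat})" unfolding K_def using finite_low by (intro card_image_le) blast
  also have "\<dots> \<le> 2 * (l + 1)\<^sup>2" using card_low[of l] by (simp add: card_cartesian_product)
  also have "\<dots> < card X" using large cardX by simp
  finally have KX: "card K < card X" .
  define v where "v = (\<lambda>x :: real \<times> coeffs. \<lambda>(a, b). if (a div 2, b) \<in> ?low
      then if even a then snd x (a div 2, b) else A (snd x) (a div 2, b) else 0)"
  have vK: "v x k = 0" if "k \<notin> K" for x k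
  proof -
    obtain a b where k: "k = (a, b)" by (cases k)
    have "(a div 2, b) \<notin> ?low"
    proof
      assume "(a div 2, b) \<in> ?low"
      then have "((a div 2, b), a mod 2) \<in> ?low \<times> {0, 1}" by auto
      then have "(\<lambda>((a, b), i). (2 * a + i, b)) ((a div 2, b), a mod 2) \<in> K" unfolding K_def by (rule imageI)
      then show False using that k by simp
    qed
    then show ?thesis by (simp add: v_def k)
  qed
  have "\<exists>c. (\<exists>x\<in>X. c x \<noteq> 0) \<and> (\<Sum>x\<in>X. cscale (c x) (v x)) = 0"
    by (rule nontrivial_relation[OF X K KX]) (rule vK)
  then obtain c where
    c: "\<exists>x\<in>X. c x \<noteq> 0" "(\<Sum>x\<in>X. cscale (c x) (v x)) = 0" by (elim exE conjE)
  define f where "f = (\<Sum>x\<in>X. cscale (c x) (snd x))"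
  define F where "F = (\<lambda>s. \<Sum>b\<in>E s. cscale (c (s, b)) b)"
  have Af: "A f = (\<Sum>x\<in>X. cscale (c x) (A (snd x)))" unfolding f_def by (rule A_sum[OF X XN])
  have fN: "f \<in> N" unfolding f_def by (intro coeffs.subspace_sum[OF sub] coeffs.subspace_scale[OF sub] XN)
  have low: "f k = 0 \<and> A f k = 0" if k: "tdeg k \<le> l" for k
  proof -
    obtain a b where kk: "k = (a, b)" by (cases k)
    have "f k = (\<Sum>x\<in>X. c x * snd x k)" by (simp add: f_def sum_coeffs_apply cscale_def)
    moreover have "A f k = (\<Sum>x\<in>X. c x * A (snd x) k)" unfolding Af by (simp add: sum_coeffs_apply cscale_def)
    moreover have "(\<Sum>x\<in>X. cscale (c x) (v x)) (2 * a + i, b) = 0" for i unfolding c(2) by simp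
    from this[of 0] this[of 1] have "(\<Sum>x\<in>X. c x * snd x k) = 0 \<and> (\<Sum>x\<in>X. c x * A (snd x) k) = 0"
      using k by (simp add: kk sum_coeffs_apply v_def cscale_def)
    ultimately show ?thesis by simp
  qed
  have Feig: "F s \<in> eig s" for s
    unfolding F_def using E(2) by (intro coeffs.subspace_sum[OF subspace_eig] coeffs.subspace_scale[OF subspace_eig]) blast
  have FN: "F s \<in> N" for s using Feig by (auto simp: eig_def)
  have fF: "f = (\<Sum>s\<in>S. F s)"
    unfolding f_def F_def X_def using S E by (simp add: sum.Sigma case_prod_unfold)
  have "A (\<Sum>s\<in>S. cscale 1 (F s)) = (\<Sum>s\<in>S. cscale 1 (A (F s)))" by (rule A_sum[OF S(1) FN])
  then have AfF: "A f = (\<Sum>s\<in>S. A (F s))" by (simp add: fF)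
  have n1: "nsq t f = (\<Sum>s\<in>S. nsq t (F s))"
    unfolding fF by (rule nsq_orthogonal_sum[OF t S(1)]) (use NH FN eig_orthogonal(1)[OF Feig Feig] pos in blast)+
  have "nsq t (A f) = (\<Sum>s\<in>S. nsq t (A (F s)))"
    unfolding AfF by (rule nsq_orthogonal_sum[OF t S(1)]) (use NH FN A_in eig_orthogonal(2)[OF Feig Feig] pos in blast)+
  also have "\<dots> \<ge> (\<Sum>s\<in>S. \<sigma>\<^sup>2 * nsq t (F s))"
  proof (rule sum_mono)
    fix s assume "s \<in> S"
    then have "\<sigma>\<^sup>2 \<le> s\<^sup>2" using S(2) \<sigma> by (intro power_mono) auto
    then show "\<sigma>\<^sup>2 * nsq t (F s) \<le> nsq t (A (F s))" unfolding nsq_A_eig[OF Feig] using t by (intro mult_right_mono) auto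
  qed
  finally have lower: "\<sigma>\<^sup>2 * nsq t f \<le> nsq t (A f)" unfolding n1 sum_distrib_left .
  \<comment> \<open>Independence of the chosen basis makes one component F s nonzero, and
    orthogonality of the components prevents cancellation in f.\<close>
  have fpos: "nsq t f > 0"
  proof -
    obtain s b where sb: "s \<in> S" "b \<in> E s" "c (s, b) \<noteq> 0" using c(1) by (auto simp: X_def)
    have "F s \<noteq> 0"
    proof
      assume "F s = 0"
      then have "coeffs.dependent (E s)"
        unfolding F_def coeffs.dependent_finite[OF E(1)] using sb by (intro exI[of _ "\<lambda>b. c (s, b)"]) blast
      then show False using E(3) by blast
    qed
    then have "nsq t (F s) > 0" using nsq_eq_0[OF t NH[OF FN]] nsq_nonneg[OF t, of "F s"] by (metis less_eq_real_def)
    also have "nsq t (F s) \<le> nsq t f" unfolding n1 using S(1) sb(1) t by (intro member_le_sum) auto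
    finally show ?thesis .
  qed
  have hpos: "hnorm t f > 0" unfolding hnorm_sqrt using fpos by simp
  have "\<sigma> * hnorm t f = sqrt (\<sigma>\<^sup>2 * nsq t f)" using \<sigma> by (simp add: hnorm_sqrt real_sqrt_mult)
  also have "\<dots> \<le> hnorm t (A f)" unfolding hnorm_sqrt using lower by (rule real_sqrt_le_mono)
  also have "\<dots> \<le> 3 * C * ((3 + t) / (4 + t + real l)) * hnorm t f"
    by (rule A_bound_of_vanishing[OF fN]) (use low in blast)+
  also have "\<dots> < \<sigma> * hnorm t f" using l hpos by (rule mult_strict_right_mono)
  finally show False by simp
qed

text \<open>A has norm at most 2 C, because \<open>A_bound\<close> holds with the larger norm for t
  in place of the one for t + 1.\<close>

lemma dim_eig_large:
  assumes "s > 2 * C"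
  shows "coeffs.dim (eig s) = 0"
proof -
  have "f = 0" if f: "f \<in> eig s" for f
  proof (rule ccontr)
    have fN: "f \<in> N" using f by (simp add: eig_def)
    assume "f \<noteq> 0"
    then have "hnorm t f \<noteq> 0" using nsq_eq_0[OF t NH[OF fN]] by (auto simp: hnorm_sqrt)
    then have pos: "hnorm t f > 0" using hnorm_nonneg[OF t, of f] by linarith
    have "s * hnorm t f = hnorm t (A f)" unfolding hnorm_sqrt nsq_A_eig[OF f] using assms C by (simp add: real_sqrt_mult)
    also have "\<dots> \<le> 2 * C * hnorm (t + 1) f" by (rule A_bound[OF fN])
    also have "\<dots> \<le> 2 * C * hnorm t f" using hnorm_add_1_le[OF t NH[OF fN]] C by (intro mult_left_mono) auto
    also have "\<dots> < s * hnorm t f" using assms pos by (rule mult_strict_right_mono)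
    finally show False by simp
  qed
  then have "eig s \<subseteq> {0}" by blast
  then have "eig s \<subseteq> coeffs.span {}" by simp
  from coeffs.dim_le_card[OF this] show ?thesis by simp
qed

end

context small_operator
begin

text \<open>The degree l is taken to be the integer part of 3 C (3 + t) / \<sigma>, enough for the
  hypothesis of \<open>sum_dim_eig_le\<close>. As \<sigma> tends to 0 the count is O(1 /
  \<sigma>^2).\<close>

lemma sum_dim_eig_le':
  assumes S: "finite S" "\<And>s. s \<in> S \<Longrightarrow> \<sigma> \<le> s" and \<sigma>: "\<sigma> > 0"
  shows "real (\<Sum>s\<in>S. coeffs.dim (eig s)) \<le> 2 * (3 * C * (3 + t) / \<sigma> + 1)\<^sup>2"
proof -
  define D where "D = 3 * C * (3 + t)"
  have D: "D \<ge> 0" using C t by (simp add: D_def)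
  define l where "l = nat \<lfloor>D / \<sigma>\<rfloor>"
  have "D / \<sigma> \<ge> 0" using D \<sigma> by simp
  then have l: "real l \<le> D / \<sigma>" "D / \<sigma> < real l + 1" by (simp_all add: l_def)
  have "D < \<sigma> * (real l + 1)" using l(2) \<sigma> by (simp add: field_simps)
  also have "\<dots> \<le> \<sigma> * (4 + t + real l)" using t \<sigma> by (intro mult_left_mono) auto
  finally have "D / (4 + t + real l) < \<sigma>" using t by (simp add: field_simps)
  then have "3 * C * ((3 + t) / (4 + t + real l)) < \<sigma>" by (simp add: D_def)
  from sum_dim_eig_le[OF S \<sigma> this] have "(\<Sum>s\<in>S. coeffs.dim (eig s)) \<le> 2 * (l + 1)\<^sup>2" .
  then have "real (\<Sum>s\<in>S. coeffs.dim (eig s)) \<le> real (2 * (l + 1)\<^sup>2)" by (rule of_nat_mono)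
  also have "\<dots> = 2 * (real l + 1)\<^sup>2" by simp
  also have "\<dots> \<le> 2 * (D / \<sigma> + 1)\<^sup>2" using l(1) by (intro mult_left_mono power_mono) auto
  finally show ?thesis by (simp add: D_def)
qed

text \<open>Dyadic shells R / 2^(j+1) < s \<le> R / 2^j below the norm bound R = 2 C. Shell j holds
  O(4^j) singular values, each contributing at most (R / 2^j)^p, so the sum is dominated by a
  geometric series of ratio r = 4 * 2^(-p), which is below 1 exactly for p > 2.\<close>

lemma singular_values_summable:
  assumes p: "p > 2"
  shows "(\<lambda>s. real (singular_mult t N A s) * s powr p) summable_on {s. s > 0}"
proof -
  define g where "g = (\<lambda>s. real (coeffs.dim (eig s)) * s powr p)"
  define R where "R = 2 * C"
  have R: "R > 0" using C by (simp add: R_def)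
  define D where "D = 3 * C * (3 + t)"
  have D: "D \<ge> 0" using C t by (simp add: D_def)
  define r where "r = 4 * 2 powr (- p)"
  have r: "0 \<le> r" "r < 1"
  proof -
    have "(2::real) powr (- p) < 2 powr (- 2)" using p by (intro powr_less_mono) auto
    also have "(2::real) powr (- 2) = 1 / 4" by (simp add: powr_minus powr_numeral)
    finally show "r < 1" by (simp add: r_def)
  qed (simp add: r_def)
  define K where "K = R powr p * (2 * (2 * D / R + 1)\<^sup>2)"
  have K: "K \<ge> 0" by (simp add: K_def)
  \<comment> \<open>The index of the shell of s. Minimality gives the upper end of the shell, which
    for index 0 is the assumption s \<le> R.\<close>
  define J where "J = (\<lambda>s. LEAST j. R / 2 ^ Suc j < s)"
  have J: "R / 2 ^ Suc (J s) < s" "s \<le> R \<Longrightarrow> s \<le> R / 2 ^ J s" if s: "s > 0" for s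
  proof -
    obtain n where "(1 / 2) ^ n < s / R" using real_arch_pow_inv[of "s / R" "1 / 2"] s R by auto
    then have "R / 2 ^ n < s" using R by (simp add: field_simps power_divide)
    moreover have "R / 2 ^ Suc n \<le> R / 2 ^ n" using R by (intro divide_left_mono) auto
    ultimately have "R / 2 ^ Suc n < s" by linarith
    then show "R / 2 ^ Suc (J s) < s" unfolding J_def by (rule LeastI)
    show "s \<le> R / 2 ^ J s" if "s \<le> R"
    proof (cases "J s")
      case 0
      then show ?thesis using that by simp
    next
      case (Suc i)
      then have "\<not> R / 2 ^ Suc i < s" using not_less_Least[of i "\<lambda>j. R / 2 ^ Suc j < s"] unfolding J_def by simp
      then show ?thesis using Suc by simp
    qed
  qed
  have inner: "sum g {s \<in> S. J s = j} \<le> K * r ^ j" if S: "finite S" "S \<subseteq> {0<..R}" for S j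
  proof -
    let ?S = "{s \<in> S. J s = j}"
    let ?\<sigma> = "R / 2 ^ Suc j"
    have \<sigma>: "?\<sigma> > 0" using R by simp
    have "g s \<le> real (coeffs.dim (eig s)) * (R / 2 ^ j) powr p" if "s \<in> ?S" for s
    proof -
      have "s > 0" "s \<le> R" "J s = j" using that S by auto
      then have "s powr p \<le> (R / 2 ^ j) powr p" using J(2)[of s] p by (intro powr_mono2) auto
      then show ?thesis unfolding g_def by (intro mult_left_mono) auto
    qed
    then have "sum g ?S \<le> (\<Sum>s\<in>?S. real (coeffs.dim (eig s)) * (R / 2 ^ j) powr p)" by (rule sum_mono)
    also have "\<dots> = real (\<Sum>s\<in>?S. coeffs.dim (eig s)) * (R / 2 ^ j) powr p" by (simp add: sum_distrib_right)
    also have "\<dots> \<le> (2 * (D / ?\<sigma> + 1)\<^sup>2) * (R / 2 ^ j) powr p"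
    proof (rule mult_right_mono)
      have lower: "?\<sigma> \<le> s" if "s \<in> ?S" for s
      proof -
        have "s > 0" "J s = j" using that S(2) by auto
        then show ?thesis using J(1)[of s] by simp
      qed
      have "finite ?S" using S(1) by simp
      from sum_dim_eig_le'[OF this lower \<sigma>]
      show "real (\<Sum>s\<in>?S. coeffs.dim (eig s)) \<le> 2 * (D / ?\<sigma> + 1)\<^sup>2" unfolding D_def .
    qed simp
    also have "\<dots> \<le> (2 * ((2 * D / R + 1) * 2 ^ j)\<^sup>2) * (R / 2 ^ j) powr p"
    proof (intro mult_right_mono mult_left_mono power_mono)
      have "(1::real) \<le> 2 ^ j" by simp
      moreover have "D / ?\<sigma> = 2 * D / R * 2 ^ j" by (simp add: mult.left_commute)
      moreover have "(2 * D / R + 1) * 2 ^ j = 2 * D / R * 2 ^ j + 2 ^ j" by (simp only: distrib_right mult_1_left)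
      ultimately show "D / ?\<sigma> + 1 \<le> (2 * D / R + 1) * 2 ^ j" by linarith
      show "0 \<le> D / ?\<sigma> + 1" using D \<sigma> by (intro add_nonneg_nonneg divide_nonneg_pos) auto
    qed auto
    also have "\<dots> = K * r ^ j"
    proof -
      have pow: "(2 ^ j) powr p = ((2::real) powr p) ^ j" for j :: nat
        by (induction j) (simp_all add: powr_mult)
      then have 1: "(R / 2 ^ j) powr p = R powr p * (2 powr (- p)) ^ j"
        using R by (simp add: powr_divide pow powr_minus power_inverse divide_inverse[of "R powr p"])
      have 2: "((2 * D / R + 1) * 2 ^ j)\<^sup>2 = (2 * D / R + 1)\<^sup>2 * 4 ^ j"
        unfolding power_mult_distrib power_mult[symmetric] mult.commute[of j 2] unfolding power_mult by simp
      show ?thesis unfolding 1 2 K_def r_def power_mult_distrib[of 4] by (simp only: mult_ac)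
    qed
    finally show ?thesis .
  qed
  have g_nonneg: "g s \<ge> 0" for s by (simp add: g_def)
  have bounded: "sum g S \<le> K / (1 - r)" if S: "finite S" "S \<subseteq> {0<..}" for S
  proof -
    let ?S = "{s \<in> S. s \<le> R}"
    have "sum g S = sum g ?S"
    proof (rule sum.mono_neutral_right)
      show "\<forall>s\<in>S - ?S. g s = 0"
      proof
        fix s assume "s \<in> S - ?S"
        then have "2 * C < s" by (auto simp: R_def)
        then show "g s = 0" unfolding g_def dim_eig_large[OF \<open>2 * C < s\<close>] by simp
      qed
    qed (use S in auto)
    also have "\<dots> = (\<Sum>j\<in>J ` ?S. sum g {s \<in> ?S. J s = j})"
      by (rule sum.image_gen) (use S in simp)
    also have "\<dots> \<le> (\<Sum>j\<in>J ` ?S. K * r ^ j)"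
      by (intro sum_mono inner) (use S in auto)
    also have "\<dots> = K * (\<Sum>j\<in>J ` ?S. r ^ j)" by (simp add: sum_distrib_left)
    also have "\<dots> \<le> K * (1 / (1 - r))"
    proof (rule mult_left_mono[OF _ K])
      have "(\<Sum>j\<in>J ` ?S. r ^ j) \<le> suminf (\<lambda>j. r ^ j)"
        using r S by (intro sum_le_suminf summable_geometric) auto
      then show "(\<Sum>j\<in>J ` ?S. r ^ j) \<le> 1 / (1 - r)" using r by (simp add: suminf_geometric)
    qed
    finally show ?thesis by simp
  qed
  have "g summable_on {s. s > 0}"
  proof (rule nonneg_bdd_above_summable_on)
    show "bdd_above (sum g ` {F. F \<subseteq> {s. s > 0} \<and> finite F})"
      using bounded by (intro bdd_aboveI[of _ "K / (1 - r)"]) (auto simp: greaterThan_def)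
  qed (rule g_nonneg)
  then show ?thesis unfolding g_def singular_mult_eq .
qed

theorem in_schatten_class: "p > 2 \<Longrightarrow> A \<in> schatten_class t N p"
  using compact singular_values_summable by (simp add: schatten_class_def)

end

section \<open>The commutators on the closure of an ideal\<close>

text \<open>Carries an estimate from the ideal to its closure. Here a is a number attached to the
  limit f, and the error of replacing f by g is charged to the norm for t, in which the
  approximation takes place. That norm dominates the one for t + n, so the term with g converges as
  well.\<close>

lemma hclosure_bound:
  assumes t: "t \<ge> - 2" and X: "X \<subseteq> hspace t" and f: "f \<in> hclosure t X" and cK: "c \<ge> 0" "K \<ge> 0"
    and le: "\<And>g. g \<in> X \<Longrightarrow> a \<le> c * hnorm (t + real n) g + K * hnorm t (f - g)"
  shows "a \<le> c * hnorm (t + real n) f"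
proof (rule field_le_epsilon)
  fix e :: real assume e: "e > 0"
  have tn: "t + real n \<ge> - 2" using t by simp
  have fH: "f \<in> hspace t" using f by (simp add: hclosure_def)
  have "e / (c + K + 1) > 0" using e cK by simp
  then obtain g where g: "g \<in> X" "hnorm t (f - g) < e / (c + K + 1)"
    using f unfolding hclosure_def by blast
  have gH: "g \<in> hspace t" using g X by blast
  have d: "hnorm (t + real n) (f - g) \<le> hnorm t (f - g)"
    using nsq_antimono[OF t hspace_diff[OF t fH gH], of n] by (simp add: hnorm_sqrt)
  have "hnorm (t + real n) (f - (f - g)) \<le> hnorm (t + real n) f + hnorm (t + real n) (f - g)"
    using nsq_antimono[OF t] fH hspace_diff[OF t fH gH] by (intro hnorm_triangle_diff tn) blast+
  then have "hnorm (t + real n) g \<le> hnorm (t + real n) f + hnorm t (f - g)" using d by simp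
  then have "c * hnorm (t + real n) g \<le> c * (hnorm (t + real n) f + hnorm t (f - g))" using cK by (intro mult_left_mono)
  then have "a \<le> c * hnorm (t + real n) f + (c + K) * hnorm t (f - g)"
    using le[OF g(1)] by (simp add: distrib_left distrib_right)
  also have "(c + K) * hnorm t (f - g) \<le> (c + K + 1) * hnorm t (f - g)" using t by (intro mult_right_mono) auto
  also have "(c + K + 1) * hnorm t (f - g) \<le> e" using g(2) cK by (simp add: pos_less_divide_eq mult.commute)
  finally show "a \<le> c * hnorm (t + real n) f + e" by simp
qed

text \<open>
  T is one of the two coordinate multiplications, S its adjoint on the whole space; m and P are
  their counterparts on polynomials.
\<close>

locale coordinate =
  fixes t :: real and T S :: "coeffs \<Rightarrow> coeffs" and m :: cpoly2 and P :: "cpoly2 \<Rightarrow> cpoly2"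
  assumes t: "t \<ge> - 2"
    and T_add: "T (f + g) = T f + T g" and T_scale: "T (cscale c f) = cscale c (T f)"
    and S_add: "S (f + g) = S f + S g" and S_scale: "S (cscale c f) = cscale c (S f)"
    and T_bounded: "f \<in> hspace t \<Longrightarrow> T f \<in> hspace t \<and> nsq t (T f) \<le> nsq t f"
    and S_bounded: "f \<in> hspace t \<Longrightarrow> S f \<in> hspace t \<and> nsq t (S f) \<le> (3 + t) * nsq t f"
    and T_adj: "hinner t (T f) g = hinner t f (S g)"
    and T_lookup: "T (lk u) = lk (m * u)" and S_lookup: "S (lk u) = lk (P u)"
    and P: "psi (3 + t) 0 P"
begin

lemma T_diff: "T (f - g) = T f - T g"
  unfolding diff_eq_add_cscale T_add T_scale ..

lemma S_diff: "S (f - g) = S f - S g"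
  unfolding diff_eq_add_cscale S_add S_scale ..

lemma T_in: "f \<in> hspace t \<Longrightarrow> T f \<in> hspace t" and S_in: "f \<in> hspace t \<Longrightarrow> S f \<in> hspace t"
  using T_bounded S_bounded by blast+

lemma hnorm_T_le: "f \<in> hspace t \<Longrightarrow> hnorm t (T f) \<le> hnorm t f"
  using T_bounded by (simp add: hnorm_sqrt)

lemma hnorm_S_le: "f \<in> hspace t \<Longrightarrow> hnorm t (S f) \<le> sqrt (3 + t) * hnorm t f"
  using S_bounded unfolding hnorm_sqrt real_sqrt_mult[symmetric] by (intro real_sqrt_le_mono) blast

end

lemma coordinate_x:
  assumes t: "t \<ge> - 2"
  shows "coordinate t mult_x (Sx t 0) polyX (\<lambda>u. Rop (3 + t) 0 (dx u))"
proof
  show "mult_x f \<in> hspace t \<and> nsq t (mult_x f) \<le> nsq t f" if "f \<in> hspace t" for f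
    by (rule mult_x_bounded[OF t that])
  show "Sx t 0 f \<in> hspace t \<and> nsq t (Sx t 0 f) \<le> (3 + t) * nsq t f" if "f \<in> hspace t" for f
    using Sx_bounded[OF t order_refl, of f 0 0] that by simp
  show "hinner t (mult_x f) g = hinner t f (Sx t 0 g)" for f g by (rule hinner_mult_x[OF t])
  show "mult_x (lk u) = lk (polyX * u)" for u by (simp only: mult_x_lookup polyX_def)
  show "Sx t 0 (lk u) = lk (Rop (3 + t) 0 (dx u))" for u by (rule Sx_lookup)
  show "psi (3 + t) 0 (\<lambda>u. Rop (3 + t) 0 (dx u))" by (rule psi.Rdx) simp
qed (use t in \<open>auto simp: mult_x_def Sx_def cscale_def fun_eq_iff algebra_simps\<close>)

lemma coordinate_y:
  assumes t: "t \<ge> - 2"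
  shows "coordinate t mult_y (Sy t 0) polyY (\<lambda>u. Rop (3 + t) 0 (dy u))"
proof
  show "mult_y f \<in> hspace t \<and> nsq t (mult_y f) \<le> nsq t f" if "f \<in> hspace t" for f
    by (rule mult_y_bounded[OF t that])
  show "Sy t 0 f \<in> hspace t \<and> nsq t (Sy t 0 f) \<le> (3 + t) * nsq t f" if "f \<in> hspace t" for f
    using Sy_bounded[OF t order_refl, of f 0 0] that by simp
  show "hinner t (mult_y f) g = hinner t f (Sy t 0 g)" for f g by (rule hinner_mult_y[OF t])
  show "mult_y (lk u) = lk (polyY * u)" for u by (simp only: mult_y_lookup polyY_def)
  show "Sy t 0 (lk u) = lk (Rop (3 + t) 0 (dy u))" for u by (rule Sy_lookup)
  show "psi (3 + t) 0 (\<lambda>u. Rop (3 + t) 0 (dy u))" by (rule psi.Rdy) simp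
qed (use t in \<open>auto simp: mult_y_def Sy_def cscale_def fun_eq_iff algebra_simps\<close>)

definition ideal :: "cpoly2 set \<Rightarrow> bool" where
  "ideal I \<longleftrightarrow> 0 \<in> I \<and> (\<forall>g\<in>I. \<forall>h\<in>I. g + h \<in> I) \<and> (\<forall>g\<in>I. \<forall>u. u * g \<in> I)"

lemma ideal_span: "ideal (cpoly2.span G)"
  unfolding ideal_def using cpoly2.span_zero cpoly2.span_add cpoly2.span_scale by blast

lemma subspace_lookup_ideal:
  assumes "ideal I"
  shows "coeffs.subspace (lk ` I)"
  unfolding coeffs.subspace_def
proof (intro conjI ballI allI)
  have "lk 0 = 0" by (simp add: fun_eq_iff)
  then show "0 \<in> lk ` I" using assms unfolding ideal_def by (metis imageI)
next
  fix f g assume "f \<in> lk ` I" "g \<in> lk ` I"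
  then obtain u v where "u \<in> I" "v \<in> I" "f = lk u" "g = lk v" by blast
  then have "f + g = lk (u + v)" "u + v \<in> I" using assms by (simp_all only: lk_add ideal_def)
  then show "f + g \<in> lk ` I" by simp
next
  fix c f assume "f \<in> lk ` I"
  then obtain u where "u \<in> I" "f = lk u" by blast
  moreover have "cscale c (lk u) = lk (const c * u)" by (simp add: fun_eq_iff cscale_def lookup_const_times)
  ultimately show "cscale c f \<in> lk ` I" using assms unfolding ideal_def by blast
qed

text \<open>From here on \<open>almost\<close> is all that is used about quasi homogeneity: the
  adjoint, applied to an element of the ideal, misses the ideal by a term that has gained one
  step.\<close>

locale ideal_coordinate = coordinate +
  fixes I :: "cpoly2 set" and N :: "coeffs set"
  assumes I: "ideal I" and N_def: "N = hclosure t (lk ` I)"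
    and almost: "\<exists>C\<ge>0. \<forall>g\<in>I. \<exists>E\<in>I. nsq t (lk (P g - E)) \<le> C * nsq (t + 1) (lk g)"
begin

lemma I_hspace: "lk ` I \<subseteq> hspace t"
  using lookup_in_hspace by blast

lemma N: "closed_subspace t N"
  unfolding N_def by (rule closed_subspace_hclosure[OF t I_hspace subspace_lookup_ideal[OF I]])

lemma NH: "f \<in> N \<Longrightarrow> f \<in> hspace t" and sub: "coeffs.subspace N"
  using N by (auto simp: closed_subspace_def)

lemma I_N: "g \<in> I \<Longrightarrow> lk g \<in> N"
  unfolding N_def using hclosure_superset[OF I_hspace] by blast

lemma T_N:
  assumes f: "f \<in> N"
  shows "T f \<in> N"
proof -
  have "\<exists>g\<in>lk ` I. hnorm t (T f - g) < e" if e: "e > 0" for e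
  proof -
    obtain g where g: "g \<in> I" "hnorm t (f - lk g) < e"
      using f e unfolding N_def hclosure_def by blast
    have "hnorm t (T f - T (lk g)) \<le> hnorm t (f - lk g)"
      unfolding T_diff[symmetric] by (rule hnorm_T_le[OF hspace_diff[OF t NH[OF f] lookup_in_hspace]])
    then have "hnorm t (T f - lk (m * g)) < e" using g(2) unfolding T_lookup by linarith
    moreover have "m * g \<in> I" using I g(1) by (simp add: ideal_def)
    ultimately show ?thesis by blast
  qed
  then show ?thesis unfolding N_def hclosure_def using T_in[OF NH[OF f]] by blast
qed

text \<open>Not the projection itself but its composition with S. By \<open>adjoint_eq\<close> it is
  the adjoint of T in N.\<close>

definition Q :: "coeffs \<Rightarrow> coeffs" where
  "Q f = proj t N (S f)"

lemma Q_N: "f \<in> hspace t \<Longrightarrow> Q f \<in> N"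
  unfolding Q_def by (rule proj_in[OF t N S_in])

lemma hinner_T_Q: "f \<in> N \<Longrightarrow> g \<in> N \<Longrightarrow> hinner t (T f) g = hinner t f (Q g)"
  unfolding Q_def using hinner_proj[OF t N S_in[OF NH]] T_adj by simp

lemma hinner_Q_T: "f \<in> N \<Longrightarrow> g \<in> N \<Longrightarrow> hinner t (Q f) g = hinner t f (T g)"
  using hinner_T_Q[of g f] by (metis hinner_commute)

lemma adjoint_eq: "g \<in> N \<Longrightarrow> adjoint_on t N T g = Q g"
  by (rule adjoint_on_eq[OF t N Q_N[OF NH]]) (simp_all add: hinner_T_Q)

lemma Q_add: "f \<in> N \<Longrightarrow> g \<in> N \<Longrightarrow> Q (f + g) = Q f + Q g"
  unfolding Q_def S_add by (rule proj_add[OF t N]) (use S_in NH in blast)+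

lemma Q_scale: "f \<in> N \<Longrightarrow> Q (cscale c f) = cscale c (Q f)"
  unfolding Q_def S_scale by (rule proj_scale[OF t N S_in[OF NH]])

text \<open>The distance of S f from N is at most that from the element E supplied by
  \<open>almost\<close>. As S has norm at most sqrt (3 + t), the estimate passes from the ideal to
  its closure.\<close>

lemma S_almost_in_N: "\<exists>c\<ge>0. \<forall>f\<in>N. hnorm t (S f - Q f) \<le> c * hnorm (t + 1) f"
proof -
  obtain C where C: "C \<ge> 0" "\<And>g. g \<in> I \<Longrightarrow> \<exists>E\<in>I. nsq t (lk (P g - E)) \<le> C * nsq (t + 1) (lk g)"
    using almost by blast
  have "hnorm t (S f - Q f) \<le> sqrt C * hnorm (t + real 1) f" if f: "f \<in> N" for f
  proof (rule hclosure_bound[OF t I_hspace f[unfolded N_def], of "sqrt C" "sqrt (3 + t)"])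
    fix g' assume "g' \<in> lk ` I"
    then obtain g where g: "g \<in> I" "g' = lk g" by blast
    obtain E where E: "E \<in> I" "nsq t (lk (P g - E)) \<le> C * nsq (t + 1) (lk g)" using C(2)[OF g(1)] by blast
    have H: "S f \<in> hspace t" "S g' \<in> hspace t" "lk E \<in> hspace t" "f - g' \<in> hspace t"
      using S_in NH[OF f] lookup_in_hspace hspace_diff[OF t] unfolding g(2) by blast+
    have 1: "hnorm t (S f - Q f) \<le> hnorm t (S f - lk E)"
      unfolding Q_def by (rule hnorm_diff_proj_le[OF t N H(1) I_N[OF E(1)]])
    have 2: "hnorm t (S f - lk E) \<le> hnorm t (S f - S g') + hnorm t (S g' - lk E)" by (rule hnorm_triangle_sub[OF t H(1,2,3)])
    have 3: "hnorm t (S f - S g') \<le> sqrt (3 + t) * hnorm t (f - g')"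
      unfolding S_diff[symmetric] by (rule hnorm_S_le[OF H(4)])
    have 4: "hnorm t (S g' - lk E) \<le> sqrt C * hnorm (t + real 1) g'"
    proof -
      have "hnorm t (S g' - lk E) = sqrt (nsq t (lk (P g - E)))" unfolding g(2) S_lookup lk_diff hnorm_sqrt ..
      also have "\<dots> \<le> sqrt (C * nsq (t + 1) (lk g))" using E(2) by (rule real_sqrt_le_mono)
      finally show ?thesis by (simp add: g(2) hnorm_sqrt real_sqrt_mult)
    qed
    from 1 2 3 4 show "hnorm t (S f - Q f) \<le> sqrt C * hnorm (t + real 1) g' + sqrt (3 + t) * hnorm t (f - g')"
      by linarith
  qed (use C(1) t in auto)
  then show ?thesis using C(1) by (intro exI[of _ "sqrt C"]) simp
qed

end

text \<open>The two coordinates may coincide, so that four instances cover all commutators. Both are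
  kept general because the adjoint of one commutator is the commutator with the roles
  exchanged.\<close>

locale ideal_coordinates =
  ideal_coordinate t T S m P I N + other: ideal_coordinate t T' S' m' P' I N
  for t T S m P I N T' S' m' P'
begin

text \<open>On polynomials the commutator is, up to sign, \<open>ad m P'\<close>, which has order -1
  and so gains two steps. On the approximation error its two products are bounded separately, each
  by sqrt (3 + t).\<close>

lemma commutator_bound: "\<exists>c\<ge>0. \<forall>f\<in>N. hnorm t (T (S' f) - S' (T f)) \<le> c * hnorm (t + 2) f"
proof -
  have "psi (3 + t) (Suc 0) (ad m P')" by (rule psi_ad[OF _ other.P]) (use t in simp)
  from psi_bounded[OF t this, of 0] obtain C where
    C: "C \<ge> 0" "\<And>u. nsq t (lk (ad m P' u)) \<le> C * nsq (t + 2) (lk u)" by auto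
  have "hnorm t (T (S' f) - S' (T f)) \<le> sqrt C * hnorm (t + real 2) f" if f: "f \<in> N" for f
  proof (rule hclosure_bound[OF t I_hspace f[unfolded N_def], of "sqrt C" "2 * sqrt (3 + t)"])
    fix g' assume "g' \<in> lk ` I"
    then obtain g where g: "g' = lk g" by blast
    define d where "d = f - g'"
    have H: "d \<in> hspace t" "T (S' d) \<in> hspace t" "S' (T d) \<in> hspace t"
      using T_in other.S_in NH[OF f] lookup_in_hspace hspace_diff[OF t] unfolding g d_def by blast+
    have Hg: "T (S' g') - S' (T g') \<in> hspace t"
      using T_in other.S_in lookup_in_hspace hspace_diff[OF t] unfolding g by blast
    have "T (S' f) - S' (T f) = (T (S' g') - S' (T g')) + (T (S' d) - S' (T d))"
    proof -
      have "T (S' d) = T (S' f) - T (S' g')" "S' (T d) = S' (T f) - S' (T g')"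
        unfolding d_def T_diff other.S_diff by (rule refl)+
      then show ?thesis by simp
    qed
    then have "hnorm t (T (S' f) - S' (T f)) \<le> hnorm t (T (S' g') - S' (T g')) + hnorm t (T (S' d) - S' (T d))"
      using hnorm_triangle[OF t Hg hspace_diff[OF t H(2,3)]] by (simp only:)
    also have "hnorm t (T (S' d) - S' (T d)) \<le> hnorm t (T (S' d)) + hnorm t (S' (T d))"
      by (rule hnorm_triangle_diff[OF t H(2,3)])
    also have "hnorm t (T (S' d)) \<le> sqrt (3 + t) * hnorm t d"
      using hnorm_T_le[OF other.S_in[OF H(1)]] other.hnorm_S_le[OF H(1)] by linarith
    also have "hnorm t (S' (T d)) \<le> sqrt (3 + t) * hnorm t d"
    proof -
      have "hnorm t (S' (T d)) \<le> sqrt (3 + t) * hnorm t (T d)" by (rule other.hnorm_S_le[OF T_in[OF H(1)]])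
      also have "\<dots> \<le> sqrt (3 + t) * hnorm t d" using hnorm_T_le[OF H(1)] t by (intro mult_left_mono) auto
      finally show ?thesis .
    qed
    also have "hnorm t (T (S' g') - S' (T g')) \<le> sqrt C * hnorm (t + real 2) g'"
    proof -
      have "T (S' g') - S' (T g') = - lk (ad m P' g)"
        unfolding g other.S_lookup T_lookup ad_def lk_diff by simp
      then have "hnorm t (T (S' g') - S' (T g')) = hnorm t (lk (ad m P' g))" by (simp only: hnorm_minus)
      also have "\<dots> = sqrt (nsq t (lk (ad m P' g)))" by (rule hnorm_sqrt)
      also have "\<dots> \<le> sqrt (C * nsq (t + 2) (lk g))" using C(2) by (rule real_sqrt_le_mono)
      finally show ?thesis by (simp add: g hnorm_sqrt real_sqrt_mult)
    qed
    finally show "hnorm t (T (S' f) - S' (T f)) \<le> sqrt C * hnorm (t + real 2) g' + 2 * sqrt (3 + t) * hnorm t (f - g')"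
      unfolding d_def[symmetric] by (simp add: mult_ac)
  qed (use C(1) t in auto)
  then show ?thesis using C(1) by (intro exI[of _ "sqrt C"]) simp
qed

abbreviation A :: "coeffs \<Rightarrow> coeffs" where "A \<equiv> commutator T (adjoint_on t N T')"

abbreviation B :: "coeffs \<Rightarrow> coeffs" where "B \<equiv> commutator T' (adjoint_on t N T)"

lemma A_eq: "f \<in> N \<Longrightarrow> A f = T (other.Q f) - other.Q (T f)"
  by (simp add: commutator_def other.adjoint_eq T_N)

lemma B_eq: "f \<in> N \<Longrightarrow> B f = T' (Q f) - Q (T' f)"
  by (simp add: commutator_def adjoint_eq other.T_N)

lemma A_N: "f \<in> N \<Longrightarrow> A f \<in> N"
  using coeffs.subspace_diff[OF sub] T_N other.Q_N NH A_eq by simp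

lemma B_N: "f \<in> N \<Longrightarrow> B f \<in> N"
  using coeffs.subspace_diff[OF sub] other.T_N Q_N NH B_eq by simp

lemma operator_on_A: "operator_on N A"
  unfolding operator_on_def
proof (intro conjI ballI allI)
  fix f assume f: "f \<in> N"
  show "A f \<in> N" by (rule A_N[OF f])
  have "A (cscale c f) = cscale c (A f)" for c
    unfolding A_eq[OF f] A_eq[OF coeffs.subspace_scale[OF sub f]] T_scale other.Q_scale[OF f] other.Q_scale[OF T_N[OF f]]
    by (rule coeffs.scale_right_diff_distrib[symmetric])
  then show "A (cscale c f) = cscale c (A f)" for c .
  fix g assume g: "g \<in> N"
  show "A (f + g) = A f + A g"
    unfolding A_eq[OF f] A_eq[OF g] A_eq[OF coeffs.subspace_add[OF sub f g]] T_add other.Q_add[OF f g]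
      other.Q_add[OF T_N[OF f] T_N[OF g]] by (rule add_diff_add)
qed

text \<open>Taking adjoints in N reverses products, so T T'* - T'* T becomes T' T* - T* T'.\<close>

lemma hinner_A_B:
  assumes f: "f \<in> N" and g: "g \<in> N"
  shows "hinner t (A f) g = hinner t f (B g)"
proof -
  have N': "other.Q f \<in> N" "T f \<in> N" "Q g \<in> N" "T' g \<in> N" using f g T_N other.T_N Q_N other.Q_N NH by blast+
  have N'': "T (other.Q f) \<in> N" "other.Q (T f) \<in> N" "T' (Q g) \<in> N" "Q (T' g) \<in> N"
    using N' T_N other.T_N Q_N other.Q_N NH by blast+
  have "hinner t (A f) g = hinner t (T (other.Q f)) g - hinner t (other.Q (T f)) g"
    unfolding A_eq[OF f] by (rule hinner_diff_left[OF t NH NH NH]) fact+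
  also have "hinner t (T (other.Q f)) g = hinner t f (T' (Q g))"
    using hinner_T_Q[OF N'(1) g] other.hinner_Q_T[OF f N'(3)] by simp
  also have "hinner t (other.Q (T f)) g = hinner t f (Q (T' g))"
    using other.hinner_Q_T[OF N'(2) g] hinner_T_Q[OF f N'(4)] by simp
  also have "hinner t f (T' (Q g)) - hinner t f (Q (T' g)) = hinner t f (B g)"
    unfolding B_eq[OF g] by (rule hinner_diff_right[OF t NH NH NH, symmetric]) fact+
  finally show ?thesis .
qed

text \<open>
  With Q and Q' the adjoints in N, u = A f and S' f - Q' f orthogonal to N, this rests on
  <A f, u> = <T S' f - S' T f, u> - <S' f - Q' f, S u - Q u>.
\<close>

lemma A_bound: "\<exists>C>0. \<forall>f\<in>N. nsq t (A f) \<le>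
    C * (hnorm (t + 1) f * hnorm (t + 1) (A f) + hnorm (t + 2) f * hnorm t (A f))"
proof -
  obtain c1 where c1: "c1 \<ge> 0" "\<And>f. f \<in> N \<Longrightarrow> hnorm t (S f - Q f) \<le> c1 * hnorm (t + 1) f"
    using S_almost_in_N by blast
  obtain c2 where c2: "c2 \<ge> 0" "\<And>f. f \<in> N \<Longrightarrow> hnorm t (S' f - other.Q f) \<le> c2 * hnorm (t + 1) f"
    using other.S_almost_in_N by blast
  obtain c3 where c3: "c3 \<ge> 0" "\<And>f. f \<in> N \<Longrightarrow> hnorm t (T (S' f) - S' (T f)) \<le> c3 * hnorm (t + 2) f"
    using commutator_bound by blast
  define C where "C = c1 * c2 + c3 + 1"
  have C: "c1 * c2 \<le> C" "c3 \<le> C" "C > 0" using c1(1) c2(1) c3(1) by (simp_all add: C_def add_nonneg_pos)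
  have t12: "t + 1 \<ge> - 2" "t + 2 \<ge> - 2" using t by simp_all
  have "nsq t (A f) \<le> C * (hnorm (t + 1) f * hnorm (t + 1) (A f) + hnorm (t + 2) f * hnorm t (A f))"
    if f: "f \<in> N" for f
  proof -
    define u where "u = A f"
    define x where "x = S' f - other.Q f"
    define y where "y = T (S' f) - S' (T f)"
    have uN: "u \<in> N" unfolding u_def by (rule A_N[OF f])
    have QN: "other.Q f \<in> N" "other.Q (T f) \<in> N" using other.Q_N NH f T_N by blast+
    have H: "f \<in> hspace t" "u \<in> hspace t" "S' f \<in> hspace t" "other.Q f \<in> hspace t" "S' (T f) \<in> hspace t"
        "other.Q (T f) \<in> hspace t" "T (S' f) \<in> hspace t" "S u \<in> hspace t" "Q u \<in> hspace t"
      using NH f uN QN other.S_in T_in S_in Q_N by blast+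
    have xH: "x \<in> hspace t" and yH: "y \<in> hspace t" using H hspace_diff[OF t] by (simp_all add: x_def y_def)
    have TxH: "T x \<in> hspace t" using T_in xH by blast
    have "u = y + (S' (T f) - other.Q (T f)) - T x"
      unfolding u_def A_eq[OF f] x_def y_def T_diff by simp
    then have "hinner t u u = hinner t (y + (S' (T f) - other.Q (T f)) - T x) u" by (rule arg_cong)
    also have "\<dots> = hinner t y u + hinner t (S' (T f) - other.Q (T f)) u - hinner t (T x) u"
      using hinner_diff_left[OF t hspace_add[OF t yH hspace_diff[OF t H(5,6)]] TxH H(2)]
        hinner_add_left[OF t yH hspace_diff[OF t H(5,6)] H(2)] by simp
    also have "hinner t (S' (T f) - other.Q (T f)) u = 0"
      using hinner_diff_proj[OF t N H(5) uN] unfolding other.Q_def by (metis hinner_commute complex_cnj_zero)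
    also have "hinner t (T x) u = hinner t x (S u)" by (rule T_adj)
    also have "\<dots> = hinner t x (S u - Q u)"
    proof -
      have "hinner t x (Q u) = 0"
        using hinner_diff_proj[OF t N H(3) Q_N[OF H(2)]] unfolding x_def other.Q_def by (metis hinner_commute complex_cnj_zero)
      then show ?thesis using hinner_diff_right[OF t H(8,9) xH] by simp
    qed
    finally have eq: "complex_of_real (nsq t u) = hinner t y u - hinner t x (S u - Q u)"
      by (simp add: hinner_self)
    have "nsq t u = cmod (complex_of_real (nsq t u))" using t by simp
    also have "\<dots> \<le> cmod (hinner t y u) + cmod (hinner t x (S u - Q u))"
      unfolding eq by (rule norm_triangle_ineq4)
    also have "\<dots> \<le> hnorm t y * hnorm t u + hnorm t x * hnorm t (S u - Q u)"
      by (intro add_mono hinner_cauchy_schwarz[OF t] yH xH H(2) hspace_diff[OF t H(8,9)])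
    also have "\<dots> \<le> (c3 * hnorm (t + 2) f) * hnorm t u + (c2 * hnorm (t + 1) f) * (c1 * hnorm (t + 1) u)"
      using c1(2)[OF uN] c2(2)[OF f] c3(2)[OF f] c2(1) c3(1) t t12 unfolding x_def y_def
      by (intro add_mono mult_mono) auto
    also have "\<dots> = c3 * (hnorm (t + 2) f * hnorm t u) + (c1 * c2) * (hnorm (t + 1) f * hnorm (t + 1) u)"
      by (simp only: mult_ac)
    also have "\<dots> \<le> C * (hnorm (t + 2) f * hnorm t u) + C * (hnorm (t + 1) f * hnorm (t + 1) u)"
      using C t t12 by (intro add_mono mult_right_mono mult_nonneg_nonneg) auto
    finally show ?thesis unfolding u_def by (simp add: distrib_left)
  qed
  then show ?thesis using C(3) by blast
qed

lemma commutator_in_schatten_class: "p > 2 \<Longrightarrow> A \<in> schatten_class t N p"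
proof -
  assume p: "p > 2"
  obtain C where C: "C > 0" "\<forall>f\<in>N. nsq t (A f) \<le>
    C * (hnorm (t + 1) f * hnorm (t + 1) (A f) + hnorm (t + 2) f * hnorm t (A f))"
    using A_bound by blast
  have "small_operator t N A B C"
    by standard (use t N operator_on_A B_N hinner_A_B C in blast)+
  then show ?thesis using p by (rule small_operator.in_schatten_class)
qed

end

section \<open>Quasi homogeneous submodules\<close>

lemma qfactor_bounded_below:
  assumes "qfactor n1 n2 f" "n1 > 0" "n2 > 0"
  shows "bounded_below f"
  unfolding bounded_below_def
proof (intro allI impI)
  fix t :: real assume t: "t \<ge> - 2"
  consider "f = polyX" | "f = polyY" | c where "c \<noteq> 0" "f = binom n1 n2 c"
    using assms(1) unfolding qfactor_def by blast
  then show "\<exists>C\<ge>0. \<forall>h. nsq (t + 1) (lk h) \<le> C * nsq t (lk (f * h))"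
  proof cases
    case 1
    then show ?thesis using mult_x_bounded_below[OF t lookup_in_hspace] t
      by (intro exI[of _ "3 + t"]) (simp add: mult_x_lookup polyX_def)
  next
    case 2
    then show ?thesis using mult_y_bounded_below[OF t lookup_in_hspace] t
      by (intro exI[of _ "3 + t"]) (simp add: mult_y_lookup polyY_def)
  next
    case 3
    then show ?thesis using binomial_bounded_below[OF t assms(3,2) 3(1)] unfolding binom_def by blast
  qed
qed

lemma quasi_homogeneous_almost_preserved:
  assumes t: "t \<ge> - 2" and I: "quasi_homogeneous_ideal I" and P: "psi (3 + t) 0 P"
  shows "\<exists>C\<ge>0. \<forall>g\<in>I. \<exists>E\<in>I. nsq t (lk (P g - E)) \<le> C * nsq (t + 1) (lk g)"
proof -
  obtain n1 n2 G where n: "coprime n1 n2" "n1 > 0" "n2 > 0"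
    and G: "\<forall>g\<in>G. \<exists>m. quasi_homogeneous n1 n2 m g" and IG: "I = cpoly2.span G"
    using quasi_homogeneous_ideal_coprime[OF I] by blast
  show ?thesis
  proof (cases "G \<subseteq> {0}")
    case True
    \<comment> \<open>The structure theorem starts from a nonzero generator. The zero ideal is
      preserved exactly.\<close>
    have "I \<subseteq> {0}" unfolding IG by (rule cpoly2.span_minimal[OF True cpoly2.subspace_single_0])
    then have I0: "I = {0}" using cpoly2.span_zero unfolding IG by blast
    have "P (const 0 * 0) = const 0 * P 0" using psi_linear[OF P] by blast
    then have "P 0 = 0" by simp
    then show ?thesis unfolding I0 by (intro exI[of _ 0]) (simp add: nsq_def)
  next
    case False
    then obtain g0 where g0: "g0 \<in> G" "g0 \<noteq> 0" by blast
    obtain L M where L: "\<forall>f\<in>set L. qfactor n1 n2 f" "\<forall>g\<in>I. \<exists>h. g = prod_list L * h"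
      and M: "\<forall>k. M \<le> tdeg k \<longrightarrow> prod_list L * single k 1 \<in> I"
      using quasi_homogeneous_ideal_structure[OF n _ g0] G unfolding IG by blast
    have "prod_list L * v \<in> I" if v: "\<And>k. tdeg k < M \<Longrightarrow> lk v k = 0" for v
    proof -
      have "prod_list L * single k (lk v k) \<in> I" if k: "k \<in> Poly_Mapping.keys v" for k
      proof -
        have "M \<le> tdeg k" using v[of k] k by (metis in_keys_iff not_less)
        then have "prod_list L * single k 1 \<in> I" using M by blast
        then have "const (lk v k) * (prod_list L * single k 1) \<in> I"
          unfolding IG by (rule cpoly2.span_scale)
        moreover have "const (lk v k) * (prod_list L * single k 1) = prod_list L * single k (lk v k)"
          by (simp only: mult.left_commute[of "const (lk v k)"] mult_single add_0_left mult_1_right)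
        ultimately show ?thesis by simp
      qed
      then have "(\<Sum>k\<in>Poly_Mapping.keys v. prod_list L * single k (lk v k)) \<in> I"
        unfolding IG by (rule cpoly2.span_sum)
      then show ?thesis unfolding sum_distrib_left[symmetric] poly_eq_sum_single[symmetric] .
    qed
    from psi_almost_preserves_ideal[OF t _ P _ this] L qfactor_bounded_below n show ?thesis by blast
  qed
qed

theorem corollary3p6:
  fixes t :: real and I :: "cpoly2 set"
  assumes "t \<ge> - 2" and "quasi_homogeneous_ideal I"
  shows "submodule t (hclosure t (Poly_Mapping.lookup ` I)) \<and>
    (\<forall>p > 2. essentially_normal t p (hclosure t (Poly_Mapping.lookup ` I)))"
proof -
  let ?N = "hclosure t (lk ` I)"
  have I: "ideal I" using quasi_homogeneous_ideal_coprime[OF assms(2)] ideal_span by blast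
  interpret cx: coordinate t mult_x "Sx t 0" polyX "\<lambda>u. Rop (3 + t) 0 (dx u)" by (rule coordinate_x[OF assms(1)])
  interpret cy: coordinate t mult_y "Sy t 0" polyY "\<lambda>u. Rop (3 + t) 0 (dy u)" by (rule coordinate_y[OF assms(1)])
  note almost = quasi_homogeneous_almost_preserved[OF assms]
  interpret x: ideal_coordinate t mult_x "Sx t 0" polyX "\<lambda>u. Rop (3 + t) 0 (dx u)" I ?N
    by standard (use I almost[OF cx.P] in auto)
  interpret y: ideal_coordinate t mult_y "Sy t 0" polyY "\<lambda>u. Rop (3 + t) 0 (dy u)" I ?N
    by standard (use I almost[OF cy.P] in auto)
  interpret xx: ideal_coordinates t mult_x "Sx t 0" polyX "\<lambda>u. Rop (3 + t) 0 (dx u)" I ?N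
    mult_x "Sx t 0" polyX "\<lambda>u. Rop (3 + t) 0 (dx u)" ..
  interpret xy: ideal_coordinates t mult_x "Sx t 0" polyX "\<lambda>u. Rop (3 + t) 0 (dx u)" I ?N
    mult_y "Sy t 0" polyY "\<lambda>u. Rop (3 + t) 0 (dy u)" ..
  interpret yx: ideal_coordinates t mult_y "Sy t 0" polyY "\<lambda>u. Rop (3 + t) 0 (dy u)" I ?N
    mult_x "Sx t 0" polyX "\<lambda>u. Rop (3 + t) 0 (dx u)" ..
  interpret yy: ideal_coordinates t mult_y "Sy t 0" polyY "\<lambda>u. Rop (3 + t) 0 (dy u)" I ?N
    mult_y "Sy t 0" polyY "\<lambda>u. Rop (3 + t) 0 (dy u)" ..
  have "submodule t ?N"
    using x.N x.T_N y.T_N by (simp add: submodule_def closed_subspace_def)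
  moreover have "essentially_normal t p ?N" if "p > 2" for p
    using xx.commutator_in_schatten_class[OF that] xy.commutator_in_schatten_class[OF that]
      yx.commutator_in_schatten_class[OF that] yy.commutator_in_schatten_class[OF that]
    by (simp add: essentially_normal_def)
  ultimately show ?thesis by blast
qed

end
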